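(* Let $X$ be a Banach space and $Y$ be a Hilbert space. Suppose $k:\mathbb{R}^d\to \mathcal{L}(X,Y)$ is strongly measurable and satisfies the $2$-Hörmander condition: there is a constant $C$ such that $$\Big(\int_{\{s:\,\frac{1}{2}|s| \geq |t|\}} \|k(s-t)-k(s)\|^2\,\mathrm{d} s\Big)^{1/2} \leq C, \qquad t \in \mathbb{R}^d.$$ Let $K(s,t) = k(s-t)$. Then the following are equivalent: (i) $\|t\mapsto k(t)x\|_{L^2(\mathbb{R}^d;Y)}\leq A_0 \,\|x\|$ for all $x\in X$, for some $A_0>0$; (ii) $K \in \mathcal{K}_\gamma(L^{p}(\mathbb{R}^d))$ for all $p\in [2, \infty)$; (iii) $K \in \mathcal{K}_\gamma(L^{p,\infty}(\mathbb{R}^d))$ for some $p\in [2, \infty)$. In particular, for all $p \in [2,\infty)$ and $A_0$ as in (i), $$\|K\|_{\mathcal{K}_\gamma(L^p(\mathbb{R}^d))} \leq C_{p,d} \, (A_0 + \|K\|_{2\text{-Hörm}}),$$ where $C_{p,d}$ depends only on $p$ and $d$.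
   Context: $k$ strongly measurable means that $t\mapsto k(t)x$ is strongly measurable for each $x\in X$. $\gamma(\mathbb{R}^d;Y):=\gamma(L^2(\mathbb{R}^d),Y)$, where for a Hilbert space $\mathcal{H}$, $\gamma(\mathcal{H},Y)$ is the completion of the finite rank operators $T=\sum_{j=1}^n e_j\otimes x_j$ ($e_j\in\mathcal{H}$ orthonormal, $x_j\in Y$) under $\|T\|=(\mathbb{E}\|\sum_j\gamma_jx_j\|_Y^2)^{1/2}$, with $(\gamma_j)$ independent standard Gaussians; a function $f:\mathbb{R}^d\to Y$ is identified with the operator $\varphi\mapsto\int f\varphi$ on $L^2(\mathbb{R}^d)$. (For $Y$ a Hilbert space, $\gamma(\mathbb{R}^d;Y)=L^2(\mathbb{R}^d;Y)$.) $K\in\mathcal{K}_\gamma(L^p(\mathbb{R}^d))$ (resp. $K\in\mathcal{K}_\gamma(L^{p,\infty}(\mathbb{R}^d))$) means that for each $f\in L^p(\mathbb{R}^d;X)$ and a.e. $s$ the function $T_Kf(s):=K(s,\cdot)f(\cdot)$ is in $\gamma(\mathbb{R}^d;Y)$ and $T_K$ is bounded from $L^p(\mathbb{R}^d;X)$ into $L^p(\mathbb{R}^d;\gamma(\mathbb{R}^d;Y))$ (resp. into weak $L^p$, $L^{p,\infty}(\mathbb{R}^d;\gamma(\mathbb{R}^d;Y))$); $\|K\|_{\mathcal{K}_\gamma(\cdot)}$ is the corresponding operator norm. $\|K\|_{2\text{-Hörm}}$ is the least constant $C$ such that for every ball $B\subseteq\mathbb{R}^d$ (with $\frac12B$ the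 ball with the same center and half the radius) $\big(\int_{\mathbb{R}^d\setminus B}\|K(s,t)-K(s',t)\|^2\mathrm{d}t\big)^{1/2}\le C$ for $s,s'\in\frac12B$ and $\big(\int_{\mathbb{R}^d\setminus B}\|K(s,t)-K(s,t')\|^2\mathrm{d}s\big)^{1/2}\le C$ for $t,t'\in\frac12B$; for convolution kernels finiteness of this constant is the displayed condition on $k$ (the constants being comparable). *)

theory Defs
  imports "HOL-Probability.Probability"
begin

text \<open>All spaces are real. Functions on \<open>\<real>\<^sup>d\<close> are not quotiented by almost everywhere equality.\<close>

subsection \<open>Strong measurability and (weak) \<open>L\<^sup>p\<close>-norms\<close>

text \<open>
  The spaces \<open>X\<close> and \<open>Y\<close> need not be separable, so Borel measurability is not
  enough (and the Bochner integral of the library, which needs a second countable range, is not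
  available).
\<close>

definition strongly_measurable :: "('d::euclidean_space \<Rightarrow> 'x::real_normed_vector) \<Rightarrow> bool"
  where "strongly_measurable f \<longleftrightarrow>
    (\<exists>g :: nat \<Rightarrow> 'd \<Rightarrow> 'x. (\<forall>n. simple_function lebesgue (g n)) \<and>
       (AE t in lebesgue. (\<lambda>n. g n t) \<longlonglongrightarrow> f t))"

text \<open>Only used with exponents \<open>a > 0\<close>.\<close>

definition ennreal_rpow :: "ennreal \<Rightarrow> real \<Rightarrow> ennreal"
  where "ennreal_rpow x a = (if x = \<top> then \<top> else ennreal (enn2real x powr a))"

definition Lp_norm_on ::
    "'d::euclidean_space set \<Rightarrow> real \<Rightarrow> ('d \<Rightarrow> 'x::real_normed_vector) \<Rightarrow> ennreal"
  where "Lp_norm_on A p f =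
    ennreal_rpow (\<integral>\<^sup>+ t \<in> A. ennreal (norm (f t) powr p) \<partial>lebesgue) (1 / p)"

abbreviation Lp_norm :: "real \<Rightarrow> ('d::euclidean_space \<Rightarrow> 'x::real_normed_vector) \<Rightarrow> ennreal"
  where "Lp_norm \<equiv> Lp_norm_on UNIV"

definition weak_Lp_norm :: "real \<Rightarrow> ('d::euclidean_space \<Rightarrow> 'x::real_normed_vector) \<Rightarrow> ennreal"
  where "weak_Lp_norm p f =
    (SUP l \<in> {0<..}. ennreal l * ennreal_rpow (emeasure lebesgue {t. norm (f t) > l}) (1 / p))"

definition Lp_space :: "real \<Rightarrow> ('d::euclidean_space \<Rightarrow> 'x::real_normed_vector) set"
  where "Lp_space p = {f. strongly_measurable f \<and> Lp_norm p f < \<top>}"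


subsection \<open>The space \<open>\<gamma>(\<real>\<^sup>d; Y)\<close>\<close>

definition L2 :: "('d::euclidean_space \<Rightarrow> real) set"
  where "L2 = {\<phi>. \<phi> \<in> borel_measurable lebesgue \<and> integrable lebesgue (\<lambda>t. (\<phi> t)\<^sup>2)}"

definition L2_inner :: "('d::euclidean_space \<Rightarrow> real) \<Rightarrow> ('d \<Rightarrow> real) \<Rightarrow> real"
  where "L2_inner \<phi> \<psi> = (LINT t|lebesgue. \<phi> t * \<psi> t)"

definition L2_orthonormal :: "nat \<Rightarrow> (nat \<Rightarrow> 'd::euclidean_space \<Rightarrow> real) \<Rightarrow> bool"
  where "L2_orthonormal n e \<longleftrightarrow>
    (\<forall>i<n. e i \<in> L2) \<and> (\<forall>i<n. \<forall>j<n. L2_inner (e i) (e j) = (if i = j then 1 else 0))"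

text \<open>The coordinates of the product measure are independent standard Gaussians.\<close>

definition gaussian_norm :: "nat \<Rightarrow> (nat \<Rightarrow> 'y::real_normed_vector) \<Rightarrow> real"
  where "gaussian_norm n x =
    sqrt (LINT \<omega>|(\<Pi>\<^sub>M j\<in>{..<n}. density lborel (\<lambda>u. ennreal (std_normal_density u))).
      (norm (\<Sum>j<n. \<omega> j *\<^sub>R x j))\<^sup>2)"

text \<open>
  An operator \<open>L\<^sup>2(\<real>\<^sup>d) \<rightarrow> Y\<close> is a map on functions of which only the values on \<^const>\<open>L2\<close> matter.
\<close>

type_synonym ('d, 'y) L2_op = "('d \<Rightarrow> real) \<Rightarrow> 'y"

definition finite_rank_rep ::
    "('d::euclidean_space, 'y::real_normed_vector) L2_op \<Rightarrow> nat \<Rightarrow> (nat \<Rightarrow> 'd \<Rightarrow> real) \<Rightarrow> (nat \<Rightarrow> 'y) \<Rightarrow> bool"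
  where "finite_rank_rep T n e x \<longleftrightarrow>
    L2_orthonormal n e \<and> (\<forall>\<phi>\<in>L2. T \<phi> = (\<Sum>j<n. L2_inner (e j) \<phi> *\<^sub>R x j))"

definition finite_rank :: "('d::euclidean_space, 'y::real_normed_vector) L2_op \<Rightarrow> bool"
  where "finite_rank T \<longleftrightarrow> (\<exists>n e x. finite_rank_rep T n e x)"

definition gamma_norm_fin :: "('d::euclidean_space, 'y::real_normed_vector) L2_op \<Rightarrow> real"
  where "gamma_norm_fin T = (THE c. \<exists>n e x. finite_rank_rep T n e x \<and> c = gaussian_norm n x)"

text \<open>
  The \<open>\<gamma>\<close>-norm dominates the operator norm, so an element of the completion, a \<open>\<gamma>\<close>-Cauchy sequence
  \<open>S\<close> of finite rank operators, is identified with the limit \<open>T\<close> of \<open>S\<close> as an operator.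
\<close>

definition gamma_limit ::
    "(nat \<Rightarrow> ('d::euclidean_space, 'y::real_normed_vector) L2_op) \<Rightarrow> ('d, 'y) L2_op \<Rightarrow> bool"
  where "gamma_limit S T \<longleftrightarrow>
    (\<forall>n. finite_rank (S n)) \<and>
    (\<forall>\<epsilon>>0. \<exists>N. \<forall>m\<ge>N. \<forall>n\<ge>N. gamma_norm_fin (\<lambda>\<phi>. S m \<phi> - S n \<phi>) < \<epsilon>) \<and>
    (\<forall>\<phi>\<in>L2. (\<lambda>n. S n \<phi>) \<longlonglongrightarrow> T \<phi>)"

definition gamma_space :: "('d::euclidean_space, 'y::real_normed_vector) L2_op set"
  where "gamma_space = {T. \<exists>S. gamma_limit S T}"

definition gamma_norm :: "('d::euclidean_space, 'y::real_normed_vector) L2_op \<Rightarrow> real"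
  where "gamma_norm T = (THE c. \<exists>S. gamma_limit S T \<and> (\<lambda>n. gamma_norm_fin (S n)) \<longlonglongrightarrow> c)"

text \<open>\<open>T \<phi> = \<integral> f(t) \<phi>(t) dt\<close> for all \<open>\<phi> \<in> L\<^sup>2\<close>, as a weak (Pettis) integral.\<close>

definition represents ::
    "('d::euclidean_space \<Rightarrow> 'y::real_normed_vector) \<Rightarrow> ('d, 'y) L2_op \<Rightarrow> bool"
  where "represents f T \<longleftrightarrow> strongly_measurable f \<and>
    (\<forall>\<phi>\<in>L2. \<forall>l :: 'y \<Rightarrow> real. bounded_linear l \<longrightarrow>
       integrable lebesgue (\<lambda>t. l (f t) * \<phi> t) \<and>
       l (T \<phi>) = (LINT t|lebesgue. l (f t) * \<phi> t))"

definition gamma_strongly_measurable ::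
    "('d::euclidean_space \<Rightarrow> ('d, 'y::real_normed_vector) L2_op) \<Rightarrow> bool"
  where "gamma_strongly_measurable F \<longleftrightarrow>
    (\<exists>G :: nat \<Rightarrow> 'd \<Rightarrow> ('d, 'y) L2_op.
       (\<forall>n. simple_function lebesgue (G n) \<and> (\<forall>s. G n s \<in> gamma_space)) \<and>
       (AE s in lebesgue. (\<lambda>n. gamma_norm (\<lambda>\<phi>. G n s \<phi> - F s \<phi>)) \<longlonglongrightarrow> 0))"


subsection \<open>The classes \<open>\<K>\<^sub>\<gamma>(L\<^sup>p)\<close> and \<open>\<K>\<^sub>\<gamma>(L\<^sup>p\<^sup>,\<^sup>\<infinity>)\<close>\<close>

text \<open>
  \<open>F\<close> is \<open>s \<mapsto> K(s,\<cdot>)f(\<cdot>)\<close> as a \<open>\<gamma>(\<real>\<^sup>d; Y)\<close>-valued function (\<open>F s\<close> is unique on \<^const>\<open>L2\<close> for almost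
  every \<open>s\<close>).
\<close>

definition is_T ::
    "('d::euclidean_space \<Rightarrow> 'd \<Rightarrow> 'x::banach \<Rightarrow>\<^sub>L 'y::banach) \<Rightarrow> ('d \<Rightarrow> 'x) \<Rightarrow>
      ('d \<Rightarrow> ('d, 'y) L2_op) \<Rightarrow> bool"
  where "is_T K f F \<longleftrightarrow>
    (AE s in lebesgue. F s \<in> gamma_space \<and> represents (\<lambda>t. blinfun_apply (K s t) (f t)) (F s))"

text \<open>
  The norm \<open>N\<close> on the target side is \<^term>\<open>Lp_norm p\<close> or \<^term>\<open>weak_Lp_norm p\<close>.
\<close>

definition T_bounded_by ::
    "(('d::euclidean_space \<Rightarrow> real) \<Rightarrow> ennreal) \<Rightarrow> real \<Rightarrow>
      ('d \<Rightarrow> 'd \<Rightarrow> 'x::banach \<Rightarrow>\<^sub>L 'y::banach) \<Rightarrow> real \<Rightarrow> bool"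
  where "T_bounded_by N p K C \<longleftrightarrow> 0 \<le> C \<and>
    (\<forall>f\<in>Lp_space p. \<exists>F. is_T K f F \<and> gamma_strongly_measurable F \<and>
       N (\<lambda>s. gamma_norm (F s)) \<le> ennreal C * Lp_norm p f)"

definition K_gamma_Lp ::
    "real \<Rightarrow> ('d::euclidean_space \<Rightarrow> 'd \<Rightarrow> 'x::banach \<Rightarrow>\<^sub>L 'y::banach) set"
  where "K_gamma_Lp p = {K. \<exists>C. T_bounded_by (Lp_norm p) p K C}"

definition K_gamma_weak_Lp ::
    "real \<Rightarrow> ('d::euclidean_space \<Rightarrow> 'd \<Rightarrow> 'x::banach \<Rightarrow>\<^sub>L 'y::banach) set"
  where "K_gamma_weak_Lp p = {K. \<exists>C. T_bounded_by (weak_Lp_norm p) p K C}"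

definition K_gamma_Lp_norm ::
    "real \<Rightarrow> ('d::euclidean_space \<Rightarrow> 'd \<Rightarrow> 'x::banach \<Rightarrow>\<^sub>L 'y::banach) \<Rightarrow> ennreal"
  where "K_gamma_Lp_norm p K = (INF C \<in> {C. T_bounded_by (Lp_norm p) p K C}. ennreal C)"


subsection \<open>Hoermander conditions\<close>

text \<open>
  For non-separable \<open>X\<close> the operator norms below need not be measurable. The nonnegative integral
  of the library is then a lower integral, so this is the weakest reading of the conditions.
\<close>

definition Hormander2_conv :: "('d::euclidean_space \<Rightarrow> 'x::banach \<Rightarrow>\<^sub>L 'y::banach) \<Rightarrow> bool"
  where "Hormander2_conv k \<longleftrightarrow>
    (\<exists>C::real. 0 \<le> C \<and>
      (\<forall>t. Lp_norm_on {s. norm s / 2 \<ge> norm t} 2 (\<lambda>s. k (s - t) - k s) \<le> ennreal C))"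

definition Hormander2_norm ::
    "('d::euclidean_space \<Rightarrow> 'd \<Rightarrow> 'x::banach \<Rightarrow>\<^sub>L 'y::banach) \<Rightarrow> ennreal"
  where "Hormander2_norm K = Inf {C. \<forall>c r. 0 < r \<longrightarrow>
    (\<forall>s \<in> ball c (r / 2). \<forall>s' \<in> ball c (r / 2).
       Lp_norm_on (- ball c r) 2 (\<lambda>t. K s t - K s' t) \<le> C) \<and>
    (\<forall>t \<in> ball c (r / 2). \<forall>t' \<in> ball c (r / 2).
       Lp_norm_on (- ball c r) 2 (\<lambda>s. K s t - K s t') \<le> C)}"

text \<open>
  The constant \<open>C\<^sub>p\<^sub>,\<^sub>d\<close>. An existential quantifier cannot be placed outside the type variables
  standing for \<open>X\<close>, \<open>Y\<close> and \<open>\<real>\<^sup>d\<close>, so independence of everything but \<open>p\<close> and \<open>d\<close> is expressed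
  by a closed term. Its value is generous and has no significance.
\<close>

definition C_pd :: "real \<Rightarrow> nat \<Rightarrow> real"
  where "C_pd p d = (1000 * real d) powr (p + real d)"

end

theory Submission
  imports Defs "HOL-Real_Asymp.Real_Asymp"
begin

text \<open>
  As \<open>Y\<close> is a Hilbert space, \<open>\<gamma>(\<real>\<^sup>d; Y) = L\<^sup>2(\<real>\<^sup>d; Y)\<close>, so with \<open>h = \<parallel>f\<parallel>\<^sup>2\<close> and \<open>\<sigma> = f / \<parallel>f\<parallel>\<close> the square of the
  \<open>\<gamma>\<close>-norm of \<open>T\<^sub>K f(s)\<close> is \<open>W h (s) = \<integral> u(s,t)\<^sup>2 h(t) dt\<close>, where \<open>u(s,t) = \<parallel>k(s-t) \<sigma>(t)\<parallel>\<close>. This is a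
  positive linear operator, and the claim becomes its boundedness on \<open>L\<^sup>q\<close> for \<open>q = p/2\<close>. By (i) its
  adjoint is bounded on \<open>L\<^sup>\<infinity>\<close>, and a Calderon--Zygmund decomposition together with the
  2-Hoermander condition gives the weak type (1,1) of the adjoint. By Marcinkiewicz the adjoint is bounded on all
  \<open>L\<^sup>r\<close> with \<open>r > 1\<close>, hence \<open>W\<close> on all \<open>L\<^sup>q\<close>. The decomposition is made for functions that are constant
  on the cells of a fine grid, where the stopping time argument is finite and Lebesgue's
  differentiation theorem is not needed; open sets are exhausted by such cells, and outer regularity
  passes to all functions. Conversely, a weak type bound tested on \<open>1\<^bsub>B(0,R)\<^esub> x\<close> gives (i) as
  \<open>R\<close> tends to infinity.
\<close>

subsection \<open>Pointwise limits of simple functions\<close>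

text \<open>Passing to |f|^2 halves the exponent, so p \<ge> 2 is exactly q \<ge> 1. Freezing has a
  price: \<sigma>(t) destroys all smoothness in t, and only differences in s stay under control. The
  adjoint integrates in s, so it is the adjoint that is decomposed. Nor does u^2 inherit a
  Hoermander condition from u; the decomposition therefore uses a^2 \<le> 2 b^2 + 2 (a - b)^2, which
  suffices for positive operators. The second obstacle is measurability: X and Y may be
  non-separable and the operator norm of k need not be measurable. Hence for each f the kernel is
  first made jointly Borel off a null set, and the Hoermander bound is applied only to measurable
  functions below the operator norm.\<close>

definition simple_limit :: "'a measure \<Rightarrow> ('a \<Rightarrow> 'b::metric_space) \<Rightarrow> bool"
  where "simple_limit M f \<longleftrightarrow>
    (\<exists>g. (\<forall>n::nat. simple_function M (g n)) \<and> (\<forall>x\<in>space M. (\<lambda>n. g n x) \<longlonglongrightarrow> f x))"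

text \<open>A nearest-point selection that stays simple: only finitely many indices compete at stage
  n, and taking the least minimiser makes the choice measurable. The competitors are points of a
  countable set in one use and operators in another, so the distances are left abstract.\<close>

lemma simple_argmin:
  fixes \<rho> :: "nat \<Rightarrow> 'a \<Rightarrow> ennreal"
  assumes [measurable]: "\<And>i. \<rho> i \<in> borel_measurable M"
  obtains idx :: "nat \<Rightarrow> 'a \<Rightarrow> nat" where "\<And>n. simple_function M (idx n)"
    and "\<And>n x. idx n x \<le> n" and "\<And>n j x. j \<le> n \<Longrightarrow> \<rho> (idx n x) x \<le> \<rho> j x"
proof -
  define idx where "idx n x = (LEAST i. i \<le> n \<and> (\<forall>j\<in>{..n}. \<rho> i x \<le> \<rho> j x))" for n x
  have *: "idx n x \<le> n \<and> (\<forall>j\<in>{..n}. \<rho> (idx n x) x \<le> \<rho> j x)" for n x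
  proof -
    have "\<exists>i\<in>{..n}. \<forall>j\<in>{..n}. \<rho> i x \<le> \<rho> j x"
      using ex_min_if_finite[of "(\<lambda>i. \<rho> i x) ` {..n}"] by (auto simp: not_less)
    then show ?thesis unfolding idx_def
      using LeastI_ex[of "\<lambda>i. i \<le> n \<and> (\<forall>j\<in>{..n}. \<rho> i x \<le> \<rho> j x)"] by auto
  qed
  have "idx n \<in> measurable M (count_space UNIV)" for n
    unfolding idx_def by measurable
  then have "idx n -` {m} \<inter> space M \<in> sets M" for n m
    by (auto intro: measurable_sets)
  moreover have "finite (idx n ` space M)" for n
    by (rule finite_subset[of _ "{..n}"]) (use * in auto)
  ultimately have "simple_function M (idx n)" for n
    by (simp add: simple_function_def)
  then show ?thesis using that[of idx] * by auto
qed

lemma simple_limit_measurable: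
  assumes "simple_limit M f"
  shows "f \<in> borel_measurable M"
proof -
  obtain g where g: "\<forall>n::nat. simple_function M (g n)" "\<forall>x\<in>space M. (\<lambda>n. g n x) \<longlonglongrightarrow> f x"
    using assms unfolding simple_limit_def by blast
  show ?thesis
    by (rule borel_measurable_LIMSEQ_metric[of g]) (use g in \<open>auto intro: borel_measurable_simple_function\<close>)
qed

lemma simple_limit_separable:
  assumes "simple_limit M f"
  obtains D where "countable D" "f ` space M \<subseteq> closure D"
proof -
  obtain g where g: "\<forall>n::nat. simple_function M (g n)" "\<forall>x\<in>space M. (\<lambda>n. g n x) \<longlonglongrightarrow> f x"
    using assms unfolding simple_limit_def by blast
  have "countable (\<Union>n. g n ` space M)"
    using g(1) by (intro countable_UN) (auto simp: simple_function_def intro: countable_finite)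
  moreover have "f ` space M \<subseteq> closure (\<Union>n. g n ` space M)"
  proof safe
    fix x assume "x \<in> space M"
    then show "f x \<in> closure (\<Union>n. g n ` space M)"
      unfolding closure_sequential using g(2) by (intro exI[of _ "\<lambda>n. g n x"]) auto
  qed
  ultimately show ?thesis using that by blast
qed

text \<open>The approximant at stage n is the nearest of the first points of an enumeration of D, so
  its values lie in D itself. This later reduces square integrable functions to countably many
  coefficients.\<close>

lemma simple_limit_values:
  fixes f :: "'a \<Rightarrow> 'b::metric_space"
  assumes f: "f \<in> borel_measurable M" and D: "countable D" "D \<noteq> {}" "f ` space M \<subseteq> closure D"
  obtains g where "\<And>n::nat. simple_function M (g n)" "\<And>n x. g n x \<in> D"
    "\<And>x. x \<in> space M \<Longrightarrow> (\<lambda>n. g n x) \<longlonglongrightarrow> f x"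
proof -
  define d where "d = from_nat_into D"
  have d: "range d = D" unfolding d_def using D by (simp add: range_from_nat_into)
  have m: "(\<lambda>x. ennreal (dist (d i) (f x))) \<in> borel_measurable M" for i
    by (intro measurable_compose[OF f] measurable_compose[OF _ measurable_ennreal]
        borel_measurable_continuous_onI continuous_intros)
  obtain idx :: "nat \<Rightarrow> 'a \<Rightarrow> nat" where idx: "\<And>n. simple_function M (idx n)" "\<And>n x. idx n x \<le> n"
    "\<And>n j x. j \<le> n \<Longrightarrow> ennreal (dist (d (idx n x)) (f x)) \<le> ennreal (dist (d j) (f x))"
    by (rule simple_argmin[of "\<lambda>i x. ennreal (dist (d i) (f x))" M, OF m]) (rule that)
  have "(\<lambda>n. d (idx n x)) \<longlonglongrightarrow> f x" if x: "x \<in> space M" for x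
  proof (rule metric_LIMSEQ_I)
    fix r :: real assume "0 < r"
    then obtain y where "y \<in> D" "dist y (f x) < r"
      using D(3) x closure_approachable[of "f x" D] by blast
    then obtain j where j: "dist (d j) (f x) < r" using d by auto
    have "dist (d (idx n x)) (f x) < r" if "n \<ge> j" for n
      using idx(3)[OF that, of x] j by simp
    then show "\<exists>no. \<forall>n\<ge>no. dist (d (idx n x)) (f x) < r" by blast
  qed
  moreover have "simple_function M (\<lambda>x. d (idx n x))" for n
    using simple_function_compose1[OF idx(1)] .
  moreover have "d i \<in> D" for i using d by auto
  ultimately show ?thesis using that[of "\<lambda>n x. d (idx n x)"] by blast
qed

lemma simple_limit_iff:
  "simple_limit M f \<longleftrightarrow> f \<in> borel_measurable M \<and> (\<exists>D. countable D \<and> f ` space M \<subseteq> closure D)"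
proof
  assume "simple_limit M f"
  then show "f \<in> borel_measurable M \<and> (\<exists>D. countable D \<and> f ` space M \<subseteq> closure D)"
    using simple_limit_measurable[of M f] simple_limit_separable[of M f] by blast
next
  assume a: "f \<in> borel_measurable M \<and> (\<exists>D. countable D \<and> f ` space M \<subseteq> closure D)"
  then obtain D where D: "countable D" "f ` space M \<subseteq> closure D" by blast
  \<comment> \<open>\<open>simple_limit_values\<close> enumerates its set; an arbitrary extra point
    makes it nonempty.\<close>
  then have "countable (insert undefined D)" "insert undefined D \<noteq> {}"
    "f ` space M \<subseteq> closure (insert undefined D)"
    using closure_mono[of D "insert undefined D"] by auto
  from simple_limit_values[OF conjunct1[OF a] this] show "simple_limit M f"
    unfolding simple_limit_def by metis
qed

lemma simple_limit_LIMSEQ: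
  assumes "\<And>n::nat. simple_limit M (f n)" "\<And>x. x \<in> space M \<Longrightarrow> (\<lambda>n. f n x) \<longlonglongrightarrow> g x"
  shows "simple_limit M g"
proof -
  have "\<forall>n. \<exists>D. countable D \<and> f n ` space M \<subseteq> closure D"
    using assms(1) simple_limit_iff by blast
  then obtain D where D: "\<And>n. countable (D n)" "\<And>n. f n ` space M \<subseteq> closure (D n)" by metis
  have "g x \<in> closure (\<Union>n. D n)" if x: "x \<in> space M" for x
  proof (rule Lim_in_closed_set[OF closed_closure _ _ assms(2)[OF x]])
    have "f n x \<in> closure (\<Union>n. D n)" for n
    proof -
      have "closure (D n) \<subseteq> closure (\<Union>n. D n)" by (rule closure_mono) auto
      then show ?thesis using D(2)[of n] x by auto
    qed
    then show "\<forall>\<^sub>F n in sequentially. f n x \<in> closure (\<Union>n. D n)" by simp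
  qed simp
  moreover have "g \<in> borel_measurable M"
    by (rule borel_measurable_LIMSEQ_metric[OF simple_limit_measurable[OF assms(1)] assms(2)])
  ultimately show ?thesis using D(1) by (auto simp: simple_limit_iff intro!: exI[of _ "\<Union>n. D n"])
qed

lemma simple_limit_simple: "simple_function M f \<Longrightarrow> simple_limit M f"
  unfolding simple_limit_def by (intro exI[of _ "\<lambda>_. f"]) auto

lemma simple_limit_const: "simple_limit M (\<lambda>_. c)"
  by (intro simple_limit_simple simple_function_const)

lemma simple_limit_comp2:
  assumes "simple_limit M f" "simple_limit M g" and h: "continuous_on UNIV (\<lambda>(x, y). h x y)"
  shows "simple_limit M (\<lambda>x. h (f x) (g x))"
proof -
  obtain f' g' where f': "\<And>n::nat. simple_function M (f' n)" "\<forall>x\<in>space M. (\<lambda>n. f' n x) \<longlonglongrightarrow> f x"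
    and g': "\<And>n::nat. simple_function M (g' n)" "\<forall>x\<in>space M. (\<lambda>n. g' n x) \<longlonglongrightarrow> g x"
    using assms unfolding simple_limit_def by metis
  have "(\<lambda>n. h (f' n x) (g' n x)) \<longlonglongrightarrow> h (f x) (g x)" if "x \<in> space M" for x
    using isCont_tendsto_compose[OF continuous_on_interior[OF h] tendsto_Pair[OF f'(2)[rule_format, OF that] g'(2)[rule_format, OF that]]]
    by (simp add: case_prod_beta)
  then show ?thesis unfolding simple_limit_def
    using simple_function_compose2[OF f'(1) g'(1)] by (intro exI[of _ "\<lambda>n x. h (f' n x) (g' n x)"]) auto
qed

lemma simple_limit_add:
  fixes f g :: "'a \<Rightarrow> 'b::real_normed_vector"
  shows "simple_limit M f \<Longrightarrow> simple_limit M g \<Longrightarrow> simple_limit M (\<lambda>x. f x + g x)"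
  by (rule simple_limit_comp2[where h = "(+)"]) (auto simp: case_prod_beta intro!: continuous_intros)

lemma simple_limit_diff:
  fixes f g :: "'a \<Rightarrow> 'b::real_normed_vector"
  shows "simple_limit M f \<Longrightarrow> simple_limit M g \<Longrightarrow> simple_limit M (\<lambda>x. f x - g x)"
  by (rule simple_limit_comp2[where h = "(-)"]) (auto simp: case_prod_beta intro!: continuous_intros)

lemma simple_limit_scaleR:
  fixes g :: "'a \<Rightarrow> 'b::real_normed_vector"
  shows "simple_limit M f \<Longrightarrow> simple_limit M g \<Longrightarrow> simple_limit M (\<lambda>x. f x *\<^sub>R g x)"
  by (rule simple_limit_comp2[where h = "scaleR"]) (auto simp: case_prod_beta intro!: continuous_intros)

lemma simple_limit_sum:
  fixes f :: "'i \<Rightarrow> 'a \<Rightarrow> 'b::real_normed_vector"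
  shows "(\<And>i. i \<in> I \<Longrightarrow> simple_limit M (f i)) \<Longrightarrow> simple_limit M (\<lambda>x. \<Sum>i\<in>I. f i x)"
  by (induction I rule: infinite_finite_induct) (auto intro: simple_limit_const simple_limit_add)

text \<open>Convergence at every point, rather than almost everywhere, makes this hold for every
  measurable T: no null set has to be pulled back along maps such as (s, t) \<mapsto> s - t.\<close>

lemma simple_limit_compose:
  assumes "simple_limit N f" "T \<in> measurable M N"
  shows "simple_limit M (\<lambda>x. f (T x))"
proof -
  obtain D where D: "countable D" "f ` space N \<subseteq> closure D"
    using simple_limit_separable[OF assms(1)] by blast
  have "(\<lambda>x. f (T x)) ` space M \<subseteq> closure D"
    using measurable_space[OF assms(2)] D(2) by auto
  with D(1) measurable_compose[OF assms(2) simple_limit_measurable[OF assms(1)]]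
  show ?thesis by (auto simp: simple_limit_iff)
qed

lemma simple_limit_real:
  fixes f :: "'a \<Rightarrow> real" shows "simple_limit M f \<longleftrightarrow> f \<in> borel_measurable M"
proof -
  have "countable (\<rat> :: real set) \<and> f ` space M \<subseteq> closure \<rat>"
    by (simp add: Rats_closure_real countable_rat)
  then show ?thesis unfolding simple_limit_iff by blast
qed

lemma simple_limit_norm_measurable:
  fixes f :: "'a \<Rightarrow> 'b::real_normed_vector"
  assumes "simple_limit M f"
  shows "(\<lambda>x. norm (f x)) \<in> borel_measurable M"
  by (rule measurable_compose[OF simple_limit_measurable[OF assms]])
     (intro borel_measurable_continuous_onI continuous_intros)

lemma simple_limit_completion:
  "simple_limit lborel f \<Longrightarrow> simple_limit lebesgue f"
  by (rule simple_limit_compose[where T = "\<lambda>x. x" and N = lborel])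
     (simp_all add: measurable_completion)

section \<open>Strong measurability, its invariance under null sets, and Borel versions\<close>

lemma strongly_measurable_AE_eq:
  assumes "strongly_measurable f" "AE t in lebesgue. f t = f' t"
  shows "strongly_measurable f'"
proof -
  obtain g where g: "\<forall>n::nat. simple_function lebesgue (g n)" "AE t in lebesgue. (\<lambda>n. g n t) \<longlonglongrightarrow> f t"
    using assms(1) unfolding strongly_measurable_def by blast
  have "AE t in lebesgue. (\<lambda>n. g n t) \<longlonglongrightarrow> f' t" using g(2) assms(2) by eventually_elim simp
  with g(1) show ?thesis unfolding strongly_measurable_def by (intro exI[of _ g]) simp
qed

lemma simple_limit_strongly_measurable: "simple_limit lebesgue f \<Longrightarrow> strongly_measurable f"
  unfolding simple_limit_def strongly_measurable_def by (elim exE conjE, intro exI conjI) (auto intro: AE_I2)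

text \<open>Fubini's theorem is applied on products of Borel spaces. All failures of the
  approximation are collected in one Borel null set, and the value 0 there turns almost everywhere
  convergence into convergence everywhere.\<close>

lemma strongly_measurable_borel_version:
  fixes f :: "'d::euclidean_space \<Rightarrow> 'x::real_normed_vector"
  assumes "strongly_measurable f"
  obtains f' where "simple_limit lborel f'" "AE t in lborel. f t = f' t"
proof -
  obtain g where g: "\<forall>n::nat. simple_function lebesgue (g n)" "AE t in lebesgue. (\<lambda>n. g n t) \<longlonglongrightarrow> f t"
    using assms(1) unfolding strongly_measurable_def by blast
  have "\<forall>n. \<exists>h. simple_function lborel h \<and> (AE t in lborel. g n t = h t)"
    using completion_ex_simple_function[OF g(1)[rule_format]] by blast
  then obtain h where h: "\<And>n. simple_function lborel (h n)" "\<And>n. AE t in lborel. g n t = h n t" by metis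
  have "AE t in lborel. \<forall>n. g n t = h n t" using h(2) by (simp add: AE_all_countable)
  moreover have "AE t in lborel. (\<lambda>n. g n t) \<longlonglongrightarrow> f t" using g(2) by (simp add: AE_completion_iff)
  ultimately have "AE t in lborel. (\<lambda>n. h n t) \<longlonglongrightarrow> f t" by eventually_elim simp
  then obtain N where N: "N \<in> null_sets lborel" "{t. \<not> (\<lambda>n. h n t) \<longlonglongrightarrow> f t} \<subseteq> N"
    by (auto simp: eventually_ae_filter)
  define f' where "f' t = (if t \<in> N then 0 else f t)" for t
  have "simple_function lborel (\<lambda>t. if t \<in> N then 0 else h n t)" for n
    using N(1) by (intro simple_function_If_set h(1)) auto
  moreover have "(\<lambda>n. if t \<in> N then 0 else h n t) \<longlonglongrightarrow> f' t" for t
    using N(2) by (auto simp: f'_def)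
  ultimately have "simple_limit lborel f'" unfolding simple_limit_def
    by (intro exI[of _ "\<lambda>n t. if t \<in> N then 0 else h n t"]) auto
  moreover have "AE t in lborel. f t = f' t"
    using N(1) by (intro AE_I'[of N]) (auto simp: f'_def)
  ultimately show ?thesis using that by blast
qed

subsection \<open>Dyadic cubes\<close>

text \<open>Half-open, so that halving the sides partitions a cube exactly and the sets where all
  \<lfloor>x \<bullet> i / \<delta>\<rfloor> are constant are cubes themselves.\<close>

definition cube :: "'d::euclidean_space \<Rightarrow> real \<Rightarrow> 'd set"
  where "cube a l = {x. \<forall>i\<in>Basis. a \<bullet> i \<le> x \<bullet> i \<and> x \<bullet> i < a \<bullet> i + l}"

lemma cube_measurable [measurable]: "cube a l \<in> sets borel"
  unfolding cube_def by measurable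

lemma emeasure_cube:
  fixes a :: "'d::euclidean_space"
  assumes "0 \<le> l"
  shows "emeasure lborel (cube a l) = ennreal (l ^ DIM('d))"
proof -
  let ?b = "a + l *\<^sub>R One"
  have b: "?b \<bullet> i = a \<bullet> i + l" if "i \<in> Basis" for i
    using that by (simp add: inner_add_left)
  have "box a ?b \<subseteq> cube a l" "cube a l \<subseteq> cbox a ?b"
    using b by (auto simp: cube_def mem_box less_imp_le)
  then have "emeasure lborel (box a ?b) \<le> emeasure lborel (cube a l)"
    "emeasure lborel (cube a l) \<le> emeasure lborel (cbox a ?b)"
    by (auto intro!: emeasure_mono)
  moreover have "(\<Prod>i\<in>Basis. (?b - a) \<bullet> i) = l ^ DIM('d)"
    by simp
  then have "emeasure lborel (box a ?b) = ennreal (l ^ DIM('d))"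
    "emeasure lborel (cbox a ?b) = ennreal (l ^ DIM('d))"
    using assms by (auto simp: emeasure_lborel_box_eq emeasure_lborel_cbox_eq b)
  ultimately show ?thesis by auto
qed

text \<open>Comparison with the l1 norm. The inequality is strict because the cube is half-open, and
  \<open>kernel_hormander\<close> asks for a strict one.\<close>

lemma dist_cube_less:
  fixes a :: "'d::euclidean_space"
  assumes "s \<in> cube a l" "s' \<in> cube a l"
  shows "dist s s' < l * DIM('d)"
proof -
  have "dist s s' \<le> (\<Sum>i\<in>Basis. \<bar>(s - s') \<bullet> i\<bar>)"
    unfolding dist_norm by (rule norm_le_l1)
  also have "\<dots> < (\<Sum>i\<in>(Basis :: 'd set). l)"
  proof (rule sum_strict_mono)
    fix i :: 'd assume "i \<in> Basis"
    then have "a \<bullet> i \<le> s \<bullet> i \<and> s \<bullet> i < a \<bullet> i + l" "a \<bullet> i \<le> s' \<bullet> i \<and> s' \<bullet> i < a \<bullet> i + l"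
      using assms by (auto simp: cube_def)
    then show "\<bar>(s - s') \<bullet> i\<bar> < l" by (simp add: inner_diff_left abs_less_iff)
  qed auto
  also have "\<dots> = l * DIM('d)" by simp
  finally show ?thesis .
qed

text \<open>A subset S of the basis encodes one of the 2^d halves of the cube: S is the set of
  directions in which the upper half is taken.\<close>

definition subcube_corner :: "'d::euclidean_space \<Rightarrow> real \<Rightarrow> 'd set \<Rightarrow> 'd"
  where "subcube_corner a l S = a + (\<Sum>i\<in>S. (l / 2) *\<^sub>R i)"

lemma subcube_corner_inner:
  assumes "S \<subseteq> Basis" "i \<in> Basis"
  shows "subcube_corner a l S \<bullet> i = a \<bullet> i + (if i \<in> S then l / 2 else 0)"
proof -
  have "finite S" using assms(1) finite_Basis by (rule finite_subset)
  moreover have "j \<bullet> i = (if i = j then 1 else 0)" if "j \<in> S" for j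
    using assms that by (auto simp: inner_Basis)
  then have "(\<Sum>j\<in>S. (l / 2) * (j \<bullet> i)) = (\<Sum>j\<in>S. if i = j then l / 2 else 0)"
    by (intro sum.cong) auto
  ultimately show ?thesis
    by (simp add: subcube_corner_def inner_add_left inner_sum_left sum.delta')
qed

text \<open>The index S can be read off from the point, so the subcubes indexed by
  \<open>Pow Basis\<close> are disjoint and cover the cube.\<close>

lemma mem_subcube_iff:
  assumes "0 < l" "S \<subseteq> Basis"
  shows "x \<in> cube (subcube_corner a l S) (l / 2) \<longleftrightarrow>
    x \<in> cube a l \<and> S = {i\<in>Basis. a \<bullet> i + l / 2 \<le> x \<bullet> i}"
proof
  assume x: "x \<in> cube (subcube_corner a l S) (l / 2)"
  have *: "a \<bullet> i + (if i \<in> S then l / 2 else 0) \<le> x \<bullet> i"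
    "x \<bullet> i < a \<bullet> i + (if i \<in> S then l / 2 else 0) + l / 2" if "i \<in> Basis" for i
    using x subcube_corner_inner[OF assms(2)] that by (auto simp: cube_def)
  have "a \<bullet> i \<le> x \<bullet> i \<and> x \<bullet> i < a \<bullet> i + l \<and> (i \<in> S \<longleftrightarrow> a \<bullet> i + l / 2 \<le> x \<bullet> i)"
    if "i \<in> Basis" for i
    using *[OF that] assms(1) by (auto split: if_splits)
  then show "x \<in> cube a l \<and> S = {i\<in>Basis. a \<bullet> i + l / 2 \<le> x \<bullet> i}"
    using assms(2) by (auto simp: cube_def)
next
  assume "x \<in> cube a l \<and> S = {i\<in>Basis. a \<bullet> i + l / 2 \<le> x \<bullet> i}"
  then show "x \<in> cube (subcube_corner a l S) (l / 2)"
    using subcube_corner_inner[OF assms(2)] by (auto simp: cube_def)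
qed

lemma sum_subcubes:
  fixes f :: "'d::euclidean_space set \<Rightarrow> ennreal"
  assumes "0 < l"
  shows "(\<Sum>S\<in>Pow Basis. f S * indicator (cube (subcube_corner a l S) (l / 2)) x) =
    f {i\<in>Basis. a \<bullet> i + l / 2 \<le> x \<bullet> i} * indicator (cube a l) x"
proof -
  have "(\<Sum>S\<in>Pow Basis. f S * indicator (cube (subcube_corner a l S) (l / 2)) x) =
     (\<Sum>S\<in>Pow Basis. if S = {i\<in>Basis. a \<bullet> i + l / 2 \<le> x \<bullet> i} then f S * indicator (cube a l) x else 0)"
    by (intro sum.cong) (auto simp: mem_subcube_iff[OF assms] split: split_indicator)
  also have "\<dots> = f {i\<in>Basis. a \<bullet> i + l / 2 \<le> x \<bullet> i} * indicator (cube a l) x"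
    by (subst sum.delta) auto
  finally show ?thesis .
qed

subsection \<open>Square functions with a scalar Hoermander kernel\<close>

text \<open>The model is u s t = |k(s - t) \<sigma>(t)|. \<open>kernel_bound\<close> bounds the
  adjoint on L^\<infinity>. \<open>kernel_hormander\<close> compares the kernel at two values of s
  only, far from s' in the variable t.\<close>

locale hormander_kernel =
  fixes u :: "'d::euclidean_space \<Rightarrow> 'd \<Rightarrow> real" and A H :: real
  assumes kernel_measurable: "case_prod u \<in> borel_measurable (borel \<Otimes>\<^sub>M borel)"
    and A_pos: "0 < A" and H_nonneg: "0 \<le> H"
    and kernel_bound: "\<And>t. (\<integral>\<^sup>+ s. ennreal ((u s t)\<^sup>2) \<partial>lborel) \<le> ennreal (A\<^sup>2)"
    and kernel_hormander: "\<And>s s' r. 2 * dist s s' < r \<Longrightarrow>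
      (\<integral>\<^sup>+ t\<in>{t. r \<le> dist t s'}. ennreal ((u s t - u s' t)\<^sup>2) \<partial>lborel) \<le> ennreal (H\<^sup>2)"
begin

lemma kernel_measurable' [measurable (raw)]:
  "f \<in> measurable M borel \<Longrightarrow> g \<in> measurable M borel \<Longrightarrow> (\<lambda>x. u (f x) (g x)) \<in> borel_measurable M"
  using measurable_compose[OF measurable_Pair kernel_measurable, of f M g] by simp

definition W :: "('d \<Rightarrow> ennreal) \<Rightarrow> 'd \<Rightarrow> ennreal"
  where "W h s = (\<integral>\<^sup>+ t. ennreal ((u s t)\<^sup>2) * h t \<partial>lborel)"

definition W_adj :: "('d \<Rightarrow> ennreal) \<Rightarrow> 'd \<Rightarrow> ennreal"
  where "W_adj g t = (\<integral>\<^sup>+ s. ennreal ((u s t)\<^sup>2) * g s \<partial>lborel)"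

lemma W_adj_measurable [measurable (raw)]:
  assumes [measurable]: "g \<in> borel_measurable borel"
  shows "W_adj g \<in> borel_measurable borel"
  unfolding W_adj_def by measurable

lemma W_measurable [measurable (raw)]:
  assumes [measurable]: "g \<in> borel_measurable borel"
  shows "W g \<in> borel_measurable borel"
  unfolding W_def by measurable

lemma W_adj_mono: "(\<And>s. g s \<le> g' s) \<Longrightarrow> W_adj g t \<le> W_adj g' t"
  unfolding W_adj_def by (intro nn_integral_mono mult_left_mono) auto

lemma W_adj_add:
  assumes [measurable]: "g \<in> borel_measurable borel" "g' \<in> borel_measurable borel"
  shows "W_adj (\<lambda>s. g s + g' s) t = W_adj g t + W_adj g' t"
  unfolding W_adj_def by (subst nn_integral_add[symmetric]) (auto simp: distrib_left)

lemma W_adj_sum: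
  assumes "\<And>i. i \<in> I \<Longrightarrow> g i \<in> borel_measurable borel"
  shows "W_adj (\<lambda>s. \<Sum>i\<in>I. g i s) t = (\<Sum>i\<in>I. W_adj (g i) t)"
  using assms
proof (induction I rule: infinite_finite_induct)
  case (insert x F)
  then have "(\<lambda>s. \<Sum>i\<in>F. g i s) \<in> borel_measurable borel" by (intro borel_measurable_sum) auto
  with insert show ?case by (simp add: W_adj_add)
qed (auto simp: W_adj_def)

lemma W_adj_const_le: "(\<And>s. g s \<le> c) \<Longrightarrow> W_adj g t \<le> ennreal (A\<^sup>2) * c"
proof -
  assume "\<And>s. g s \<le> c"
  then have "W_adj g t \<le> (\<integral>\<^sup>+ s. ennreal ((u s t)\<^sup>2) * c \<partial>lborel)"
    unfolding W_adj_def by (intro nn_integral_mono mult_left_mono) auto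
  also have "\<dots> = (\<integral>\<^sup>+ s. ennreal ((u s t)\<^sup>2) \<partial>lborel) * c"
    by (rule nn_integral_multc) measurable
  also have "\<dots> \<le> ennreal (A\<^sup>2) * c"
    using kernel_bound by (rule mult_right_mono) auto
  finally show ?thesis .
qed

lemma W_adj_duality:
  assumes [measurable]: "g \<in> borel_measurable borel" "h \<in> borel_measurable borel"
  shows "(\<integral>\<^sup>+ s. W h s * g s \<partial>lborel) = (\<integral>\<^sup>+ t. h t * W_adj g t \<partial>lborel)"
proof -
  have "(\<integral>\<^sup>+ s. W h s * g s \<partial>lborel) = (\<integral>\<^sup>+ s. (\<integral>\<^sup>+ t. ennreal ((u s t)\<^sup>2) * h t * g s \<partial>lborel) \<partial>lborel)"
    unfolding W_def by (subst nn_integral_multc) auto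
  also have "\<dots> = (\<integral>\<^sup>+ t. (\<integral>\<^sup>+ s. ennreal ((u s t)\<^sup>2) * h t * g s \<partial>lborel) \<partial>lborel)"
    by (rule lborel_pair.Fubini') measurable
  also have "\<dots> = (\<integral>\<^sup>+ t. h t * W_adj g t \<partial>lborel)"
    unfolding W_adj_def by (subst nn_integral_cmult[symmetric]) (auto simp: ac_simps)
  finally show ?thesis .
qed

text \<open>On a selected cube \<open>g\<close> is replaced by its average. Comparing \<open>u s t\<close> with \<open>u s' t\<close> for all
  \<open>s'\<close> in the cube costs a factor 2 and the error \<open>b\<close>; as \<open>W_adj\<close> is positive, no cancellation is
  needed.\<close>

lemma selected_cube:
  fixes g :: "'d \<Rightarrow> ennreal"
  assumes [measurable]: "g \<in> borel_measurable borel" and l: "0 < l"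
    and low: "ennreal (\<kappa> * l ^ DIM('d)) \<le> (\<integral>\<^sup>+ s\<in>cube a l. g s \<partial>lborel)"
    and up: "(\<integral>\<^sup>+ s\<in>cube a l. g s \<partial>lborel) \<le> ennreal (\<mu> * l ^ DIM('d))" and pos: "0 \<le> \<kappa>" "0 \<le> \<mu>"
  obtains E g' b where "E \<in> sets borel" "g' \<in> borel_measurable borel" "b \<in> borel_measurable borel"
    "\<And>s. g' s \<le> ennreal \<mu> * indicator (cube a l) s"
    "emeasure lborel E * ennreal \<kappa> \<le> ennreal ((6 * real DIM('d)) ^ DIM('d)) * (\<integral>\<^sup>+ s\<in>cube a l. g s \<partial>lborel)"
    "(\<integral>\<^sup>+ t. b t \<partial>lborel) \<le> ennreal (2 * H\<^sup>2) * (\<integral>\<^sup>+ s\<in>cube a l. g s \<partial>lborel)"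
    "\<And>t. t \<notin> E \<Longrightarrow> W_adj (\<lambda>s. g s * indicator (cube a l) s) t \<le> 2 * W_adj g' t + b t"
proof -
  let ?Q = "cube a l" and ?n = "DIM('d)"
  define q where "q = l ^ ?n"
  have q: "0 < q" using l by (simp add: q_def)
  have eQ: "emeasure lborel ?Q = ennreal q" using emeasure_cube[of l a] l by (simp add: q_def)
  define G where "G = (\<integral>\<^sup>+ s\<in>?Q. g s \<partial>lborel)"
  \<comment> \<open>A point outside E has a coordinate at distance at least c from that of the
    corner a, hence distance at least c - l \<ge> 2 l d from every point of the cube. This exceeds
    twice the distance of any two of its points, as the Hoermander condition requires.\<close>
  define c where "c = l * 3 * ?n"
  define E where "E = box (a - c *\<^sub>R One) (a + c *\<^sub>R One)"
  \<comment> \<open>The oscillation of the kernel over the cube, seen from s. By Fubini and the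
    Hoermander condition its integral over the complement of E is at most H^2 times the volume of
    the cube.\<close>
  define D where "D s t = (\<integral>\<^sup>+ s'\<in>?Q. ennreal ((u s t - u s' t)\<^sup>2) \<partial>lborel)" for s t
  have D_meas2 [measurable (raw)]: "(\<lambda>x. D (f x) (h x)) \<in> borel_measurable M"
    if [measurable]: "f \<in> measurable M borel" "h \<in> measurable M borel" for f h and M :: "('d \<times> 'd) measure"
    unfolding D_def by measurable
  have D_meas3 [measurable (raw)]: "(\<lambda>x. D (f x) (h x)) \<in> borel_measurable M"
    if [measurable]: "f \<in> measurable M borel" "h \<in> measurable M borel" for f h and M :: "'d measure"
    unfolding D_def by measurable
  define b where "b t = indicator (- E) t * (ennreal (2 / q) * (\<integral>\<^sup>+ s\<in>?Q. g s * D s t \<partial>lborel))" for t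
  define g' where "g' s = ennreal (1 / q) * G * indicator ?Q s" for s
  have E_meas [measurable]: "E \<in> sets borel" unfolding E_def by simp
  have cpos: "0 < c" using l by (simp add: c_def)
  have far: "2 * l * ?n \<le> dist t s'" if t: "t \<notin> E" and s': "s' \<in> ?Q" for t s'
  proof -
    obtain i where i: "i \<in> Basis" "\<not> (a \<bullet> i - c < t \<bullet> i \<and> t \<bullet> i < a \<bullet> i + c)"
      using t unfolding E_def by (auto simp: mem_box inner_diff_left inner_add_left)
    have s'i: "a \<bullet> i \<le> s' \<bullet> i \<and> s' \<bullet> i < a \<bullet> i + l" using s' i(1) by (auto simp: cube_def)
    have "1 \<le> real ?n" using DIM_positive[where 'a = 'd] by linarith
    then have "l \<le> l * real ?n" using l by simp
    then have "2 * l * ?n \<le> c - l" unfolding c_def by simp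
    also have "c - l \<le> \<bar>(t - s') \<bullet> i\<bar>" using i(2) s'i by (auto simp: inner_diff_left)
    also have "\<dots> \<le> dist t s'" unfolding dist_norm using i(1) by (rule Basis_le_norm)
    finally show ?thesis .
  qed
  have "emeasure lborel E = ennreal ((2 * c) ^ ?n)"
    unfolding E_def using cpos
    by (simp add: emeasure_lborel_box_eq inner_diff_left inner_add_left algebra_simps)
  also have "(2 * c) ^ ?n = (6 * real ?n) ^ ?n * q"
  proof -
    have "2 * c = (6 * real ?n) * l" by (simp add: c_def)
    then show ?thesis by (simp only: q_def power_mult_distrib)
  qed
  finally have "emeasure lborel E * ennreal \<kappa> = ennreal ((6 * real ?n) ^ ?n) * ennreal (\<kappa> * q)"
    using q pos by (simp add: ennreal_mult[symmetric] ac_simps)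
  also have "\<dots> \<le> ennreal ((6 * real ?n) ^ ?n) * G"
    using low unfolding G_def q_def by (intro mult_left_mono) auto
  finally have 1: "emeasure lborel E * ennreal \<kappa> \<le> ennreal ((6 * real ?n) ^ ?n) * G" .
  have "g' s \<le> ennreal \<mu> * indicator ?Q s" for s
  proof -
    have "ennreal (1 / q) * G \<le> ennreal (1 / q) * ennreal (\<mu> * q)"
      using up unfolding G_def q_def by (intro mult_left_mono) auto
    also have "\<dots> = ennreal \<mu>" using q pos by (simp add: ennreal_mult[symmetric])
    finally show ?thesis unfolding g'_def by (intro mult_right_mono) auto
  qed
  note 2 = this
  have DH: "(\<integral>\<^sup>+ t. indicator (- E) t * D s t \<partial>lborel) \<le> ennreal q * ennreal (H\<^sup>2)" if s: "s \<in> ?Q" for s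
  proof -
    have "(\<integral>\<^sup>+ t. indicator (- E) t * D s t \<partial>lborel) =
        (\<integral>\<^sup>+ t. (\<integral>\<^sup>+ s'. indicator (- E) t * (ennreal ((u s t - u s' t)\<^sup>2) * indicator ?Q s') \<partial>lborel) \<partial>lborel)"
      unfolding D_def by (subst nn_integral_cmult) auto
    also have "\<dots> = (\<integral>\<^sup>+ s'. (\<integral>\<^sup>+ t. indicator (- E) t * (ennreal ((u s t - u s' t)\<^sup>2) * indicator ?Q s') \<partial>lborel) \<partial>lborel)"
      by (rule lborel_pair.Fubini') measurable
    also have "\<dots> \<le> (\<integral>\<^sup>+ s'. ennreal (H\<^sup>2) * indicator ?Q s' \<partial>lborel)"
    proof (rule nn_integral_mono)
      fix s' :: 'd
      show "(\<integral>\<^sup>+ t. indicator (- E) t * (ennreal ((u s t - u s' t)\<^sup>2) * indicator ?Q s') \<partial>lborel) \<le>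
        ennreal (H\<^sup>2) * indicator ?Q s'"
      proof (cases "s' \<in> ?Q")
        case True
        have "2 * dist s s' < 2 * l * ?n" using dist_cube_less[OF s True] by simp
        from kernel_hormander[OF this]
        have "(\<integral>\<^sup>+ t\<in>{t. 2 * l * ?n \<le> dist t s'}. ennreal ((u s t - u s' t)\<^sup>2) \<partial>lborel) \<le> ennreal (H\<^sup>2)" .
        moreover have "(\<integral>\<^sup>+ t. indicator (- E) t * (ennreal ((u s t - u s' t)\<^sup>2) * indicator ?Q s') \<partial>lborel) \<le>
            (\<integral>\<^sup>+ t\<in>{t. 2 * l * ?n \<le> dist t s'}. ennreal ((u s t - u s' t)\<^sup>2) \<partial>lborel)"
          using True far[OF _ True] by (intro nn_integral_mono) (auto split: split_indicator)
        ultimately show ?thesis using True by simp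
      qed simp
    qed
    also have "\<dots> = ennreal q * ennreal (H\<^sup>2)"
      by (subst nn_integral_cmult_indicator) (auto simp: eQ mult.commute)
    finally show ?thesis .
  qed
  have "(\<integral>\<^sup>+ t. b t \<partial>lborel) =
      (\<integral>\<^sup>+ t. (\<integral>\<^sup>+ s. ennreal (2 / q) * (g s * indicator ?Q s) * (indicator (- E) t * D s t) \<partial>lborel) \<partial>lborel)"
    unfolding b_def by (subst nn_integral_cmult[symmetric], simp, subst nn_integral_cmult[symmetric]) (auto simp: ac_simps)
  also have "\<dots> = (\<integral>\<^sup>+ s. (\<integral>\<^sup>+ t. ennreal (2 / q) * (g s * indicator ?Q s) * (indicator (- E) t * D s t) \<partial>lborel) \<partial>lborel)"
    by (rule lborel_pair.Fubini') measurable
  also have "\<dots> = (\<integral>\<^sup>+ s. ennreal (2 / q) * (g s * indicator ?Q s) * (\<integral>\<^sup>+ t. indicator (- E) t * D s t \<partial>lborel) \<partial>lborel)"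
    by (subst nn_integral_cmult) auto
  also have "\<dots> \<le> (\<integral>\<^sup>+ s. ennreal (2 / q) * (g s * indicator ?Q s) * (ennreal q * ennreal (H\<^sup>2)) \<partial>lborel)"
    using DH by (intro nn_integral_mono) (auto split: split_indicator intro!: mult_left_mono)
  also have "\<dots> = (\<integral>\<^sup>+ s. ennreal (2 * H\<^sup>2) * (g s * indicator ?Q s) \<partial>lborel)"
  proof (rule nn_integral_cong)
    fix s
    have "ennreal (2 / q) * (ennreal q * ennreal (H\<^sup>2)) = ennreal (2 * H\<^sup>2)"
      using q by (simp add: ennreal_mult[symmetric] del: ennreal_mult'')
    then show "ennreal (2 / q) * (g s * indicator ?Q s) * (ennreal q * ennreal (H\<^sup>2)) =
      ennreal (2 * H\<^sup>2) * (g s * indicator ?Q s)"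
      by (metis mult.assoc mult.commute)
  qed
  also have "\<dots> = ennreal (2 * H\<^sup>2) * G"
    unfolding G_def by (rule nn_integral_cmult) measurable
  finally have 3: "(\<integral>\<^sup>+ t. b t \<partial>lborel) \<le> ennreal (2 * H\<^sup>2) * G" .
  have 4: "W_adj (\<lambda>s. g s * indicator ?Q s) t \<le> 2 * W_adj g' t + b t" if t: "t \<notin> E" for t
  proof -
    define V where "V = (\<integral>\<^sup>+ s'\<in>?Q. ennreal ((u s' t)\<^sup>2) \<partial>lborel)"
    \<comment> \<open>The left side does not depend on s', so it equals its average over s' in the
      cube, under which u s t is replaced by u s' t at the cost of D.\<close>
    have *: "ennreal ((u s t)\<^sup>2) \<le> ennreal (1 / q) * (2 * V + 2 * D s t)" for s
    proof -
      have "ennreal ((u s t)\<^sup>2) = ennreal (1 / q) * (\<integral>\<^sup>+ s'. ennreal ((u s t)\<^sup>2) * indicator ?Q s' \<partial>lborel)"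
        using q by (subst nn_integral_cmult_indicator)
          (auto simp: eQ ennreal_mult[symmetric] simp del: ennreal_mult'')
      also have "\<dots> \<le> ennreal (1 / q) * (\<integral>\<^sup>+ s'. 2 * (ennreal ((u s' t)\<^sup>2) * indicator ?Q s') +
          2 * (ennreal ((u s t - u s' t)\<^sup>2) * indicator ?Q s') \<partial>lborel)"
      proof (intro mult_left_mono nn_integral_mono)
        fix s'
        have "(u s t)\<^sup>2 \<le> 2 * (u s' t)\<^sup>2 + 2 * (u s t - u s' t)\<^sup>2"
          using zero_le_power2[of "u s t - 2 * u s' t"] by (simp add: power2_eq_square algebra_simps)
        then have "ennreal ((u s t)\<^sup>2) \<le> ennreal (2 * (u s' t)\<^sup>2 + 2 * (u s t - u s' t)\<^sup>2)"
          by (rule ennreal_leI)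
        then have "ennreal ((u s t)\<^sup>2) \<le> 2 * ennreal ((u s' t)\<^sup>2) + 2 * ennreal ((u s t - u s' t)\<^sup>2)"
          by (simp add: ennreal_plus ennreal_mult)
        then show "ennreal ((u s t)\<^sup>2) * indicator ?Q s' \<le> 2 * (ennreal ((u s' t)\<^sup>2) * indicator ?Q s') +
          2 * (ennreal ((u s t - u s' t)\<^sup>2) * indicator ?Q s')"
          by (auto split: split_indicator)
      qed auto
      also have "\<dots> = ennreal (1 / q) * (2 * V + 2 * D s t)"
        unfolding V_def D_def by (simp add: nn_integral_add nn_integral_cmult)
      finally show ?thesis .
    qed
    have "W_adj (\<lambda>s. g s * indicator ?Q s) t \<le>
        (\<integral>\<^sup>+ s. ennreal (1 / q) * (2 * V + 2 * D s t) * (g s * indicator ?Q s) \<partial>lborel)"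
      unfolding W_adj_def by (intro nn_integral_mono mult_right_mono *) auto
    also have "\<dots> = (\<integral>\<^sup>+ s. (2 * (ennreal (1 / q) * V)) * (g s * indicator ?Q s) +
        ennreal (2 / q) * (g s * D s t * indicator ?Q s) \<partial>lborel)"
    proof (rule nn_integral_cong)
      fix s
      have "ennreal (2 / q) = 2 * ennreal (1 / q)"
        using q by (simp add: ennreal_mult[symmetric] flip: ennreal_numeral del: ennreal_mult'')
      then show "ennreal (1 / q) * (2 * V + 2 * D s t) * (g s * indicator ?Q s) =
        (2 * (ennreal (1 / q) * V)) * (g s * indicator ?Q s) + ennreal (2 / q) * (g s * D s t * indicator ?Q s)"
        by (simp add: algebra_simps)
    qed
    also have "\<dots> = (2 * (ennreal (1 / q) * V)) * G + ennreal (2 / q) * (\<integral>\<^sup>+ s\<in>?Q. g s * D s t \<partial>lborel)"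
      unfolding G_def by (simp add: nn_integral_add nn_integral_cmult)
    also have "ennreal (2 / q) * (\<integral>\<^sup>+ s\<in>?Q. g s * D s t \<partial>lborel) = b t"
      using t unfolding b_def by simp
    also have "(2 * (ennreal (1 / q) * V)) * G = 2 * W_adj g' t"
    proof -
      have "W_adj g' t = (\<integral>\<^sup>+ s. (ennreal (1 / q) * G) * (ennreal ((u s t)\<^sup>2) * indicator ?Q s) \<partial>lborel)"
        unfolding W_adj_def g'_def by (simp add: ac_simps)
      also have "\<dots> = (ennreal (1 / q) * G) * V"
        unfolding V_def by (rule nn_integral_cmult) measurable
      finally show ?thesis by (simp add: ac_simps)
    qed
    finally show ?thesis .
  qed
  show ?thesis
  proof (rule that)
    show "g' \<in> borel_measurable borel" unfolding g'_def by measurable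
    show "b \<in> borel_measurable borel" unfolding b_def by measurable
  qed (use 1 2 3 4 E_meas in \<open>auto simp: G_def\<close>)
qed


text \<open>The conclusion of \<open>selected_cube\<close> with 2^d \<kappa> as upper density: g' is
  the good part, b the error, E the union of the enlarged selected cubes. Every bound is
  proportional to an integral or indicator over Q, so splittings of the subcubes add up to one of Q,
  which closes the induction.\<close>

definition cz_splitting where
  "cz_splitting \<kappa> g Q E g' b \<longleftrightarrow> E \<in> sets borel \<and> g' \<in> borel_measurable borel \<and> b \<in> borel_measurable borel \<and>
    (\<forall>s. g' s \<le> ennreal (2 ^ DIM('d) * \<kappa>) * indicator Q s) \<and>
    emeasure lborel E * ennreal \<kappa> \<le> ennreal ((6 * real DIM('d)) ^ DIM('d)) * (\<integral>\<^sup>+ s\<in>Q. g s \<partial>lborel) \<and>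
    (\<integral>\<^sup>+ t. b t \<partial>lborel) \<le> ennreal (2 * H\<^sup>2) * (\<integral>\<^sup>+ s\<in>Q. g s \<partial>lborel) \<and>
    (\<forall>t. t \<notin> E \<longrightarrow> W_adj (\<lambda>s. g s * indicator Q s) t \<le> 2 * W_adj g' t + b t)"

text \<open>The stopping time argument as an induction on the number k of halvings left. A subcube
  of mean at most \<kappa> is treated recursively, any other one is selected. Constancy on cells
  stops the recursion at side \<delta>.\<close>

lemma cz_splitting_exists:
  fixes g :: "'d \<Rightarrow> ennreal"
  assumes g [measurable]: "g \<in> borel_measurable borel" and \<kappa>: "0 < \<kappa>" and \<delta>: "0 < \<delta>"
    and cell: "\<And>x y. (\<And>i. i \<in> Basis \<Longrightarrow> \<lfloor>x \<bullet> i / \<delta>\<rfloor> = \<lfloor>y \<bullet> i / \<delta>\<rfloor>) \<Longrightarrow> g x = g y"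
  shows "(\<And>i. i \<in> Basis \<Longrightarrow> \<exists>z::int. a \<bullet> i = \<delta> * z) \<Longrightarrow>
    (\<integral>\<^sup>+ s\<in>cube a (2 ^ k * \<delta>). g s \<partial>lborel) \<le> ennreal (\<kappa> * (2 ^ k * \<delta>) ^ DIM('d)) \<Longrightarrow>
    \<exists>E g' b. cz_splitting \<kappa> g (cube a (2 ^ k * \<delta>)) E g' b"
proof (induction k arbitrary: a)
  case 0
  let ?q = "\<delta> ^ DIM('d)"
  \<comment> \<open>The corner is a grid point, so the cube is a single cell. The mean bound on g is
    then a pointwise bound, and g is its own good part, with E empty and b zero.\<close>
  have const: "g x = g a" if "x \<in> cube a \<delta>" for x
  proof (rule cell)
    fix i :: 'd assume i: "i \<in> Basis"
    obtain z :: int where z: "a \<bullet> i = \<delta> * z" using 0(1)[OF i] by blast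
    have "a \<bullet> i \<le> x \<bullet> i" "x \<bullet> i < a \<bullet> i + \<delta>" using i \<open>x \<in> cube a \<delta>\<close> by (auto simp: cube_def)
    then have "\<lfloor>x \<bullet> i / \<delta>\<rfloor> = z" using z \<delta> by (intro floor_unique) (auto simp: field_simps)
    moreover have "\<lfloor>a \<bullet> i / \<delta>\<rfloor> = z" using z \<delta> by simp
    ultimately show "\<lfloor>x \<bullet> i / \<delta>\<rfloor> = \<lfloor>a \<bullet> i / \<delta>\<rfloor>" by simp
  qed
  have "(\<integral>\<^sup>+ s\<in>cube a \<delta>. g s \<partial>lborel) = (\<integral>\<^sup>+ s. g a * indicator (cube a \<delta>) s \<partial>lborel)"
    using const by (intro nn_integral_cong) (auto split: split_indicator)
  also have "\<dots> = g a * ennreal ?q"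
    using \<delta> by (subst nn_integral_cmult_indicator) (auto simp: emeasure_cube)
  finally have "ennreal ?q * g a \<le> ennreal ?q * ennreal \<kappa>"
    using 0(2) \<kappa> \<delta> by (simp add: ennreal_mult mult.commute)
  then have ga: "g a \<le> ennreal \<kappa>" using \<delta> by (subst (asm) ennreal_mult_le_mult_iff) auto
  have "\<kappa> \<le> 2 ^ DIM('d) * \<kappa>" using \<kappa> by simp
  then have "g a \<le> ennreal (2 ^ DIM('d) * \<kappa>)" using ga by (meson ennreal_leI order_trans)
  then have "g s * indicator (cube a \<delta>) s \<le> ennreal (2 ^ DIM('d) * \<kappa>) * indicator (cube a \<delta>) s" for s
    using const[of s] by (auto split: split_indicator)
  moreover have "x \<le> 2 * x" for x :: ennreal
    using add_increasing[of x x x] by (simp add: mult_2)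
  ultimately have "cz_splitting \<kappa> g (cube a \<delta>) {} (\<lambda>s. g s * indicator (cube a \<delta>) s) (\<lambda>_. 0)"
    unfolding cz_splitting_def by auto
  then show ?case by auto
next
  case (Suc k)
  define l where "l = 2 ^ Suc k * \<delta>"
  have l: "0 < l" "2 ^ k * \<delta> = l / 2" using \<delta> by (auto simp: l_def)
  let ?Q = "\<lambda>S. cube (subcube_corner a l S) (l / 2)" and ?n = "DIM('d)"
  have "\<exists>E g' b. cz_splitting \<kappa> g (?Q S) E g' b" if S: "S \<subseteq> Basis" for S
  proof (cases "(\<integral>\<^sup>+ s\<in>?Q S. g s \<partial>lborel) \<le> ennreal (\<kappa> * (l / 2) ^ ?n)")
    case True
    have "\<exists>z::int. subcube_corner a l S \<bullet> i = \<delta> * z" if i: "i \<in> Basis" for i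
    proof -
      obtain z :: int where z: "a \<bullet> i = \<delta> * z" using Suc.prems(1)[OF i] by blast
      \<comment> \<open>Half the side is still an integer multiple of \<delta>, so subcubes remain
        aligned with the grid.\<close>
      have "subcube_corner a l S \<bullet> i = \<delta> * of_int (z + (if i \<in> S then 2 ^ k else 0))"
        using subcube_corner_inner[OF S i, of a l] z l(2) by (auto simp: algebra_simps)
      then show ?thesis by blast
    qed
    then show ?thesis using Suc.IH[of "subcube_corner a l S"] True l(2) by simp
  next
    case False
    \<comment> \<open>A selected cube has a parent of mean at most \<kappa> and 2^d times its
      volume; this caps its own mean by 2^d \<kappa>.\<close>
    have "(\<integral>\<^sup>+ s\<in>?Q S. g s \<partial>lborel) \<le> (\<integral>\<^sup>+ s\<in>cube a l. g s \<partial>lborel)"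
      using mem_subcube_iff[OF l(1) S] by (intro nn_integral_mono) (auto split: split_indicator)
    also have "\<dots> \<le> ennreal (\<kappa> * l ^ ?n)" using Suc.prems(2) by (simp add: l_def)
    also have "\<kappa> * l ^ ?n = 2 ^ ?n * \<kappa> * (l / 2) ^ ?n" by (simp add: power_divide)
    finally have up: "(\<integral>\<^sup>+ s\<in>?Q S. g s \<partial>lborel) \<le> ennreal (2 ^ ?n * \<kappa> * (l / 2) ^ ?n)" .
    have low: "ennreal (\<kappa> * (l / 2) ^ ?n) \<le> (\<integral>\<^sup>+ s\<in>?Q S. g s \<partial>lborel)" using False by simp
    have "0 < l / 2" "0 \<le> \<kappa>" "0 \<le> 2 ^ ?n * \<kappa>" using l \<kappa> by auto
    note pos = this
    obtain E g' b where "E \<in> sets borel" "g' \<in> borel_measurable borel" "b \<in> borel_measurable borel"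
      "\<And>s. g' s \<le> ennreal (2 ^ ?n * \<kappa>) * indicator (?Q S) s"
      "emeasure lborel E * ennreal \<kappa> \<le> ennreal ((6 * real ?n) ^ ?n) * (\<integral>\<^sup>+ s\<in>?Q S. g s \<partial>lborel)"
      "(\<integral>\<^sup>+ t. b t \<partial>lborel) \<le> ennreal (2 * H\<^sup>2) * (\<integral>\<^sup>+ s\<in>?Q S. g s \<partial>lborel)"
      "\<And>t. t \<notin> E \<Longrightarrow> W_adj (\<lambda>s. g s * indicator (?Q S) s) t \<le> 2 * W_adj g' t + b t"
      by (rule selected_cube[OF g pos(1) low up pos(2,3)]) (rule that)
    then have "cz_splitting \<kappa> g (?Q S) E g' b" unfolding cz_splitting_def by blast
    then show ?thesis by blast
  qed
  then obtain E g' b where cz: "\<And>S. S \<subseteq> Basis \<Longrightarrow> cz_splitting \<kappa> g (?Q S) (E S) (g' S) (b S)"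
    by metis
  have G: "(\<integral>\<^sup>+ s\<in>cube a l. g s \<partial>lborel) = (\<Sum>S\<in>Pow Basis. (\<integral>\<^sup>+ s\<in>?Q S. g s \<partial>lborel))"
    by (subst nn_integral_sum[symmetric]) (auto simp: sum_subcubes[OF l(1)])
  have fin: "finite (Pow (Basis :: 'd set))" by simp
  have [measurable]: "E S \<in> sets borel" "g' S \<in> borel_measurable borel" "b S \<in> borel_measurable borel"
    if "S \<in> Pow Basis" for S
    using cz[of S] that unfolding cz_splitting_def by auto
  have "cz_splitting \<kappa> g (cube a l) (\<Union>S\<in>Pow Basis. E S) (\<lambda>s. \<Sum>S\<in>Pow Basis. g' S s) (\<lambda>t. \<Sum>S\<in>Pow Basis. b S t)"
    unfolding cz_splitting_def
  proof (intro conjI allI impI)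
    show "(\<Union>S\<in>Pow Basis. E S) \<in> sets borel" by (intro sets.finite_UN) auto
    show "(\<lambda>s. \<Sum>S\<in>Pow Basis. g' S s) \<in> borel_measurable borel" by (intro borel_measurable_sum) auto
    show "(\<lambda>s. \<Sum>S\<in>Pow Basis. b S s) \<in> borel_measurable borel" by (intro borel_measurable_sum) auto
    fix s
    have "(\<Sum>S\<in>Pow Basis. g' S s) \<le> (\<Sum>S\<in>Pow Basis. ennreal (2 ^ ?n * \<kappa>) * indicator (?Q S) s)"
      using cz unfolding cz_splitting_def by (intro sum_mono) auto
    also have "\<dots> = ennreal (2 ^ ?n * \<kappa>) * indicator (cube a l) s" by (rule sum_subcubes[OF l(1)])
    finally show "(\<Sum>S\<in>Pow Basis. g' S s) \<le> ennreal (2 ^ ?n * \<kappa>) * indicator (cube a l) s" .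
  next
    have "emeasure lborel (\<Union>S\<in>Pow Basis. E S) * ennreal \<kappa> \<le> (\<Sum>S\<in>Pow Basis. emeasure lborel (E S)) * ennreal \<kappa>"
      by (intro mult_right_mono emeasure_subadditive_finite) auto
    also have "\<dots> \<le> (\<Sum>S\<in>Pow Basis. ennreal ((6 * real ?n) ^ ?n) * (\<integral>\<^sup>+ s\<in>?Q S. g s \<partial>lborel))"
      unfolding sum_distrib_right using cz unfolding cz_splitting_def by (intro sum_mono) auto
    finally show "emeasure lborel (\<Union>S\<in>Pow Basis. E S) * ennreal \<kappa> \<le>
        ennreal ((6 * real ?n) ^ ?n) * (\<integral>\<^sup>+ s\<in>cube a l. g s \<partial>lborel)"
      unfolding G by (simp add: sum_distrib_left)
    have "(\<integral>\<^sup>+ t. (\<Sum>S\<in>Pow Basis. b S t) \<partial>lborel) = (\<Sum>S\<in>Pow Basis. \<integral>\<^sup>+ t. b S t \<partial>lborel)"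
      by (intro nn_integral_sum) auto
    also have "\<dots> \<le> (\<Sum>S\<in>Pow Basis. ennreal (2 * H\<^sup>2) * (\<integral>\<^sup>+ s\<in>?Q S. g s \<partial>lborel))"
      using cz unfolding cz_splitting_def by (intro sum_mono) auto
    finally show "(\<integral>\<^sup>+ t. (\<Sum>S\<in>Pow Basis. b S t) \<partial>lborel) \<le> ennreal (2 * H\<^sup>2) * (\<integral>\<^sup>+ s\<in>cube a l. g s \<partial>lborel)"
      unfolding G by (simp add: sum_distrib_left)
  next
    fix t assume t: "t \<notin> (\<Union>S\<in>Pow Basis. E S)"
    have "W_adj (\<lambda>s. g s * indicator (cube a l) s) t = (\<Sum>S\<in>Pow Basis. W_adj (\<lambda>s. g s * indicator (?Q S) s) t)"
      by (subst W_adj_sum[symmetric]) (auto simp: sum_subcubes[OF l(1)])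
    also have "\<dots> \<le> (\<Sum>S\<in>Pow Basis. 2 * W_adj (g' S) t + b S t)"
      using cz t unfolding cz_splitting_def by (intro sum_mono) auto
    also have "\<dots> = 2 * W_adj (\<lambda>s. \<Sum>S\<in>Pow Basis. g' S s) t + (\<Sum>S\<in>Pow Basis. b S t)"
      by (subst W_adj_sum) (auto simp: sum.distrib sum_distrib_left)
    finally show "W_adj (\<lambda>s. g s * indicator (cube a l) s) t \<le>
      2 * W_adj (\<lambda>s. \<Sum>S\<in>Pow Basis. g' S s) t + (\<Sum>S\<in>Pow Basis. b S t)" .
  qed
  then show ?case unfolding l_def by blast
qed

text \<open>The first summand is (6 d)^d / \<kappa> at \<theta> = 1, with the \<kappa> chosen in
  \<open>weak_type_step\<close>, and accounts for E. The second is Markov's inequality for the error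
  b at height 1/2, whose integral is at most 2 H^2 times that of g.\<close>

definition C1 :: real where "C1 = 4 * (12 * real DIM('d)) ^ DIM('d) * A\<^sup>2 + 4 * H\<^sup>2"

lemma C1_ge: "A\<^sup>2 \<le> C1"
proof -
  have "1 \<le> 12 * real DIM('d)" using DIM_positive[where 'a = 'd] by linarith
  then have "1 \<le> (12 * real DIM('d)) ^ DIM('d)" by (rule one_le_power)
  then have "1 * A\<^sup>2 \<le> (4 * (12 * real DIM('d)) ^ DIM('d)) * A\<^sup>2"
    by (intro mult_right_mono) auto
  then show ?thesis unfolding C1_def using zero_le_power2[of H] by linarith
qed

lemma C1_pos: "0 < C1"
  using C1_ge A_pos zero_less_power2[of A] by linarith

lemma weak_type_step:
  fixes g :: "'d \<Rightarrow> ennreal"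
  assumes g [measurable]: "g \<in> borel_measurable borel" and \<delta>: "0 < \<delta>" and \<theta>: "0 < \<theta>"
    and cell: "\<And>x y. (\<And>i. i \<in> Basis \<Longrightarrow> \<lfloor>x \<bullet> i / \<delta>\<rfloor> = \<lfloor>y \<bullet> i / \<delta>\<rfloor>) \<Longrightarrow> g x = g y"
    and supp: "\<And>x i. g x \<noteq> 0 \<Longrightarrow> i \<in> Basis \<Longrightarrow> \<bar>x \<bullet> i\<bar> \<le> M"
    and fin: "(\<integral>\<^sup>+ s. g s \<partial>lborel) < \<top>"
  shows "emeasure lborel {t. ennreal \<theta> < W_adj g t} \<le> ennreal (C1 / \<theta>) * (\<integral>\<^sup>+ s. g s \<partial>lborel)"
proof -
  let ?n = "DIM('d)"
  \<comment> \<open>Chosen so that the good part, bounded by 2^d \<kappa>, contributes at most 2 A^2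
    2^d \<kappa> = \<theta> / 2. The other half of the level is left to b.\<close>
  define \<kappa> where "\<kappa> = \<theta> / (4 * 2 ^ ?n * A\<^sup>2)"
  have \<kappa>: "0 < \<kappa>" using \<theta> A_pos by (simp add: \<kappa>_def)
  define I where "I = enn2real (\<integral>\<^sup>+ s. g s \<partial>lborel)"
  have I: "(\<integral>\<^sup>+ s. g s \<partial>lborel) = ennreal I" "0 \<le> I" using fin by (auto simp: I_def)
  define m :: nat where "m = nat \<lceil>M / \<delta>\<rceil>"
  have m: "M \<le> \<delta> * m" using real_nat_ceiling_ge[of "M / \<delta>"] \<delta> by (simp add: m_def field_simps)
  define a :: 'd where "a = (- (\<delta> * m)) *\<^sub>R One"
  have a: "a \<bullet> i = - (\<delta> * m)" if "i \<in> Basis" for i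
    using that by (simp add: a_def)
  \<comment> \<open>The starting cube must contain the support of g and have mean at most \<kappa>.
    The entry 1 / \<delta> makes its side exceed 1, so that the side is at most the volume and a
    linear bound suffices.\<close>
  obtain k where k: "max (max ((2 * \<delta> * m + 1) / \<delta>) (I / (\<kappa> * \<delta>))) (1 / \<delta>) < 2 ^ k"
    using real_arch_pow[of 2 "max (max ((2 * \<delta> * m + 1) / \<delta>) (I / (\<kappa> * \<delta>))) (1 / \<delta>)"]
    by auto
  define l where "l = 2 ^ k * \<delta>"
  have l: "2 * \<delta> * m + 1 < l" "I / \<kappa> < l" "1 < l"
    using k \<delta> \<kappa> by (auto simp: l_def field_simps)
  have "l ^ 1 \<le> l ^ ?n" using l(3) by (intro power_increasing) auto
  then have "I \<le> \<kappa> * l ^ ?n" using l(2) \<kappa> by (simp add: field_simps) (meson less_imp_le mult_left_mono order_trans)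
  have eq: "(\<lambda>s. g s * indicator (cube a l) s) = g"
  proof
    fix s show "g s * indicator (cube a l) s = g s"
    proof (cases "g s = 0")
      case False
      have "a \<bullet> i \<le> s \<bullet> i \<and> s \<bullet> i < a \<bullet> i + l" if "i \<in> Basis" for i
        using supp[OF False that] a[OF that] m l(1) \<delta> by auto
      then show ?thesis by (simp add: cube_def)
    qed simp
  qed
  have "\<exists>z::int. a \<bullet> i = \<delta> * z" if "i \<in> Basis" for i
    using a[OF that] by (intro exI[of _ "- int m"]) simp
  moreover have "(\<integral>\<^sup>+ s\<in>cube a (2 ^ k * \<delta>). g s \<partial>lborel) \<le> ennreal (\<kappa> * (2 ^ k * \<delta>) ^ ?n)"
    using eq \<open>I \<le> \<kappa> * l ^ ?n\<close> unfolding l_def[symmetric] by (simp add: I ennreal_leI)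
  ultimately obtain E g' b where "cz_splitting \<kappa> g (cube a l) E g' b"
    using cz_splitting_exists[OF g \<kappa> \<delta> cell, of a k] unfolding l_def by blast
  then have [measurable]: "E \<in> sets borel" "g' \<in> borel_measurable borel" "b \<in> borel_measurable borel"
    and g': "\<And>s. g' s \<le> ennreal (2 ^ ?n * \<kappa>) * indicator (cube a l) s"
    and E: "emeasure lborel E * ennreal \<kappa> \<le> ennreal ((6 * real ?n) ^ ?n) * ennreal I"
    and b: "(\<integral>\<^sup>+ t. b t \<partial>lborel) \<le> ennreal (2 * H\<^sup>2) * ennreal I"
    and W: "\<And>t. t \<notin> E \<Longrightarrow> W_adj g t \<le> 2 * W_adj g' t + b t"
    unfolding cz_splitting_def eq I(1)[symmetric] by (auto simp: eq[unfolded fun_eq_iff])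
  have "W_adj g' t \<le> ennreal (A\<^sup>2) * ennreal (2 ^ ?n * \<kappa>)" for t
    using g' by (intro W_adj_const_le order_trans[OF g']) (auto split: split_indicator)
  also have "ennreal (A\<^sup>2) * ennreal (2 ^ ?n * \<kappa>) = ennreal (\<theta> / 4)"
    using \<kappa> \<theta> A_pos by (subst ennreal_mult[symmetric]) (auto simp: \<kappa>_def)
  finally have "2 * W_adj g' t \<le> 2 * ennreal (\<theta> / 4)" for t by (rule mult_left_mono) simp
  also have "2 * ennreal (\<theta> / 4) = ennreal (\<theta> / 2)"
    using \<theta> by (simp add: ennreal_mult[symmetric] flip: ennreal_numeral)
  finally have Wg': "2 * W_adj g' t \<le> ennreal (\<theta> / 2)" for t .
  have sub: "{t. ennreal \<theta> < W_adj g t} \<subseteq> E \<union> {t\<in>space lborel. 1 \<le> ennreal (2 / \<theta>) * b t}"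
  proof
    fix t assume t: "t \<in> {t. ennreal \<theta> < W_adj g t}"
    show "t \<in> E \<union> {t\<in>space lborel. 1 \<le> ennreal (2 / \<theta>) * b t}"
    proof (rule ccontr)
      assume "\<not> ?thesis"
      then have tE: "t \<notin> E" and bt: "ennreal (2 / \<theta>) * b t < 1" by auto
      have "ennreal (\<theta> / 2) * ennreal (2 / \<theta>) = 1"
        using \<theta> by (subst ennreal_mult[symmetric]) auto
      then have "b t = ennreal (\<theta> / 2) * (ennreal (2 / \<theta>) * b t)"
        by (metis mult.assoc mult_1_left)
      also have "\<dots> \<le> ennreal (\<theta> / 2) * 1" using bt by (intro mult_left_mono) auto
      finally have "b t \<le> ennreal (\<theta> / 2)" by simp
      then have "2 * W_adj g' t + b t \<le> ennreal (\<theta> / 2) + ennreal (\<theta> / 2)"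
        by (rule add_mono[OF Wg'])
      with W[OF tE] have "W_adj g t \<le> ennreal (\<theta> / 2) + ennreal (\<theta> / 2)" by (rule order_trans)
      also have "\<dots> = ennreal \<theta>" using \<theta> by (subst ennreal_plus[symmetric]) auto
      finally show False using t by auto
    qed
  qed
  have "emeasure lborel E = emeasure lborel E * ennreal \<kappa> * ennreal (1 / \<kappa>)"
  proof -
    have "ennreal \<kappa> * ennreal (1 / \<kappa>) = 1" using \<kappa> by (subst ennreal_mult[symmetric]) auto
    then show ?thesis by (metis mult.assoc mult_1_right)
  qed
  also have "\<dots> \<le> ennreal ((6 * real ?n) ^ ?n) * ennreal I * ennreal (1 / \<kappa>)"
    using E by (rule mult_right_mono) simp
  also have "\<dots> = ennreal ((6 * real ?n) ^ ?n * I / \<kappa>)" using I \<kappa> by (simp add: ennreal_mult'[symmetric] ennreal_mult''[symmetric])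
  finally have mE: "emeasure lborel E \<le> ennreal ((6 * real ?n) ^ ?n * I / \<kappa>)" .
  have "emeasure lborel {t\<in>space lborel. 1 \<le> ennreal (2 / \<theta>) * b t} \<le> ennreal (2 / \<theta>) * (\<integral>\<^sup>+ t. b t \<partial>lborel)"
    using nn_integral_Markov_inequality[of b "space lborel" lborel "ennreal (2 / \<theta>)"] by simp
  also have "\<dots> \<le> ennreal (2 / \<theta>) * (ennreal (2 * H\<^sup>2) * ennreal I)" by (intro mult_left_mono b) simp
  also have "\<dots> = ennreal (4 * H\<^sup>2 * I / \<theta>)" using I \<theta> by (simp add: ennreal_mult'[symmetric] ennreal_mult''[symmetric])
  finally have mb: "emeasure lborel {t\<in>space lborel. 1 \<le> ennreal (2 / \<theta>) * b t} \<le> ennreal (4 * H\<^sup>2 * I / \<theta>)" .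
  have "emeasure lborel {t. ennreal \<theta> < W_adj g t} \<le> emeasure lborel E + emeasure lborel {t\<in>space lborel. 1 \<le> ennreal (2 / \<theta>) * b t}"
    by (rule order_trans[OF emeasure_mono[OF sub] emeasure_subadditive]) measurable
  also have "\<dots> \<le> ennreal ((6 * real ?n) ^ ?n * I / \<kappa>) + ennreal (4 * H\<^sup>2 * I / \<theta>)"
    by (rule add_mono[OF mE mb])
  also have "\<dots> = ennreal ((6 * real ?n) ^ ?n * I / \<kappa> + 4 * H\<^sup>2 * I / \<theta>)"
    using I \<kappa> \<theta> by (simp add: ennreal_plus)
  also have "(6 * real ?n) ^ ?n * I / \<kappa> + 4 * H\<^sup>2 * I / \<theta> = C1 / \<theta> * I"
  proof -
    have "(12 * real ?n) ^ ?n = 2 ^ ?n * (6 * real ?n) ^ ?n"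
      using power_mult_distrib[of 2 "6 * real ?n" ?n] by simp
    then show ?thesis using \<theta> A_pos by (simp add: C1_def \<kappa>_def field_simps)
  qed
  also have "ennreal (C1 / \<theta> * I) = ennreal (C1 / \<theta>) * (\<integral>\<^sup>+ s. g s \<partial>lborel)"
    using I C1_pos \<theta> by (simp only: ennreal_mult''[OF I(2)])
  finally show ?thesis .
qed


subsection \<open>The weak type (1,1) inequality\<close>

definition weak_bound where
  "weak_bound \<theta> g \<longleftrightarrow>
    emeasure lborel {t. ennreal \<theta> < W_adj g t} \<le> ennreal (C1 / \<theta>) * (\<integral>\<^sup>+ s. g s \<partial>lborel)"

text \<open>Fatou's lemma twice, once inside \<open>W_adj\<close> and once for the measures of the
  level sets. The level sets are given by strict inequalities, so membership for the limit forces
  eventual membership for the sequence.\<close>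

lemma W_adj_level_liminf:
  fixes g :: "'d \<Rightarrow> ennreal"
  assumes [measurable]: "\<And>n. f n \<in> borel_measurable borel" and lim: "\<And>s. (\<lambda>n. f n s) \<longlonglongrightarrow> g s"
    and bd: "\<And>n. emeasure lborel {t. ennreal \<theta> < W_adj (f n) t} \<le> B"
  shows "emeasure lborel {t. ennreal \<theta> < W_adj g t} \<le> B"
proof -
  have "g = (\<lambda>s. liminf (\<lambda>n. f n s))"
    using lim_imp_Liminf[OF sequentially_bot lim] by (simp add: fun_eq_iff)
  then have [measurable]: "g \<in> borel_measurable borel" by simp
  have ev: "\<forall>\<^sub>F n in sequentially. ennreal \<theta> < W_adj (f n) t" if t: "ennreal \<theta> < W_adj g t" for t
  proof -
    have "W_adj g t = (\<integral>\<^sup>+ s. liminf (\<lambda>n. ennreal ((u s t)\<^sup>2) * f n s) \<partial>lborel)"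
      unfolding W_adj_def
      by (intro nn_integral_cong lim_imp_Liminf[symmetric] ennreal_tendsto_cmult lim) auto
    also have "\<dots> \<le> liminf (\<lambda>n. W_adj (f n) t)"
      unfolding W_adj_def by (rule nn_integral_liminf) measurable
    finally show ?thesis using t by (intro less_LiminfD) simp
  qed
  have "emeasure lborel {t. ennreal \<theta> < W_adj g t} = (\<integral>\<^sup>+ t. indicator {t. ennreal \<theta> < W_adj g t} t \<partial>lborel)"
    by (rule nn_integral_indicator[symmetric]) measurable
  also have "\<dots> \<le> (\<integral>\<^sup>+ t. liminf (\<lambda>n. indicator {t. ennreal \<theta> < W_adj (f n) t} t) \<partial>lborel)"
  proof (rule nn_integral_mono)
    fix t
    show "indicator {t. ennreal \<theta> < W_adj g t} t \<le> liminf (\<lambda>n. indicator {t. ennreal \<theta> < W_adj (f n) t} t :: ennreal)"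
    proof (cases "ennreal \<theta> < W_adj g t")
      case True
      have "1 \<le> liminf (\<lambda>n. indicator {t. ennreal \<theta> < W_adj (f n) t} t :: ennreal)"
        by (rule Liminf_bounded, rule eventually_mono[OF ev[OF True]]) simp
      with True show ?thesis by simp
    qed simp
  qed
  also have "\<dots> \<le> liminf (\<lambda>n. \<integral>\<^sup>+ t. indicator {t. ennreal \<theta> < W_adj (f n) t} t \<partial>lborel)"
    by (rule nn_integral_liminf) measurable
  also have "\<dots> \<le> liminf (\<lambda>n. B)"
  proof (intro Liminf_mono always_eventually allI)
    fix n
    have "(\<integral>\<^sup>+ t. indicator {t. ennreal \<theta> < W_adj (f n) t} t \<partial>lborel) = emeasure lborel {t. ennreal \<theta> < W_adj (f n) t}"
      by (rule nn_integral_indicator) measurable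
    then show "(\<integral>\<^sup>+ t. indicator {t. ennreal \<theta> < W_adj (f n) t} t \<partial>lborel) \<le> B" using bd by simp
  qed
  also have "\<dots> = B" by (simp add: Liminf_const)
  finally show ?thesis .
qed

definition grid_corner :: "real \<Rightarrow> 'd \<Rightarrow> 'd"
  where "grid_corner \<delta> x = (\<Sum>i\<in>Basis. (\<delta> * \<lfloor>x \<bullet> i / \<delta>\<rfloor>) *\<^sub>R i)"

lemma grid_corner_inner: "i \<in> Basis \<Longrightarrow> grid_corner \<delta> x \<bullet> i = \<delta> * \<lfloor>x \<bullet> i / \<delta>\<rfloor>"
  unfolding grid_corner_def by simp

text \<open>\<open>grid_corner\<close> has countable range, so any union of grid cells is Borel,
  whatever the selection rule P.\<close>

lemma grid_corner_preimage: "grid_corner \<delta> -` P \<in> sets borel"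
proof -
  have [measurable]: "grid_corner \<delta> \<in> borel_measurable borel" unfolding grid_corner_def by measurable
  have "range (grid_corner \<delta>) \<subseteq> (\<lambda>z. \<Sum>i\<in>Basis. (\<delta> * of_int (z i)) *\<^sub>R i) ` (PiE Basis (\<lambda>_. UNIV :: int set))"
  proof
    fix y assume "y \<in> range (grid_corner \<delta>)"
    then obtain x where "y = grid_corner \<delta> x" by blast
    then have "y = (\<Sum>i\<in>Basis. (\<delta> * of_int (restrict (\<lambda>i. \<lfloor>x \<bullet> i / \<delta>\<rfloor>) Basis i)) *\<^sub>R i)"
      unfolding grid_corner_def by (auto intro: sum.cong)
    then show "y \<in> (\<lambda>z. \<Sum>i\<in>Basis. (\<delta> * of_int (z i)) *\<^sub>R i) ` (PiE Basis (\<lambda>_. UNIV :: int set))"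
      by (intro image_eqI[where x = "restrict (\<lambda>i. \<lfloor>x \<bullet> i / \<delta>\<rfloor>) Basis"]) simp_all
  qed
  moreover have "countable (PiE (Basis :: 'd set) (\<lambda>_. UNIV :: int set))"
    by (intro countable_PiE) auto
  ultimately have "countable (range (grid_corner \<delta>))"
    by (meson countable_image countable_subset)
  then have "countable (P \<inter> range (grid_corner \<delta>))" by blast
  moreover have "grid_corner \<delta> -` {p} \<inter> space borel \<in> sets borel" for p
    by (rule measurable_sets[of "grid_corner \<delta>" borel borel]) measurable
  ultimately have "(\<Union>p\<in>P \<inter> range (grid_corner \<delta>). grid_corner \<delta> -` {p} \<inter> space borel) \<in> sets borel"
    by (intro sets.countable_UN') (simp_all add: image_subset_iff)
  moreover have "(\<Union>p\<in>P \<inter> range (grid_corner \<delta>). grid_corner \<delta> -` {p} \<inter> space borel) = grid_corner \<delta> -` P"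
    by auto
  ultimately show ?thesis by simp
qed

lemma mem_cube_grid_corner:
  assumes "0 < \<delta>" shows "x \<in> cube (grid_corner \<delta> x) \<delta>"
  using floor_divide_lower[OF assms, of "x \<bullet> _"] floor_divide_upper[OF assms, of "x \<bullet> _"]
  by (auto simp: cube_def grid_corner_inner algebra_simps)

text \<open>The union of the cells of side 2^(-n) that lie inside U. The bound on the corner gives
  bounded support, which \<open>weak_type_step\<close> needs for its starting cube.\<close>

definition grid_interior :: "'d set \<Rightarrow> nat \<Rightarrow> 'd set"
  where "grid_interior U n = grid_corner ((1 / 2) ^ n) -`
    {p. cube p ((1 / 2) ^ n) \<subseteq> U \<and> (\<forall>i\<in>Basis. \<bar>p \<bullet> i\<bar> \<le> 2 ^ n)}"

lemma grid_interior_subset: "grid_interior U n \<subseteq> U"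
  unfolding grid_interior_def using mem_cube_grid_corner[of "(1/2) ^ n"] by auto

lemma grid_interior_eventually:
  assumes "open U" "x \<in> U"
  shows "\<forall>\<^sub>F n in sequentially. x \<in> grid_interior U n"
proof -
  obtain e where e: "0 < e" "ball x e \<subseteq> U" using assms by (auto simp: open_contains_ball)
  have "(\<lambda>n. (1 / 2) ^ n * real DIM('d)) \<longlonglongrightarrow> 0 * real DIM('d)"
    by (intro tendsto_intros LIMSEQ_realpow_zero) auto
  then have 1: "\<forall>\<^sub>F n in sequentially. (1 / 2) ^ n * real DIM('d) < e"
    using e(1) by (intro order_tendstoD(2)) auto
  have "filterlim (\<lambda>n. (2::real) ^ n) at_top sequentially" by real_asymp
  \<comment> \<open>The summand 1 leaves room for the passage from x to the corner of its cell,
    whose side is at most 1.\<close>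
  then have 2: "\<forall>\<^sub>F n in sequentially. norm x + 1 \<le> 2 ^ n"
    unfolding filterlim_at_top by blast
  show ?thesis using 1 2
  proof eventually_elim
    case (elim n)
    let ?d = "(1 / 2 :: real) ^ n"
    have d: "0 < ?d" "?d \<le> 1" by (auto simp: power_le_one)
    note xc = mem_cube_grid_corner[OF d(1), of x]
    have "y \<in> U" if "y \<in> cube (grid_corner ?d x) ?d" for y
    proof -
      have "dist x y < e" using dist_cube_less[OF xc that] elim(1) by linarith
      then show ?thesis using e(2) by auto
    qed
    moreover have "\<bar>grid_corner ?d x \<bullet> i\<bar> \<le> 2 ^ n" if i: "i \<in> Basis" for i
    proof -
      have "grid_corner ?d x \<bullet> i \<le> x \<bullet> i" "x \<bullet> i < grid_corner ?d x \<bullet> i + ?d"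
        using xc i by (auto simp: cube_def)
      moreover have "\<bar>x \<bullet> i\<bar> \<le> norm x" using i by (rule Basis_le_norm)
      ultimately show ?thesis using elim(2) d by linarith
    qed
    ultimately show ?case unfolding grid_interior_def by auto
  qed
qed

text \<open>Replacing each U i by its grid interior gives functions that are constant on cells, lie
  below the given one and converge to it pointwise. The bound of \<open>weak_type_step\<close> is
  uniform along them.\<close>

lemma weak_type_open:
  fixes c :: "'i \<Rightarrow> real" and U :: "'i \<Rightarrow> 'd set"
  assumes I: "finite I" and U: "\<And>i. i \<in> I \<Longrightarrow> open (U i)" "\<And>i. i \<in> I \<Longrightarrow> emeasure lborel (U i) < \<top>"
    and \<theta>: "0 < \<theta>"
  shows "weak_bound \<theta> (\<lambda>s. \<Sum>i\<in>I. ennreal (c i) * indicator (U i) s)"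
proof -
  define g where "g s = (\<Sum>i\<in>I. ennreal (c i) * indicator (U i) s)" for s
  define f where "f n s = (\<Sum>i\<in>I. ennreal (c i) * indicator (grid_interior (U i) n) s)" for n s
  have [measurable]: "grid_interior (U i) n \<in> sets borel" for i n
    unfolding grid_interior_def by (rule grid_corner_preimage)
  have [measurable]: "f n \<in> borel_measurable borel" for n unfolding f_def by measurable
  have fg: "f n s \<le> g s" for n s
    unfolding f_def g_def using grid_interior_subset by (intro sum_mono) (auto split: split_indicator)
  have "(\<integral>\<^sup>+ s. g s \<partial>lborel) = (\<Sum>i\<in>I. ennreal (c i) * emeasure lborel (U i))"
    unfolding g_def using U(1) by (subst nn_integral_sum) (auto simp: nn_integral_cmult_indicator)
  also have "\<dots> < \<top>" using U(2) I by (auto simp: ennreal_mult_less_top)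
  finally have gfin: "(\<integral>\<^sup>+ s. g s \<partial>lborel) < \<top>" .
  have "emeasure lborel {t. ennreal \<theta> < W_adj g t} \<le> ennreal (C1 / \<theta>) * (\<integral>\<^sup>+ s. g s \<partial>lborel)"
  proof (rule W_adj_level_liminf)
    show "f n \<in> borel_measurable borel" for n by measurable
    show "(\<lambda>n. f n s) \<longlonglongrightarrow> g s" for s
      unfolding f_def g_def
    proof (intro tendsto_sum ennreal_tendsto_cmult)
      fix i assume i: "i \<in> I"
      show "(\<lambda>n. indicator (grid_interior (U i) n) s) \<longlonglongrightarrow> (indicator (U i) s :: ennreal)"
      proof (cases "s \<in> U i")
        case True
        show ?thesis
          using grid_interior_eventually[OF U(1)[OF i] True] True
          by (intro tendsto_eventually) (auto elim: eventually_mono)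
      next
        case False
        then have "s \<notin> grid_interior (U i) n" for n using grid_interior_subset by blast
        then show ?thesis using False by simp
      qed
    qed auto
    fix n
    let ?d = "(1 / 2 :: real) ^ n"
    have "emeasure lborel {t. ennreal \<theta> < W_adj (f n) t} \<le> ennreal (C1 / \<theta>) * (\<integral>\<^sup>+ s. f n s \<partial>lborel)"
    \<comment> \<open>Corners have coordinates of modulus at most 2^n, and points of a cell exceed
      their corner by at most one side.\<close>
    proof (rule weak_type_step[where \<delta> = ?d and M = "2 ^ n + ?d"])
      show "f n x = f n y" if "\<And>i. i \<in> Basis \<Longrightarrow> \<lfloor>x \<bullet> i / ?d\<rfloor> = \<lfloor>y \<bullet> i / ?d\<rfloor>" for x y
      proof -
        have "grid_corner ?d x = grid_corner ?d y" unfolding grid_corner_def using that by (intro sum.cong) auto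
        then have "x \<in> grid_interior V n \<longleftrightarrow> y \<in> grid_interior V n" for V by (simp add: grid_interior_def)
        then show ?thesis unfolding f_def by (intro sum.cong) (auto split: split_indicator)
      qed
      show "\<bar>x \<bullet> b\<bar> \<le> 2 ^ n + ?d" if "f n x \<noteq> 0" "b \<in> Basis" for x b
      proof -
        obtain i where "x \<in> grid_interior (U i) n"
        proof -
          have "\<exists>i\<in>I. x \<in> grid_interior (U i) n"
            using \<open>f n x \<noteq> 0\<close> I by (auto simp: f_def indicator_def)
          then show thesis using that by blast
        qed
        then have "\<bar>grid_corner ?d x \<bullet> b\<bar> \<le> 2 ^ n" using \<open>b \<in> Basis\<close> by (auto simp: grid_interior_def)
        moreover have "x \<in> cube (grid_corner ?d x) ?d" by (rule mem_cube_grid_corner) simp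
        then have "grid_corner ?d x \<bullet> b \<le> x \<bullet> b" "x \<bullet> b < grid_corner ?d x \<bullet> b + ?d"
          using \<open>b \<in> Basis\<close> by (auto simp: cube_def)
        ultimately show ?thesis by linarith
      qed
      show "(\<integral>\<^sup>+ s. f n s \<partial>lborel) < \<top>"
        using nn_integral_mono[OF fg] gfin by (rule order.strict_trans1)
    qed (use \<theta> in auto)
    also have "\<dots> \<le> ennreal (C1 / \<theta>) * (\<integral>\<^sup>+ s. g s \<partial>lborel)"
      by (intro mult_left_mono nn_integral_mono fg) auto
    finally show "emeasure lborel {t. ennreal \<theta> < W_adj (f n) t} \<le> ennreal (C1 / \<theta>) * (\<integral>\<^sup>+ s. g s \<partial>lborel)" .
  qed
  then show ?thesis unfolding weak_bound_def g_def .
qed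

text \<open>Level sets are enlarged to open sets of almost the same measure. This gives a larger f
  covered by \<open>weak_type_open\<close> whose integral is nearly that of g, and
  \<open>W_adj\<close> is monotone.\<close>

lemma weak_type_simple:
  fixes g :: "'d \<Rightarrow> ennreal"
  assumes g: "simple_function lborel g" "\<And>s. g s < \<top>" and fin: "(\<integral>\<^sup>+ s. g s \<partial>lborel) < \<top>" and \<theta>: "0 < \<theta>"
  shows "weak_bound \<theta> g"
  unfolding weak_bound_def
proof (rule ennreal_le_epsilon)
  fix e :: real assume e: "0 < e"
  have [measurable]: "g \<in> borel_measurable borel" using g(1) borel_measurable_simple_function by force
  define I where "I = g ` UNIV - {0}"
  have I: "finite I" using g(1) by (auto simp: I_def simple_function_def)
  define c where "c = enn2real"
  define K where "K = (\<Sum>y\<in>I. c y) + 1"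
  have c: "ennreal (c y) = y" "0 < c y" if "y \<in> I" for y
    using that g(2) by (auto simp: c_def I_def enn2real_positive_iff zero_less_iff_neq_zero)
  have K: "0 < K" unfolding K_def c_def by (simp add: sum_nonneg add_nonneg_pos)
  \<comment> \<open>The enlargement adds at most K \<epsilon> to the integral, which the weak type
    constant C1 / \<theta> turns into exactly e.\<close>
  define \<epsilon> where "\<epsilon> = e * \<theta> / (C1 * K)"
  have \<epsilon>: "0 < \<epsilon>" using e \<theta> C1_pos K by (simp add: \<epsilon>_def)
  have lev [measurable]: "g -` {y} \<in> sets borel" for y
    using measurable_sets[of g borel borel "{y}"] by simp
  have "\<exists>U. open U \<and> g -` {y} \<subseteq> U \<and> emeasure lborel (U - g -` {y}) \<le> ennreal \<epsilon>" for y
    using outer_regular_lborel[OF lev \<epsilon>] by (metis less_imp_le)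
  then obtain U where U: "\<And>y. open (U y)" "\<And>y. g -` {y} \<subseteq> U y" "\<And>y. emeasure lborel (U y - g -` {y}) \<le> ennreal \<epsilon>"
    by metis
  have mU: "emeasure lborel (U y) \<le> emeasure lborel (g -` {y}) + ennreal \<epsilon>" for y
  proof -
    have "emeasure lborel (U y) \<le> emeasure lborel (g -` {y} \<union> (U y - g -` {y}))"
      using U(1) by (intro emeasure_mono) auto
    also have "\<dots> \<le> emeasure lborel (g -` {y}) + emeasure lborel (U y - g -` {y})"
      using U(1) by (intro emeasure_subadditive) auto
    finally show ?thesis using U(3)[of y] by (meson add_left_mono order_trans)
  qed
  have gsum: "g s = (\<Sum>y\<in>I. y * indicator (g -` {y}) s)" for s
  proof (cases "g s = 0")
    case True
    then show ?thesis by (auto simp: I_def indicator_def)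
  next
    case False
    then have "g s \<in> I" by (simp add: I_def)
    have "(\<Sum>y\<in>I. y * indicator (g -` {y}) s) = (\<Sum>y\<in>I. if y = g s then y else 0)"
      by (intro sum.cong) (auto simp: indicator_def)
    then show ?thesis using I \<open>g s \<in> I\<close> by simp
  qed
  have Ig: "(\<integral>\<^sup>+ s. g s \<partial>lborel) = (\<Sum>y\<in>I. y * emeasure lborel (g -` {y}))"
  proof -
    have "(\<integral>\<^sup>+ s. g s \<partial>lborel) = (\<integral>\<^sup>+ s. (\<Sum>y\<in>I. y * indicator (g -` {y}) s) \<partial>lborel)"
      by (rule nn_integral_cong) (rule gsum)
    also have "\<dots> = (\<Sum>y\<in>I. \<integral>\<^sup>+ s. y * indicator (g -` {y}) s \<partial>lborel)"
      by (rule nn_integral_sum) auto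
    finally show ?thesis by (simp add: nn_integral_cmult_indicator)
  qed
  have levfin: "emeasure lborel (g -` {y}) < \<top>" if y: "y \<in> I" for y
  proof -
    have "y * emeasure lborel (g -` {y}) \<le> (\<integral>\<^sup>+ s. g s \<partial>lborel)"
      unfolding Ig using I y by (intro member_le_sum) auto
    then have "y * emeasure lborel (g -` {y}) < \<top>" using fin by (rule order.strict_trans1)
    then show ?thesis using y by (auto simp: ennreal_mult_less_top I_def)
  qed
  define f where "f s = (\<Sum>y\<in>I. ennreal (c y) * indicator (U y) s)" for s
  have "weak_bound \<theta> f" unfolding f_def
  proof (rule weak_type_open[OF I _ _ \<theta>])
    show "emeasure lborel (U y) < \<top>" if "y \<in> I" for y
      by (rule order.strict_trans1[OF mU]) (use levfin[OF that] in simp)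
  qed (use U(1) in auto)
  have gf: "g s \<le> f s" for s
  proof -
    have "y * indicator (g -` {y}) s \<le> ennreal (c y) * indicator (U y) s" if "y \<in> I" for y
      using U(2)[of y] c(1)[OF that] by (auto split: split_indicator)
    then show ?thesis unfolding f_def by (subst gsum) (rule sum_mono)
  qed
  have "(\<integral>\<^sup>+ s. f s \<partial>lborel) = (\<Sum>y\<in>I. ennreal (c y) * emeasure lborel (U y))"
    unfolding f_def using U(1) by (subst nn_integral_sum) (auto simp: nn_integral_cmult_indicator)
  also have "\<dots> \<le> (\<Sum>y\<in>I. y * emeasure lborel (g -` {y}) + ennreal (c y) * ennreal \<epsilon>)"
  proof (rule sum_mono)
    fix y assume y: "y \<in> I"
    have "ennreal (c y) * emeasure lborel (U y) \<le> ennreal (c y) * (emeasure lborel (g -` {y}) + ennreal \<epsilon>)"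
      by (intro mult_left_mono mU) auto
    then show "ennreal (c y) * emeasure lborel (U y) \<le> y * emeasure lborel (g -` {y}) + ennreal (c y) * ennreal \<epsilon>"
      by (simp add: c(1)[OF y] distrib_left)
  qed
  also have "\<dots> = (\<integral>\<^sup>+ s. g s \<partial>lborel) + ennreal ((\<Sum>y\<in>I. c y) * \<epsilon>)"
    unfolding sum.distrib Ig using \<epsilon> by (simp add: c_def sum_distrib_right ennreal_mult flip: sum_ennreal)
  also have "\<dots> \<le> (\<integral>\<^sup>+ s. g s \<partial>lborel) + ennreal (K * \<epsilon>)"
    using \<epsilon> by (intro add_left_mono ennreal_leI mult_right_mono) (auto simp: K_def)
  finally have If: "(\<integral>\<^sup>+ s. f s \<partial>lborel) \<le> (\<integral>\<^sup>+ s. g s \<partial>lborel) + ennreal (K * \<epsilon>)" .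
  have [measurable]: "f \<in> borel_measurable borel"
  proof -
    have [measurable]: "U y \<in> sets borel" for y using U(1) by auto
    show ?thesis unfolding f_def by measurable
  qed
  have "emeasure lborel {t. ennreal \<theta> < W_adj g t} \<le> emeasure lborel {t. ennreal \<theta> < W_adj f t}"
    using W_adj_mono[OF gf] by (intro emeasure_mono) (auto intro: order.strict_trans2)
  also have "\<dots> \<le> ennreal (C1 / \<theta>) * (\<integral>\<^sup>+ s. f s \<partial>lborel)"
    using \<open>weak_bound \<theta> f\<close> unfolding weak_bound_def .
  also have "\<dots> \<le> ennreal (C1 / \<theta>) * ((\<integral>\<^sup>+ s. g s \<partial>lborel) + ennreal (K * \<epsilon>))"
    by (intro mult_left_mono If) auto
  also have "\<dots> = ennreal (C1 / \<theta>) * (\<integral>\<^sup>+ s. g s \<partial>lborel) + ennreal (C1 / \<theta> * (K * \<epsilon>))"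
    using C1_pos \<theta> K \<epsilon> unfolding distrib_left
    by (subst ennreal_mult[of "C1 / \<theta>" "K * \<epsilon>"]) auto
  also have "C1 / \<theta> * (K * \<epsilon>) = e" using C1_pos \<theta> K by (simp add: \<epsilon>_def)
  finally show "emeasure lborel {t. ennreal \<theta> < W_adj g t} \<le> ennreal (C1 / \<theta>) * (\<integral>\<^sup>+ s. g s \<partial>lborel) + ennreal e" .
qed

lemma weak_type:
  fixes g :: "'d \<Rightarrow> ennreal"
  assumes g: "g \<in> borel_measurable borel" and \<theta>: "0 < \<theta>"
  shows "emeasure lborel {t. ennreal \<theta> < W_adj g t} \<le> ennreal (C1 / \<theta>) * (\<integral>\<^sup>+ s. g s \<partial>lborel)"
proof (cases "(\<integral>\<^sup>+ s. g s \<partial>lborel) < \<top>")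
  case True
  have "g \<in> borel_measurable lborel" using g by simp
  then obtain f where f: "\<And>i. simple_function lborel (f i)" "incseq f" "\<And>i x. f i x < \<top>" "\<And>x. (SUP i. f i x) = g x"
    by (rule borel_measurable_implies_simple_function_sequence') (rule that)
  have fg: "f i x \<le> g x" for i x unfolding f(4)[symmetric] by (rule SUP_upper) simp
  show ?thesis
  proof (rule W_adj_level_liminf)
    show "f n \<in> borel_measurable borel" for n
      using borel_measurable_simple_function[OF f(1)] by simp
    show "(\<lambda>n. f n s) \<longlonglongrightarrow> g s" for s
      unfolding f(4)[symmetric] using f(2) by (intro LIMSEQ_SUP) (auto simp: incseq_def le_fun_def)
    fix n
    have "weak_bound \<theta> (f n)"
      by (intro weak_type_simple f \<theta> order.strict_trans1[OF nn_integral_mono True] fg)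
    then show "emeasure lborel {t. ennreal \<theta> < W_adj (f n) t} \<le> ennreal (C1 / \<theta>) * (\<integral>\<^sup>+ s. g s \<partial>lborel)"
      unfolding weak_bound_def by (rule order_trans) (intro mult_left_mono nn_integral_mono fg, simp)
  qed
next
  case False
  then have "ennreal (C1 / \<theta>) * (\<integral>\<^sup>+ s. g s \<partial>lborel) = \<top>"
    using C1_pos \<theta> by (simp add: ennreal_mult_eq_top_iff less_top[symmetric])
  then show ?thesis by simp
qed

end

subsection \<open>Interpolation and duality\<close>

lemma nn_integral_powr_from_0:
  fixes a c :: real
  assumes "-1 < a" "0 \<le> c"
  shows "(\<integral>\<^sup>+ x. ennreal (x powr a) * indicator {0<..<c} x \<partial>lborel) = ennreal (c powr (a + 1) / (a + 1))"
proof -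
  have "(\<integral>\<^sup>+ x. ennreal (x powr a) * indicator {0<..<c} x \<partial>lborel) =
      (\<integral>\<^sup>+ x. ennreal (x powr a) * indicator {0..c} x \<partial>lborel)"
  proof (rule nn_integral_cong_AE)
    show "AE x in lborel. ennreal (x powr a) * indicator {0<..<c} x = ennreal (x powr a) * indicator {0..c} x"
      using AE_lborel_singleton[of 0] AE_lborel_singleton[of c]
      by eventually_elim (auto split: split_indicator)
  qed
  also have "\<dots> = ennreal (c powr (a + 1) / (a + 1))"
    by (rule nn_integral_has_integral_lebesgue'[OF _ has_integral_powr_from_0[OF assms]]) simp
  finally show ?thesis .
qed

context hormander_kernel begin

text \<open>The usual splitting of \<open>g\<close> at height \<open>l / (2 A\<^sup>2)\<close>, whose lower part contributes at most \<open>l / 2\<close>.\<close>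

lemma W_adj_split_level:
  fixes g :: "'d \<Rightarrow> real"
  assumes [measurable]: "g \<in> borel_measurable borel" and l: "0 < l"
  shows "emeasure lborel {t. ennreal l < W_adj (\<lambda>s. ennreal (g s)) t} \<le>
    ennreal (2 * C1 / l) * (\<integral>\<^sup>+ s. ennreal (g s) * indicator {0<..<2 * A\<^sup>2 * g s} l \<partial>lborel)"
proof -
  define f where "f s = ennreal (g s) * indicator {0<..<2 * A\<^sup>2 * g s} l" for s
  have [measurable]: "f \<in> borel_measurable borel" unfolding f_def greaterThanLessThan_def greaterThan_def lessThan_def
    by measurable
  have A2: "0 < A\<^sup>2" using A_pos by simp
  have le: "ennreal (g s) \<le> f s + ennreal (l / (2 * A\<^sup>2))" for s
  proof (cases "l < 2 * A\<^sup>2 * g s")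
    case True
    then show ?thesis using l by (simp add: f_def)
  next
    case False
    then have "g s \<le> l / (2 * A\<^sup>2)" using A2 by (simp add: field_simps)
    then show ?thesis by (intro add_increasing ennreal_leI) auto
  qed
  have "W_adj (\<lambda>s. ennreal (g s)) t \<le> W_adj f t + ennreal (l / 2)" for t
  proof -
    have "W_adj (\<lambda>s. ennreal (g s)) t \<le> W_adj (\<lambda>s. f s + ennreal (l / (2 * A\<^sup>2))) t"
      by (rule W_adj_mono) (rule le)
    also have "\<dots> = W_adj f t + W_adj (\<lambda>s. ennreal (l / (2 * A\<^sup>2))) t"
      by (rule W_adj_add) auto
    also have "W_adj (\<lambda>s. ennreal (l / (2 * A\<^sup>2))) t \<le> ennreal (A\<^sup>2) * ennreal (l / (2 * A\<^sup>2))"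
      by (rule W_adj_const_le) simp
    also have "\<dots> = ennreal (l / 2)" using A2 l by (subst ennreal_mult[symmetric]) auto
    finally show ?thesis by (simp add: add_left_mono)
  qed
  note split = this
  have "{t. ennreal l < W_adj (\<lambda>s. ennreal (g s)) t} \<subseteq> {t. ennreal (l / 2) < W_adj f t}"
  proof safe
    fix t assume t: "ennreal l < W_adj (\<lambda>s. ennreal (g s)) t"
    show "ennreal (l / 2) < W_adj f t"
    proof (rule ccontr)
      assume "\<not> ?thesis"
      then have "W_adj f t + ennreal (l / 2) \<le> ennreal (l / 2) + ennreal (l / 2)" by (intro add_right_mono) simp
      also have "\<dots> = ennreal l" using l by (subst ennreal_plus[symmetric]) auto
      finally show False using t split[of t] by (meson leD order_trans)
    qed
  qed
  then have "emeasure lborel {t. ennreal l < W_adj (\<lambda>s. ennreal (g s)) t} \<le> emeasure lborel {t. ennreal (l / 2) < W_adj f t}"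
    by (rule emeasure_mono) measurable
  also have "\<dots> \<le> ennreal (C1 / (l / 2)) * (\<integral>\<^sup>+ s. f s \<partial>lborel)"
    using l by (intro weak_type) auto
  also have "C1 / (l / 2) = 2 * C1 / l" by simp
  finally show ?thesis unfolding f_def .
qed

text \<open>Marcinkiewicz interpolation between weak L^1 and L^\<infinity>, with
  \<open>W_adj_split_level\<close> inserted into the layer cake formula. The remaining integral of
  l^(r-2) up to 2 A^2 g(s) converges at 0 because r > 1 and yields (2 A^2)^(r-1) / (r-1).
  Boundedness of g makes \<open>W_adj\<close> finite, so real powers can be taken.\<close>

lemma W_adj_Lr:
  fixes g :: "'d \<Rightarrow> real"
  assumes [measurable]: "g \<in> borel_measurable borel" and g: "\<And>s. 0 \<le> g s" "\<And>s. g s \<le> M" and r: "1 < r"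
  shows "(\<integral>\<^sup>+ t. ennreal (enn2real (W_adj (\<lambda>s. ennreal (g s)) t) powr r) \<partial>lborel) \<le>
    ennreal (2 * C1 * (r / (r - 1)) * (2 * A\<^sup>2) powr (r - 1)) * (\<integral>\<^sup>+ s. ennreal (g s powr r) \<partial>lborel)"
proof -
  define v where "v t = enn2real (W_adj (\<lambda>s. ennreal (g s)) t)" for t
  have [measurable]: "v \<in> borel_measurable borel" unfolding v_def by measurable
  have "W_adj (\<lambda>s. ennreal (g s)) t \<le> ennreal (A\<^sup>2) * ennreal M" for t
    using g(2) by (intro W_adj_const_le ennreal_leI)
  then have vW: "ennreal (v t) = W_adj (\<lambda>s. ennreal (g s)) t" for t
    unfolding v_def by (metis ennreal_enn2real ennreal_less_top ennreal_mult_less_top order.strict_trans1)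
  have v0: "0 \<le> v t" for t by (simp add: v_def)
  have lev: "emeasure lborel {t. l < v t} \<le>
    ennreal (2 * C1 / l) * (\<integral>\<^sup>+ s. ennreal (g s) * indicator {0<..<2 * A\<^sup>2 * g s} l \<partial>lborel)" if l: "0 < l" for l
  proof -
    have "{t. l < v t} = {t. ennreal l < W_adj (\<lambda>s. ennreal (g s)) t}"
      unfolding vW[symmetric] using l by (auto simp: ennreal_less_iff)
    then show ?thesis using W_adj_split_level[OF assms(1) l] by simp
  qed
  have [measurable]: "Measurable.pred (borel \<Otimes>\<^sub>M borel) (\<lambda>x. fst x \<in> {0<..<v (snd x)})"
    "Measurable.pred (borel \<Otimes>\<^sub>M borel) (\<lambda>x. snd x \<in> {0<..<v (fst x)})"
    "Measurable.pred (borel \<Otimes>\<^sub>M borel) (\<lambda>x. fst x \<in> {0<..<2 * A\<^sup>2 * g (snd x)})"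
    unfolding greaterThanLessThan_iff by measurable
  \<comment> \<open>The layer cake formula: v^r is the integral of r l^(r-1) over 0 < l < v.\<close>
  have "(\<integral>\<^sup>+ t. ennreal (v t powr r) \<partial>lborel) =
      (\<integral>\<^sup>+ t. (\<integral>\<^sup>+ l. ennreal (r * l powr (r - 1)) * indicator {0<..<v t} l \<partial>lborel) \<partial>lborel)"
  proof (rule nn_integral_cong)
    fix t
    have "(\<integral>\<^sup>+ l. ennreal (r * l powr (r - 1)) * indicator {0<..<v t} l \<partial>lborel) =
        (\<integral>\<^sup>+ l. ennreal r * (ennreal (l powr (r - 1)) * indicator {0<..<v t} l) \<partial>lborel)"
      using r by (intro nn_integral_cong) (simp add: ennreal_mult mult.assoc)
    also have "\<dots> = ennreal r * ennreal (v t powr r / r)"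
      using r nn_integral_powr_from_0[of "r - 1" "v t"] v0 by (subst nn_integral_cmult) auto
    also have "\<dots> = ennreal (v t powr r)"
      using r by (subst ennreal_mult[symmetric]) auto
    finally show "ennreal (v t powr r) = (\<integral>\<^sup>+ l. ennreal (r * l powr (r - 1)) * indicator {0<..<v t} l \<partial>lborel)"
      by simp
  qed
  also have "\<dots> = (\<integral>\<^sup>+ l. (\<integral>\<^sup>+ t. ennreal (r * l powr (r - 1)) * indicator {0<..<v t} l \<partial>lborel) \<partial>lborel)"
    by (rule lborel_pair.Fubini') measurable
  also have "\<dots> \<le> (\<integral>\<^sup>+ l. (\<integral>\<^sup>+ s. ennreal (2 * C1 * r * g s) * (ennreal (l powr (r - 2)) * indicator {0<..<2 * A\<^sup>2 * g s} l) \<partial>lborel) \<partial>lborel)"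
  proof (rule nn_integral_mono)
    fix l :: real
    show "(\<integral>\<^sup>+ t. ennreal (r * l powr (r - 1)) * indicator {0<..<v t} l \<partial>lborel) \<le>
       (\<integral>\<^sup>+ s. ennreal (2 * C1 * r * g s) * (ennreal (l powr (r - 2)) * indicator {0<..<2 * A\<^sup>2 * g s} l) \<partial>lborel)"
    proof (cases "0 < l")
      case True
      have "(\<integral>\<^sup>+ t. ennreal (r * l powr (r - 1)) * indicator {0<..<v t} l \<partial>lborel) =
          (\<integral>\<^sup>+ t. ennreal (r * l powr (r - 1)) * indicator {t. l < v t} t \<partial>lborel)"
        using True by (intro nn_integral_cong) (auto split: split_indicator)
      also have "\<dots> = ennreal (r * l powr (r - 1)) * emeasure lborel {t. l < v t}"
        by (rule nn_integral_cmult_indicator) measurable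
      also have "\<dots> \<le> ennreal (r * l powr (r - 1)) *
          (ennreal (2 * C1 / l) * (\<integral>\<^sup>+ s. ennreal (g s) * indicator {0<..<2 * A\<^sup>2 * g s} l \<partial>lborel))"
        by (intro mult_left_mono lev True) auto
      also have "\<dots> = ennreal (2 * C1 * r * l powr (r - 2)) * (\<integral>\<^sup>+ s. ennreal (g s) * indicator {0<..<2 * A\<^sup>2 * g s} l \<partial>lborel)"
      proof -
        have "l powr (r - 1) = l powr (r - 2) * l" using True powr_add[of l "r - 2" 1] by simp
        then have "r * l powr (r - 1) * (2 * C1 / l) = 2 * C1 * r * l powr (r - 2)" using True by simp
        then have "ennreal (r * l powr (r - 1)) * ennreal (2 * C1 / l) = ennreal (2 * C1 * r * l powr (r - 2))"
          using True r C1_pos by (subst ennreal_mult[symmetric]) auto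
        then show ?thesis by (simp only: mult.assoc[symmetric])
      qed
      also have "\<dots> = (\<integral>\<^sup>+ s. ennreal (2 * C1 * r * l powr (r - 2)) * (ennreal (g s) * indicator {0<..<2 * A\<^sup>2 * g s} l) \<partial>lborel)"
        unfolding greaterThanLessThan_def greaterThan_def lessThan_def
        by (rule nn_integral_cmult[symmetric]) measurable
      also have "\<dots> = (\<integral>\<^sup>+ s. ennreal (2 * C1 * r * g s) * (ennreal (l powr (r - 2)) * indicator {0<..<2 * A\<^sup>2 * g s} l) \<partial>lborel)"
        using r C1_pos g(1) by (intro nn_integral_cong) (simp add: ennreal_mult ac_simps)
      finally show ?thesis .
    next
      case False
      have "(\<integral>\<^sup>+ t. ennreal (r * l powr (r - 1)) * indicator {0<..<v t} l \<partial>lborel) = (\<integral>\<^sup>+ t. 0 \<partial>(lborel :: 'd measure))"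
        using False by (intro nn_integral_cong) auto
      then show ?thesis by simp
    qed
  qed
  also have "\<dots> = (\<integral>\<^sup>+ s. (\<integral>\<^sup>+ l. ennreal (2 * C1 * r * g s) * (ennreal (l powr (r - 2)) * indicator {0<..<2 * A\<^sup>2 * g s} l) \<partial>lborel) \<partial>lborel)"
    by (rule lborel_pair.Fubini'[symmetric]) measurable
  also have "\<dots> = (\<integral>\<^sup>+ s. ennreal (2 * C1 * (r / (r - 1)) * (2 * A\<^sup>2) powr (r - 1)) * ennreal (g s powr r) \<partial>lborel)"
  proof (rule nn_integral_cong)
    fix s
    have "(\<integral>\<^sup>+ l. ennreal (2 * C1 * r * g s) * (ennreal (l powr (r - 2)) * indicator {0<..<2 * A\<^sup>2 * g s} l) \<partial>lborel) =
        ennreal (2 * C1 * r * g s) * ennreal ((2 * A\<^sup>2 * g s) powr (r - 1) / (r - 1))"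
      using nn_integral_powr_from_0[of "r - 2" "2 * A\<^sup>2 * g s"] r g(1)[of s] by (subst nn_integral_cmult) auto
    also have "\<dots> = ennreal (2 * C1 * r * g s * ((2 * A\<^sup>2 * g s) powr (r - 1) / (r - 1)))"
      using r C1_pos g(1)[of s] by (subst ennreal_mult[symmetric]) auto
    also have "2 * C1 * r * g s * ((2 * A\<^sup>2 * g s) powr (r - 1) / (r - 1)) =
        (2 * C1 * (r / (r - 1)) * (2 * A\<^sup>2) powr (r - 1)) * g s powr r"
    proof -
      have "g s powr r = g s * g s powr (r - 1)"
        using g(1)[of s] powr_add[of "g s" 1 "r - 1"] by (cases "g s = 0") auto
      moreover have "(2 * A\<^sup>2 * g s) powr (r - 1) = (2 * A\<^sup>2) powr (r - 1) * g s powr (r - 1)"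
        by (rule powr_mult)
      ultimately show ?thesis by simp
    qed
    finally show "(\<integral>\<^sup>+ l. ennreal (2 * C1 * r * g s) * (ennreal (l powr (r - 2)) * indicator {0<..<2 * A\<^sup>2 * g s} l) \<partial>lborel) =
      ennreal (2 * C1 * (r / (r - 1)) * (2 * A\<^sup>2) powr (r - 1)) * ennreal (g s powr r)"
      using r C1_pos by (simp only: ennreal_mult''[OF powr_ge_zero])
  qed
  also have "\<dots> = ennreal (2 * C1 * (r / (r - 1)) * (2 * A\<^sup>2) powr (r - 1)) * (\<integral>\<^sup>+ s. ennreal (g s powr r) \<partial>lborel)"
    by (rule nn_integral_cmult) measurable
  finally show ?thesis unfolding v_def .
qed

text \<open>The endpoint q = 1, where the dual exponent is infinite and the L^\<infinity> bound of
  the adjoint takes the place of interpolation.\<close>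

lemma W_L1:
  assumes [measurable]: "h \<in> borel_measurable borel"
  shows "(\<integral>\<^sup>+ s. W h s \<partial>lborel) \<le> ennreal (A\<^sup>2) * (\<integral>\<^sup>+ t. h t \<partial>lborel)"
proof -
  have "(\<integral>\<^sup>+ s. W h s \<partial>lborel) = (\<integral>\<^sup>+ t. h t * W_adj (\<lambda>_. 1) t \<partial>lborel)"
    using W_adj_duality[of "\<lambda>_. 1" h] by simp
  also have "\<dots> \<le> (\<integral>\<^sup>+ t. h t * ennreal (A\<^sup>2) \<partial>lborel)"
    using W_adj_const_le[of "\<lambda>_. 1" 1] by (intro nn_integral_mono mult_left_mono) auto
  also have "\<dots> = ennreal (A\<^sup>2) * (\<integral>\<^sup>+ t. h t \<partial>lborel)"
    by (subst nn_integral_multc) (auto simp: mult.commute)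
  finally show ?thesis .
qed

text \<open>Duality against \<open>g = w\<^bsup>q-1\<^esup>\<close>, with Young's inequality in place of Hoelder's.\<close>

lemma truncated_W_Lq:
  fixes h :: "'d \<Rightarrow> real" and w :: "'d \<Rightarrow> real"
  assumes [measurable]: "h \<in> borel_measurable borel" "w \<in> borel_measurable borel" and h: "\<And>t. 0 \<le> h t"
    and q: "1 < q" and w: "\<And>s. 0 \<le> w s" "\<And>s. w s \<le> M" "\<And>s. ennreal (w s) \<le> W (\<lambda>t. ennreal (h t)) s"
    and fin: "(\<integral>\<^sup>+ s. ennreal (w s powr q) \<partial>lborel) < \<top>"
  shows "(\<integral>\<^sup>+ s. ennreal (w s powr q) \<partial>lborel) \<le> ennreal ((2 * q * C1) powr q) * (\<integral>\<^sup>+ t. ennreal (h t powr q) \<partial>lborel)"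
proof (cases "(\<integral>\<^sup>+ t. ennreal (h t powr q) \<partial>lborel) < \<top>")
  case True
  \<comment> \<open>For the dual exponent r one has r / (r - 1) = q, so the constant of
    \<open>W_adj_Lr\<close> is L (2 A^2)^(r-1). As 2 A^2 \<le> L, it is at most L^r.\<close>
  define L where "L = 2 * q * C1"
  have L: "0 < L" using q C1_pos by (simp add: L_def)
  define r where "r = q / (q - 1)"
  have r: "1 < r" "r / (r - 1) = q" "(q - 1) * r = q" "1 / q + 1 / r = 1" using q by (auto simp: r_def field_simps)
  define g where "g s = w s powr (q - 1)" for s
  have [measurable]: "g \<in> borel_measurable borel" unfolding g_def by measurable
  have gw: "w s * g s = w s powr q" "g s powr r = w s powr q" for s
    using w(1)[of s] powr_add[of "w s" 1 "q - 1"] r(3) by (cases "w s = 0", auto simp: g_def powr_powr)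
  have g: "0 \<le> g s" "g s \<le> M powr (q - 1)" for s
    using w(1,2)[of s] q by (auto simp: g_def intro!: powr_mono2)
  define v where "v t = enn2real (W_adj (\<lambda>s. ennreal (g s)) t)" for t
  have [measurable]: "v \<in> borel_measurable borel" unfolding v_def by measurable
  have "W_adj (\<lambda>s. ennreal (g s)) t \<le> ennreal (A\<^sup>2) * ennreal (M powr (q - 1))" for t
    using g(2) by (intro W_adj_const_le ennreal_leI)
  then have vW: "ennreal (v t) = W_adj (\<lambda>s. ennreal (g s)) t" for t
    unfolding v_def by (metis ennreal_enn2real ennreal_less_top ennreal_mult_less_top order.strict_trans1)
  have v0: "0 \<le> v t" for t by (simp add: v_def)
  let ?I = "\<integral>\<^sup>+ s. ennreal (w s powr q) \<partial>lborel" and ?J = "\<integral>\<^sup>+ t. ennreal (h t powr q) \<partial>lborel"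
  have vr: "(\<integral>\<^sup>+ t. ennreal (v t powr r) \<partial>lborel) \<le> ennreal (L powr r) * ?I"
  proof -
    have "(\<integral>\<^sup>+ t. ennreal (v t powr r) \<partial>lborel) \<le> ennreal (2 * C1 * (r / (r - 1)) * (2 * A\<^sup>2) powr (r - 1)) * (\<integral>\<^sup>+ s. ennreal (g s powr r) \<partial>lborel)"
      unfolding v_def by (rule W_adj_Lr[OF _ g r(1)]) measurable
    also have "\<dots> \<le> ennreal (L powr r) * (\<integral>\<^sup>+ s. ennreal (g s powr r) \<partial>lborel)"
    proof (intro mult_right_mono ennreal_leI)
      have "2 * A\<^sup>2 \<le> L"
      proof -
        have "1 * C1 \<le> q * C1" using q C1_pos by (intro mult_right_mono) auto
        then show ?thesis using C1_ge by (simp add: L_def)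
      qed
      then have "L * (2 * A\<^sup>2) powr (r - 1) \<le> L * L powr (r - 1)"
        using L r(1) by (intro mult_left_mono powr_mono2) auto
      then have "2 * C1 * (r / (r - 1)) * (2 * A\<^sup>2) powr (r - 1) \<le> L * L powr (r - 1)"
        unfolding r(2) by (simp add: L_def ac_simps)
      also have "\<dots> = L powr r" using L powr_add[of L 1 "r - 1"] by simp
      finally show "2 * C1 * (r / (r - 1)) * (2 * A\<^sup>2) powr (r - 1) \<le> L powr r" .
    qed auto
    finally show ?thesis by (simp add: gw)
  qed
  have "?I = (\<integral>\<^sup>+ s. ennreal (w s) * ennreal (g s) \<partial>lborel)"
    using gw(1) w(1) g(1) by (intro nn_integral_cong) (simp add: ennreal_mult[symmetric])
  also have "\<dots> \<le> (\<integral>\<^sup>+ s. W (\<lambda>t. ennreal (h t)) s * ennreal (g s) \<partial>lborel)"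
    using w(3) by (intro nn_integral_mono mult_right_mono) auto
  also have "\<dots> = (\<integral>\<^sup>+ t. ennreal (h t) * W_adj (\<lambda>s. ennreal (g s)) t \<partial>lborel)"
    by (rule W_adj_duality) measurable
  also have "\<dots> \<le> (\<integral>\<^sup>+ t. ennreal (L powr q / q) * ennreal (h t powr q) + ennreal (1 / (r * L powr r)) * ennreal (v t powr r) \<partial>lborel)"
  proof (rule nn_integral_mono)
    fix t
    \<comment> \<open>The weight L is balanced so that the term with v integrates to at most 1/r
      times the integral of w^q. This is less than the left side and can be absorbed there.\<close>
    have "h t * v t = (L * h t) * (v t / L)" using L by simp
    also have "\<dots> \<le> (L * h t) powr q / q + (v t / L) powr r / r"
      using q r L h[of t] v0[of t] by (intro Youngs_inequality) auto
    also have "\<dots> = L powr q / q * h t powr q + 1 / (r * L powr r) * v t powr r"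
      using L h[of t] v0[of t] by (simp add: powr_mult powr_divide)
    finally have "ennreal (h t * v t) \<le> ennreal (L powr q / q * h t powr q + 1 / (r * L powr r) * v t powr r)"
      by (rule ennreal_leI)
    then show "ennreal (h t) * W_adj (\<lambda>s. ennreal (g s)) t \<le>
        ennreal (L powr q / q) * ennreal (h t powr q) + ennreal (1 / (r * L powr r)) * ennreal (v t powr r)"
      unfolding vW[symmetric] using h[of t] v0[of t] q r(1) L
      by (subst (asm) ennreal_plus) (auto simp: ennreal_mult'[symmetric] ennreal_mult''[symmetric])
  qed
  also have "\<dots> = ennreal (L powr q / q) * ?J + ennreal (1 / (r * L powr r)) * (\<integral>\<^sup>+ t. ennreal (v t powr r) \<partial>lborel)"
    by (simp add: nn_integral_add nn_integral_cmult)
  also have "\<dots> \<le> ennreal (L powr q / q) * ?J + ennreal (1 / (r * L powr r)) * (ennreal (L powr r) * ?I)"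
    by (intro add_left_mono mult_left_mono vr) auto
  finally have main: "?I \<le> ennreal (L powr q / q) * ?J + ennreal (1 / (r * L powr r)) * (ennreal (L powr r) * ?I)" .
  obtain i where i: "?I = ennreal i" "0 \<le> i" using fin by (cases ?I) auto
  obtain j where j: "?J = ennreal j" "0 \<le> j" using True by (cases ?J) auto
  have "ennreal i \<le> ennreal (L powr q / q * j + 1 / (r * L powr r) * (L powr r * i))"
    using main unfolding i(1) j(1) using i(2) j(2) q r(1) L
    by (subst ennreal_plus) (auto simp: ennreal_mult'[symmetric] ennreal_mult''[symmetric])
  then have "i \<le> L powr q / q * j + 1 / (r * L powr r) * (L powr r * i)"
    using i(2) j(2) q r(1) L by (subst (asm) ennreal_le_iff) auto
  also have "\<dots> = L powr q * j / q + i / r" using L by simp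
  \<comment> \<open>The absorption subtracts i / r from both sides; this is where the finiteness
    assumption on w enters.\<close>
  finally have "i * (1 - 1 / r) \<le> L powr q * j / q" by (simp add: algebra_simps)
  moreover have "1 - 1 / r = 1 / q" using r(4) by linarith
  ultimately have "i \<le> L powr q * j" using q by (simp add: field_simps)
  then have "ennreal i \<le> ennreal (L powr q * j)" by (rule ennreal_leI)
  then show ?thesis unfolding i(1) j(1) L_def[symmetric] using j(2) by (simp add: ennreal_mult)
next
  case False
  then have J: "(\<integral>\<^sup>+ t. ennreal (h t powr q) \<partial>lborel) = \<top>" by (simp add: less_top[symmetric])
  show ?thesis unfolding J using q C1_pos by (simp add: ennreal_mult_top)
qed

lemma W_Lq:
  fixes h :: "'d \<Rightarrow> real"
  assumes [measurable]: "h \<in> borel_measurable borel" and h: "\<And>t. 0 \<le> h t" and q: "1 \<le> q"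
  shows "(\<integral>\<^sup>+ s. ennreal_rpow (W (\<lambda>t. ennreal (h t)) s) q \<partial>lborel) \<le>
    ennreal ((2 * q * C1) powr q) * (\<integral>\<^sup>+ t. ennreal (h t powr q) \<partial>lborel)"
proof (cases "q = 1")
  case True
  have "ennreal_rpow x 1 = x" for x by (cases x) (auto simp: ennreal_rpow_def)
  then have "(\<integral>\<^sup>+ s. ennreal_rpow (W (\<lambda>t. ennreal (h t)) s) q \<partial>lborel) \<le> ennreal (A\<^sup>2) * (\<integral>\<^sup>+ t. ennreal (h t) \<partial>lborel)"
    using W_L1[of "\<lambda>t. ennreal (h t)"] True by simp
  also have "\<dots> \<le> ennreal ((2 * q * C1) powr q) * (\<integral>\<^sup>+ t. ennreal (h t) \<partial>lborel)"
    using True C1_ge C1_pos by (intro mult_right_mono ennreal_leI) auto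
  finally show ?thesis using True h by simp
next
  case False
  then have q: "1 < q" using q by simp
  let ?W = "W (\<lambda>t. ennreal (h t))"
  \<comment> \<open>Truncation in height and in space gives a bounded function with finite integral
    of its q-th power, as \<open>truncated_W_Lq\<close> requires; its constant does not depend on n,
    so Fatou's lemma removes the truncation.\<close>
  define w where "w n s = enn2real (min (?W s) (ennreal (real n))) * indicator (ball 0 (real n)) s" for n s
  have [measurable]: "ball (0 :: 'd) \<rho> \<in> sets borel" for \<rho> by simp
  have [measurable]: "w n \<in> borel_measurable borel" for n unfolding w_def by measurable
  have min_eq: "ennreal (enn2real (min (?W s) (ennreal (real n)))) = min (?W s) (ennreal (real n))" for n s
    by (rule ennreal_enn2real) (simp add: min_less_iff_disj)
  have w: "0 \<le> w n s" "w n s \<le> real n" "ennreal (w n s) \<le> ?W s" for n s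
  proof -
    have "enn2real (min (?W s) (ennreal (real n))) \<le> real n"
      using enn2real_mono[of "min (?W s) (ennreal (real n))" "ennreal (real n)"] by simp
    then show "w n s \<le> real n" "0 \<le> w n s" by (auto simp: w_def split: split_indicator)
    show "ennreal (w n s) \<le> ?W s"
      using min_eq[of s n] by (auto simp: w_def split: split_indicator)
  qed
  have bd: "(\<integral>\<^sup>+ s. ennreal (w n s powr q) \<partial>lborel) \<le>
    ennreal ((2 * q * C1) powr q) * (\<integral>\<^sup>+ t. ennreal (h t powr q) \<partial>lborel)" for n
  proof (rule truncated_W_Lq[OF _ _ h q w])
    have "(\<integral>\<^sup>+ s. ennreal (w n s powr q) \<partial>lborel) \<le> (\<integral>\<^sup>+ s. ennreal (real n powr q) * indicator (ball 0 (real n)) s \<partial>(lborel :: 'd measure))"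
    proof (rule nn_integral_mono)
      fix s show "ennreal (w n s powr q) \<le> ennreal (real n powr q) * indicator (ball 0 (real n)) s"
        using w(1,2)[of n s] q by (cases "s \<in> ball 0 (real n)") (auto simp: w_def intro!: ennreal_leI powr_mono2)
    qed
    also have "\<dots> = ennreal (real n powr q) * emeasure lborel (ball (0::'d) (real n))"
      by (rule nn_integral_cmult_indicator) simp
    also have "\<dots> < \<top>" 
      using emeasure_bounded_finite[OF bounded_ball, of "0 :: 'd" "real n"] by (simp add: ennreal_mult_less_top)
    finally show "(\<integral>\<^sup>+ s. ennreal (w n s powr q) \<partial>lborel) < \<top>" .
  qed measurable
  have lim: "(\<lambda>n. ennreal (w n s powr q)) \<longlonglongrightarrow> ennreal_rpow (?W s) q" for s
  proof -
    obtain N :: nat where N: "norm s < real N" using reals_Archimedean2 by blast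
    show ?thesis
    proof (cases "?W s = \<top>")
      case True
      have "filterlim (\<lambda>n. real n powr q) at_top sequentially" using q by real_asymp
      then have "(\<lambda>n. ennreal (real n powr q)) \<longlonglongrightarrow> \<top>" by (simp add: ennreal_tendsto_top_eq_at_top)
      moreover have "\<forall>\<^sub>F n in sequentially. ennreal (real n powr q) = ennreal (w n s powr q)"
        using eventually_ge_at_top[of N]
      proof eventually_elim
        case (elim n)
        then show ?case using N True by (simp add: w_def)
      qed
      ultimately show ?thesis using True by (simp add: ennreal_rpow_def tendsto_cong)
    next
      case False
      then obtain x where x: "?W s = ennreal x" "0 \<le> x" by (cases "?W s") auto
      obtain N' :: nat where N': "x < real N'" using reals_Archimedean2 by blast
      have "\<forall>\<^sub>F n in sequentially. ennreal (w n s powr q) = ennreal_rpow (?W s) q"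
        using eventually_ge_at_top[of "max N N'"]
      proof eventually_elim
        case (elim n)
        then have "min (?W s) (ennreal (real n)) = ennreal x" using N' x by (simp add: min_def)
        then show ?case using elim N x by (simp add: w_def ennreal_rpow_def)
      qed
      then show ?thesis by (rule tendsto_eventually)
    qed
  qed
  have "(\<integral>\<^sup>+ s. ennreal_rpow (?W s) q \<partial>lborel) = (\<integral>\<^sup>+ s. liminf (\<lambda>n. ennreal (w n s powr q)) \<partial>lborel)"
    by (intro nn_integral_cong lim_imp_Liminf[symmetric] lim) auto
  also have "\<dots> \<le> liminf (\<lambda>n. \<integral>\<^sup>+ s. ennreal (w n s powr q) \<partial>lborel)"
    by (rule nn_integral_liminf) measurable
  also have "\<dots> \<le> liminf (\<lambda>n. ennreal ((2 * q * C1) powr q) * (\<integral>\<^sup>+ t. ennreal (h t powr q) \<partial>lborel))"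
    by (intro Liminf_mono always_eventually allI bd)
  also have "\<dots> = ennreal ((2 * q * C1) powr q) * (\<integral>\<^sup>+ t. ennreal (h t powr q) \<partial>lborel)"
    by (simp add: Liminf_const)
  finally show ?thesis .
qed

end

subsection \<open>The \<open>\<gamma>\<close>-norm into a Hilbert space\<close>

text \<open>Independent standard Gaussians have the identity as covariance matrix, so only the
  diagonal terms of the expanded square survive. This is the only place where the inner product of Y
  meets the Gaussian definition.\<close>

lemma gaussian_norm_eq:
  fixes x :: "nat \<Rightarrow> 'y::real_inner"
  shows "gaussian_norm n x = sqrt (\<Sum>j<n. (norm (x j))\<^sup>2)"
proof -
  define G where "G = density lborel (\<lambda>u. ennreal (std_normal_density u))"
  have G_prob: "prob_space G" unfolding G_def by (rule prob_space_normal_density) simp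
  interpret G: prob_space G by (rule G_prob)
  interpret product_prob_space "\<lambda>_::nat. G" by unfold_locales
  let ?P = "\<Pi>\<^sub>M j\<in>{..<n}. G"
  have int: "integrable G (\<lambda>u. u ^ k)" for k
    unfolding G_def using integrable_std_normal_moment[of k] by (subst integrable_density) auto
  have mom: "(LINT u|G. u ^ k) = (LINT u|lborel. std_normal_density u * u ^ k)" for k
    unfolding G_def by (subst integral_density) auto
  have m0: "(LINT u|G. 1) = (1 :: real)" using G.prob_space by simp
  have m1: "(LINT u|G. u) = 0" using mom[of 1] integral_std_normal_moment_odd[of 0] by simp
  have m2: "(LINT u|G. u * u) = 1"
    using mom[of 2] integral_std_normal_moment_even[of 1] by (simp add: power2_eq_square)
  \<comment> \<open>Writes \<omega> i * \<omega> j as a product of one factor per coordinate, where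
    the factor is u * u at k = i = j. Integrals over the product measure then factorise in both
    cases at once.\<close>
  define f where "f i j k u = (if k = i then u else 1) * (if k = j then u else (1::real))" for i j k :: nat and u
  have f_int: "integrable G (f i j k)" for i j k
    using int[of 0] int[of 1] int[of 2] unfolding f_def
    by (cases "k = i"; cases "k = j") (simp_all add: power2_eq_square)
  have f_prod: "(\<Prod>k<n. f i j k (\<omega> k)) = \<omega> i * \<omega> j" if "i < n" "j < n" for i j \<omega>
    unfolding f_def prod.distrib using that by (simp add: prod.delta)
  have prod_int: "integrable ?P (\<lambda>\<omega>. \<omega> i * \<omega> j)" if "i < n" "j < n" for i j
    using product_integrable_prod[of "{..<n}" "f i j"] f_int f_prod[OF that] by simp
  have cov: "(LINT \<omega>|?P. \<omega> i * \<omega> j) = (if i = j then 1 else 0)" if "i < n" "j < n" for i j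
  proof -
    have "(LINT \<omega>|?P. \<omega> i * \<omega> j) = (\<Prod>k<n. LINT u|G. f i j k u)"
      using product_integral_prod[of "{..<n}" "f i j"] f_int f_prod[OF that] by simp
    also have "\<dots> = (if i = j then 1 else 0)"
    proof (cases "i = j")
      case True
      then have "(LINT u|G. f i j k u) = 1" for k using m0 m2 by (cases "k = j") (simp_all add: f_def)
      with True show ?thesis by simp
    next
      case False
      then have "(LINT u|G. f i j i u) = 0" using m1 by (simp add: f_def)
      with False that show ?thesis by (auto intro!: prod_zero)
    qed
    finally show ?thesis .
  qed
  have "(LINT \<omega>|?P. (norm (\<Sum>j<n. \<omega> j *\<^sub>R x j))\<^sup>2) = (LINT \<omega>|?P. (\<Sum>i<n. \<Sum>j<n. \<omega> i * \<omega> j * (x j \<bullet> x i)))"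
    by (simp add: power2_norm_eq_inner inner_sum_left inner_sum_right sum_distrib_left ac_simps)
  also have "\<dots> = (\<Sum>i<n. \<Sum>j<n. (LINT \<omega>|?P. \<omega> i * \<omega> j) * (x j \<bullet> x i))"
  proof -
    have "(LINT \<omega>|?P. (\<Sum>i<n. \<Sum>j<n. \<omega> i * \<omega> j * (x j \<bullet> x i))) =
        (\<Sum>i<n. LINT \<omega>|?P. (\<Sum>j<n. \<omega> i * \<omega> j * (x j \<bullet> x i)))"
      by (intro Bochner_Integration.integral_sum Bochner_Integration.integrable_sum integrable_mult_left prod_int) auto
    also have "\<dots> = (\<Sum>i<n. \<Sum>j<n. LINT \<omega>|?P. \<omega> i * \<omega> j * (x j \<bullet> x i))"
      by (intro sum.cong refl Bochner_Integration.integral_sum integrable_mult_left prod_int) auto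
    finally show ?thesis by simp
  qed
  also have "\<dots> = (\<Sum>i<n. \<Sum>j<n. if i = j then x i \<bullet> x i else 0)"
    by (intro sum.cong) (auto simp: cov)
  also have "\<dots> = (\<Sum>j<n. (norm (x j))\<^sup>2)"
    by (simp add: power2_norm_eq_inner)
  finally show ?thesis unfolding gaussian_norm_def G_def by simp
qed

section \<open>The scalar space \<open>L2\<close>: inner product, Cauchy--Schwarz and
  orthonormalisation\<close>

lemma L2_measurable: "\<phi> \<in> L2 \<Longrightarrow> \<phi> \<in> borel_measurable lebesgue"
  by (simp add: L2_def)

lemma L2_mult_integrable:
  assumes "\<phi> \<in> L2" "\<psi> \<in> L2"
  shows "integrable lebesgue (\<lambda>t. \<phi> t * \<psi> t)"
proof (rule Bochner_Integration.integrable_bound)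
  show "integrable lebesgue (\<lambda>t. (\<phi> t)\<^sup>2 + (\<psi> t)\<^sup>2)" using assms by (auto simp: L2_def)
  show "(\<lambda>t. \<phi> t * \<psi> t) \<in> borel_measurable lebesgue" using assms by (auto simp: L2_def)
  have "\<bar>a * b\<bar> \<le> a\<^sup>2 + b\<^sup>2" for a b :: real
  proof -
    have "2 * (\<bar>a\<bar> * \<bar>b\<bar>) \<le> a\<^sup>2 + b\<^sup>2"
      using zero_le_power2[of "\<bar>a\<bar> - \<bar>b\<bar>"] by (simp add: power2_eq_square algebra_simps)
    moreover have "0 \<le> \<bar>a\<bar> * \<bar>b\<bar>" by simp
    ultimately show ?thesis unfolding abs_mult by linarith
  qed
  then show "AE t in lebesgue. norm (\<phi> t * \<psi> t) \<le> norm ((\<phi> t)\<^sup>2 + (\<psi> t)\<^sup>2)" by simp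
qed

lemma L2_scale: "\<phi> \<in> L2 \<Longrightarrow> (\<lambda>t. c * \<phi> t) \<in> L2"
  by (auto simp: L2_def power_mult_distrib)

lemma L2_add:
  assumes "\<phi> \<in> L2" "\<psi> \<in> L2"
  shows "(\<lambda>t. \<phi> t + \<psi> t) \<in> L2"
  using assms L2_mult_integrable[OF assms] by (auto simp: L2_def power2_sum mult.assoc)

lemma L2_diff: "\<phi> \<in> L2 \<Longrightarrow> \<psi> \<in> L2 \<Longrightarrow> (\<lambda>t. \<phi> t - \<psi> t) \<in> L2"
  using L2_add[of \<phi> "\<lambda>t. -1 * \<psi> t"] L2_scale[of \<psi> "-1"] by simp

lemma L2_zero: "(\<lambda>_. 0) \<in> L2"
  by (simp add: L2_def)

lemma L2_sum: "(\<And>i. i \<in> I \<Longrightarrow> \<phi> i \<in> L2) \<Longrightarrow> (\<lambda>t. \<Sum>i\<in>I. \<phi> i t) \<in> L2"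
  by (induction I rule: infinite_finite_induct) (auto intro: L2_zero L2_add)

lemma L2_inner_commute: "L2_inner \<phi> \<psi> = L2_inner \<psi> \<phi>"
  by (simp add: L2_inner_def mult.commute)

lemma L2_inner_diff_left:
  "\<phi> \<in> L2 \<Longrightarrow> \<psi> \<in> L2 \<Longrightarrow> \<zeta> \<in> L2 \<Longrightarrow> L2_inner (\<lambda>t. \<phi> t - \<psi> t) \<zeta> = L2_inner \<phi> \<zeta> - L2_inner \<psi> \<zeta>"
  by (simp add: L2_inner_def left_diff_distrib L2_mult_integrable)

lemma L2_inner_scale_left: "L2_inner (\<lambda>t. c * \<phi> t) \<zeta> = c * L2_inner \<phi> \<zeta>"
  by (simp add: L2_inner_def mult.assoc)

lemma L2_inner_sum_left:
  "(\<And>i. i \<in> I \<Longrightarrow> \<phi> i \<in> L2) \<Longrightarrow> \<zeta> \<in> L2 \<Longrightarrow> L2_inner (\<lambda>t. \<Sum>i\<in>I. \<phi> i t) \<zeta> = (\<Sum>i\<in>I. L2_inner (\<phi> i) \<zeta>)"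
  by (simp add: L2_inner_def sum_distrib_right L2_mult_integrable)

lemma L2_inner_self_nonneg: "0 \<le> L2_inner \<phi> \<phi>"
  by (simp add: L2_inner_def)

lemma L2_inner_null:
  assumes "\<psi> \<in> L2" "L2_inner \<psi> \<psi> = 0"
  shows "L2_inner \<psi> \<zeta> = 0"
proof -
  have "AE t in lebesgue. \<psi> t * \<psi> t = 0"
    using assms integral_nonneg_eq_0_iff_AE[of lebesgue "\<lambda>t. \<psi> t * \<psi> t"] L2_mult_integrable[OF assms(1,1)]
    by (simp add: L2_inner_def)
  then have "AE t in lebesgue. \<psi> t * \<zeta> t = 0" by eventually_elim simp
  then show ?thesis unfolding L2_inner_def by (rule integral_eq_zero_AE)
qed

lemma L2_Cauchy_Schwarz:
  assumes "\<phi> \<in> L2" "\<psi> \<in> L2"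
  shows "\<bar>L2_inner \<phi> \<psi>\<bar> \<le> sqrt (L2_inner \<phi> \<phi>) * sqrt (L2_inner \<psi> \<psi>)"
proof (cases "L2_inner \<psi> \<psi> = 0")
  case True
  then show ?thesis using L2_inner_null[OF assms(2) True] by (simp add: L2_inner_commute)
next
  case False
  define N where "N = L2_inner \<psi> \<psi>"
  have N: "0 < N" using False L2_inner_self_nonneg[of \<psi>] by (simp add: N_def)
  define c where "c = L2_inner \<phi> \<psi>"
  define d where "d = c / N"
  let ?\<eta> = "\<lambda>t. \<phi> t - d * \<psi> t"
  have \<eta>: "?\<eta> \<in> L2" using assms by (intro L2_diff L2_scale)
  have s\<psi>: "(\<lambda>t. d * \<psi> t) \<in> L2" using assms by (intro L2_scale)
  have "0 \<le> L2_inner ?\<eta> ?\<eta>" by (rule L2_inner_self_nonneg)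
  also have "L2_inner ?\<eta> ?\<eta> = L2_inner \<phi> ?\<eta> - d * L2_inner \<psi> ?\<eta>"
    using L2_inner_diff_left[OF assms(1) s\<psi> \<eta>] by (simp add: L2_inner_scale_left)
  also have "L2_inner \<phi> ?\<eta> = L2_inner \<phi> \<phi> - d * c"
    using L2_inner_diff_left[OF assms(1) s\<psi> assms(1)] L2_inner_scale_left[of d \<psi> \<phi>]
    by (metis L2_inner_commute c_def)
  also have "L2_inner \<psi> ?\<eta> = c - d * N"
    using L2_inner_diff_left[OF assms(1) s\<psi> assms(2)] L2_inner_scale_left[of d \<psi> \<psi>]
    by (metis L2_inner_commute c_def N_def)
  finally have "c\<^sup>2 \<le> L2_inner \<phi> \<phi> * N" using N by (simp add: d_def field_simps power2_eq_square)
  then have "sqrt (c\<^sup>2) \<le> sqrt (L2_inner \<phi> \<phi> * N)" by (rule real_sqrt_le_mono)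
  then show ?thesis by (simp add: real_sqrt_mult c_def N_def)
qed

text \<open>Sums of \<phi> j \<otimes> y j without orthonormality: this form is stable under
  differences and arises directly from simple functions. \<open>tensor_fun\<close> is the function
  that represents the operator.\<close>

definition tensor_op :: "nat \<Rightarrow> (nat \<Rightarrow> 'd::euclidean_space \<Rightarrow> real) \<Rightarrow> (nat \<Rightarrow> 'y::real_normed_vector) \<Rightarrow> ('d, 'y) L2_op"
  where "tensor_op n \<phi> y \<psi> = (\<Sum>j<n. L2_inner (\<phi> j) \<psi> *\<^sub>R y j)"

definition tensor_fun :: "nat \<Rightarrow> (nat \<Rightarrow> 'd::euclidean_space \<Rightarrow> real) \<Rightarrow> (nat \<Rightarrow> 'y::real_normed_vector) \<Rightarrow> 'd \<Rightarrow> 'y"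
  where "tensor_fun n \<phi> y t = (\<Sum>j<n. \<phi> j t *\<^sub>R y j)"

text \<open>By Gram--Schmidt, one function \<open>\<phi> n\<close> at a time.\<close>

lemma tensor_op_orthonormal_rep:
  fixes y :: "nat \<Rightarrow> 'y::real_normed_vector"
  shows "(\<And>j. j < n \<Longrightarrow> \<phi> j \<in> L2) \<Longrightarrow> \<exists>m e x. finite_rank_rep (tensor_op n \<phi> y) m e x"
proof (induction n)
  case 0
  have "finite_rank_rep (tensor_op 0 \<phi> y) 0 \<phi> y"
    by (simp add: finite_rank_rep_def L2_orthonormal_def tensor_op_def)
  then show ?case by blast
next
  case (Suc n)
  then obtain m e x where rep: "finite_rank_rep (tensor_op n \<phi> y) m e x" by (meson less_SucI)
  have e: "e i \<in> L2" if "i < m" for i using rep that by (auto simp: finite_rank_rep_def L2_orthonormal_def)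
  have on: "L2_inner (e i) (e j) = (if i = j then 1 else 0)" if "i < m" "j < m" for i j
    using rep that by (auto simp: finite_rank_rep_def L2_orthonormal_def)
  have op: "tensor_op n \<phi> y \<zeta> = (\<Sum>j<m. L2_inner (e j) \<zeta> *\<^sub>R x j)" if "\<zeta> \<in> L2" for \<zeta>
    using rep that by (auto simp: finite_rank_rep_def)
  have \<phi>n: "\<phi> n \<in> L2" using Suc.prems by simp
  define c where "c j = L2_inner (e j) (\<phi> n)" for j
  \<comment> \<open>The orthogonal projection of \<phi> n to the span of the e j. Its part of the
    operator is absorbed into the vectors x j, and the remainder \<psi> is orthogonal to all e
    j.\<close>
  define p where "p t = (\<Sum>j<m. c j * e j t)" for t
  have p: "p \<in> L2" unfolding p_def using e by (intro L2_sum L2_scale) auto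
  have p_inner: "L2_inner p \<zeta> = (\<Sum>j<m. c j * L2_inner (e j) \<zeta>)" if "\<zeta> \<in> L2" for \<zeta>
    unfolding p_def using e that by (subst L2_inner_sum_left) (auto intro: L2_scale simp: L2_inner_scale_left)
  define \<psi> where "\<psi> t = \<phi> n t - p t" for t
  have \<psi>: "\<psi> \<in> L2" unfolding \<psi>_def using \<phi>n p by (rule L2_diff)
  have \<psi>_inner: "L2_inner (\<phi> n) \<zeta> = L2_inner p \<zeta> + L2_inner \<psi> \<zeta>" if "\<zeta> \<in> L2" for \<zeta>
    unfolding \<psi>_def using L2_inner_diff_left[OF \<phi>n p that] by simp
  have orth: "L2_inner \<psi> (e i) = 0" if i: "i < m" for i
  proof -
    have "L2_inner p (e i) = (\<Sum>j<m. if j = i then c j else 0)"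
      unfolding p_inner[OF e[OF i]] using i by (intro sum.cong) (auto simp: on)
    then have "L2_inner p (e i) = c i" using i by simp
    then show ?thesis using \<psi>_inner[OF e[OF i]] by (simp add: c_def L2_inner_commute)
  qed
  have step: "tensor_op (Suc n) \<phi> y \<zeta> =
      (\<Sum>j<m. L2_inner (e j) \<zeta> *\<^sub>R (x j + c j *\<^sub>R y n)) + L2_inner \<psi> \<zeta> *\<^sub>R y n" if \<zeta>: "\<zeta> \<in> L2" for \<zeta>
  proof -
    have "tensor_op (Suc n) \<phi> y \<zeta> = tensor_op n \<phi> y \<zeta> + L2_inner (\<phi> n) \<zeta> *\<^sub>R y n"
      by (simp add: tensor_op_def)
    also have "\<dots> = (\<Sum>j<m. L2_inner (e j) \<zeta> *\<^sub>R x j) + ((\<Sum>j<m. c j * L2_inner (e j) \<zeta>) + L2_inner \<psi> \<zeta>) *\<^sub>R y n"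
      by (simp add: op[OF \<zeta>] \<psi>_inner[OF \<zeta>] p_inner[OF \<zeta>])
    also have "\<dots> = (\<Sum>j<m. L2_inner (e j) \<zeta> *\<^sub>R (x j + c j *\<^sub>R y n)) + L2_inner \<psi> \<zeta> *\<^sub>R y n"
      by (simp add: scaleR_add_left scaleR_add_right sum.distrib scaleR_sum_left mult.commute)
    finally show ?thesis .
  qed
  define N where "N = L2_inner \<psi> \<psi>"
  show ?case
  proof (cases "N = 0")
    case True
    have "finite_rank_rep (tensor_op (Suc n) \<phi> y) m e (\<lambda>j. x j + c j *\<^sub>R y n)"
      using rep step L2_inner_null[OF \<psi>] True by (auto simp: finite_rank_rep_def N_def)
    then show ?thesis by blast
  next
    case False
    then have N: "0 < N" using L2_inner_self_nonneg[of \<psi>] by (simp add: N_def)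
    \<comment> \<open>The remainder is normalised, and the factor sqrt N lost thereby is moved into
      the new vector.\<close>
    define e' where "e' j = (if j < m then e j else (\<lambda>t. (1 / sqrt N) * \<psi> t))" for j
    define x' where "x' j = (if j < m then x j + c j *\<^sub>R y n else sqrt N *\<^sub>R y n)" for j
    have new: "L2_inner (\<lambda>t. (1 / sqrt N) * \<psi> t) \<zeta> = (1 / sqrt N) * L2_inner \<psi> \<zeta>" for \<zeta>
      by (rule L2_inner_scale_left)
    have "L2_inner (e' i) (e' j) = (if i = j then 1 else 0)" if ij: "i < Suc m" "j < Suc m" for i j
    proof -
      consider "i < m" "j < m" | "i < m" "j = m" | "i = m" "j < m" | "i = m" "j = m" using ij by linarith
      then show ?thesis
      proof cases
        case 1
        then show ?thesis by (simp add: e'_def on)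
      next
        case 2
        then show ?thesis using new[of "e i"] orth[of i] by (simp add: e'_def L2_inner_commute[of "e i"])
      next
        case 3
        then show ?thesis using new[of "e j"] orth[of j] by (simp add: e'_def)
      next
        case 4
        have "L2_inner \<psi> (\<lambda>t. (1 / sqrt N) * \<psi> t) = (1 / sqrt N) * N"
          unfolding N_def by (subst L2_inner_commute) (rule L2_inner_scale_left)
        then have "L2_inner (\<lambda>t. (1 / sqrt N) * \<psi> t) (\<lambda>t. (1 / sqrt N) * \<psi> t) = (1 / sqrt N) * ((1 / sqrt N) * N)"
          by (subst new) (simp only:)
        then have "L2_inner (e' m) (e' m) = (1 / sqrt N) * ((1 / sqrt N) * N)" by (simp only: e'_def less_irrefl if_False)
        also have "\<dots> = 1"
        proof -
          have "sqrt N * sqrt N = N" "sqrt N \<noteq> 0" using N by auto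
          then show ?thesis by (simp add: divide_simps)
        qed
        finally show ?thesis using 4 by simp
      qed
    qed
    moreover have "e' i \<in> L2" if "i < Suc m" for i
      using e that L2_scale[OF \<psi>, of "1 / sqrt N"] by (auto simp: e'_def)
    moreover have "tensor_op (Suc n) \<phi> y \<zeta> = (\<Sum>j<Suc m. L2_inner (e' j) \<zeta> *\<^sub>R x' j)" if "\<zeta> \<in> L2" for \<zeta>
      unfolding step[OF that] using N new[of \<zeta>] by (simp add: e'_def x'_def)
    ultimately have "finite_rank_rep (tensor_op (Suc n) \<phi> y) (Suc m) e' x'"
      unfolding finite_rank_rep_def L2_orthonormal_def by blast
    then show ?thesis by blast
  qed
qed

subsection \<open>Square integrable functions represent \<open>\<gamma>\<close>-radonifying operators\<close>

definition sq_integrable :: "('d::euclidean_space \<Rightarrow> 'y::real_normed_vector) \<Rightarrow> bool"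
  where "sq_integrable f \<longleftrightarrow> simple_limit lebesgue f \<and> integrable lebesgue (\<lambda>t. (norm (f t))\<^sup>2)"

definition L2_norm :: "('d::euclidean_space \<Rightarrow> 'y::real_normed_vector) \<Rightarrow> real"
  where "L2_norm f = sqrt (LINT t|lebesgue. (norm (f t))\<^sup>2)"

lemma L2_norm_nonneg: "0 \<le> L2_norm f"
  by (simp add: L2_norm_def)

lemma sq_integrable_norm_L2: "sq_integrable f \<Longrightarrow> (\<lambda>t. norm (f t)) \<in> L2"
  by (simp add: sq_integrable_def L2_def simple_limit_norm_measurable)

lemma L2_norm_eq_inner: "L2_norm f = sqrt (L2_inner (\<lambda>t. norm (f t)) (\<lambda>t. norm (f t)))"
  by (simp add: L2_norm_def L2_inner_def power2_eq_square)

lemma L2_norm_square: "(L2_norm f)\<^sup>2 = (LINT t|lebesgue. (norm (f t))\<^sup>2)"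
  by (simp add: L2_norm_def)

lemma sq_integrable_bound:
  fixes f :: "'d::euclidean_space \<Rightarrow> 'y::real_normed_vector"
  assumes "simple_limit lebesgue f" "\<phi> \<in> L2" "\<And>t. norm (f t) \<le> \<phi> t"
  shows "sq_integrable f"
  unfolding sq_integrable_def
proof (rule conjI[OF assms(1)], rule Bochner_Integration.integrable_bound)
  show "integrable lebesgue (\<lambda>t. (\<phi> t)\<^sup>2)" using assms(2) by (simp add: L2_def)
  show "(\<lambda>t. (norm (f t))\<^sup>2) \<in> borel_measurable lebesgue"
    using simple_limit_norm_measurable[OF assms(1)] by measurable
  show "AE t in lebesgue. norm ((norm (f t))\<^sup>2) \<le> norm ((\<phi> t)\<^sup>2)"
    using assms(3) by (auto intro!: power_mono)
qed

lemma sq_integrable_add: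
  assumes "sq_integrable f" "sq_integrable g"
  shows "sq_integrable (\<lambda>t. f t + g t)"
proof (rule sq_integrable_bound)
  show "simple_limit lebesgue (\<lambda>t. f t + g t)"
    using assms by (auto simp: sq_integrable_def intro: simple_limit_add)
  show "(\<lambda>t. norm (f t) + norm (g t)) \<in> L2" using assms by (intro L2_add sq_integrable_norm_L2)
qed (rule norm_triangle_ineq)

lemma sq_integrable_diff:
  assumes "sq_integrable f" "sq_integrable g"
  shows "sq_integrable (\<lambda>t. f t - g t)"
proof (rule sq_integrable_bound)
  show "simple_limit lebesgue (\<lambda>t. f t - g t)"
    using assms by (auto simp: sq_integrable_def intro: simple_limit_diff)
  show "(\<lambda>t. norm (f t) + norm (g t)) \<in> L2" using assms by (intro L2_add sq_integrable_norm_L2)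
qed (rule norm_triangle_ineq4)

text \<open>Stated for any h dominated pointwise, so that the triangle inequality, its reverse and
  the three-point version are all instances.\<close>

lemma L2_norm_le_add:
  assumes f: "sq_integrable f" and g: "sq_integrable g" and h: "sq_integrable h"
    and le: "\<And>t. norm (h t) \<le> norm (f t) + norm (g t)"
  shows "L2_norm h \<le> L2_norm f + L2_norm g"
proof -
  let ?a = "\<lambda>t. norm (f t)" and ?b = "\<lambda>t. norm (g t)"
  note a = sq_integrable_norm_L2[OF f] and b = sq_integrable_norm_L2[OF g]
  have "(L2_norm h)\<^sup>2 \<le> (LINT t|lebesgue. (?a t + ?b t)\<^sup>2)"
    unfolding L2_norm_square using h L2_add[OF a b] le
    by (intro integral_mono power_mono) (auto simp: sq_integrable_def L2_def)
  also have "\<dots> = L2_inner ?a ?a + 2 * L2_inner ?a ?b + L2_inner ?b ?b"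
    using L2_mult_integrable[OF a a] L2_mult_integrable[OF a b] L2_mult_integrable[OF b b]
    by (simp add: L2_inner_def power2_eq_square algebra_simps)
  also have "\<dots> \<le> (L2_norm f)\<^sup>2 + 2 * (L2_norm f * L2_norm g) + (L2_norm g)\<^sup>2"
    using L2_Cauchy_Schwarz[OF a b] L2_inner_self_nonneg[of ?a] L2_inner_self_nonneg[of ?b]
    by (simp add: L2_norm_eq_inner)
  also have "\<dots> = (L2_norm f + L2_norm g)\<^sup>2" by (simp add: power2_sum)
  finally show ?thesis
    by (rule power2_le_imp_le) (simp add: L2_norm_nonneg)
qed

lemma L2_norm_triangle:
  "sq_integrable f \<Longrightarrow> sq_integrable g \<Longrightarrow> L2_norm (\<lambda>t. f t + g t) \<le> L2_norm f + L2_norm g"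
  by (intro L2_norm_le_add sq_integrable_add norm_triangle_ineq)

lemma L2_norm_minus_commute: "L2_norm (\<lambda>t. f t - g t) = L2_norm (\<lambda>t. g t - f t)"
  by (simp add: L2_norm_def norm_minus_commute)

lemma L2_norm_diff_le:
  assumes "sq_integrable f" "sq_integrable g"
  shows "\<bar>L2_norm f - L2_norm g\<bar> \<le> L2_norm (\<lambda>t. f t - g t)"
proof -
  have "L2_norm f \<le> L2_norm g + L2_norm (\<lambda>t. f t - g t)"
    by (intro L2_norm_le_add sq_integrable_diff assms) (metis norm_triangle_sub)
  moreover have "L2_norm g \<le> L2_norm f + L2_norm (\<lambda>t. f t - g t)"
    by (intro L2_norm_le_add sq_integrable_diff assms) (metis norm_triangle_sub norm_minus_commute)
  ultimately show ?thesis by linarith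
qed

lemma L2_norm_triangle3:
  assumes "sq_integrable f" "sq_integrable g" "sq_integrable h"
  shows "L2_norm (\<lambda>t. f t - h t) \<le> L2_norm (\<lambda>t. f t - g t) + L2_norm (\<lambda>t. g t - h t)"
proof (intro L2_norm_le_add sq_integrable_diff assms)
  fix t
  have "f t - h t = (f t - g t) + (g t - h t)" by simp
  then show "norm (f t - h t) \<le> norm (f t - g t) + norm (g t - h t)" by (metis norm_triangle_ineq)
qed

lemma sq_integrable_tensor_fun:
  assumes "\<And>j. j < n \<Longrightarrow> \<phi> j \<in> L2"
  shows "sq_integrable (tensor_fun n \<phi> y)"
proof (rule sq_integrable_bound)
  show "simple_limit lebesgue (tensor_fun n \<phi> y)"
    unfolding tensor_fun_def [abs_def] using assms
    by (intro simple_limit_sum simple_limit_scaleR simple_limit_const) (auto simp: simple_limit_real L2_def)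
  have "(\<lambda>t. \<bar>\<phi> j t\<bar>) \<in> L2" if "j < n" for j using assms[OF that] by (auto simp: L2_def)
  then show "(\<lambda>t. \<Sum>j<n. norm (y j) * \<bar>\<phi> j t\<bar>) \<in> L2" by (intro L2_sum L2_scale) auto
  show "norm (tensor_fun n \<phi> y t) \<le> (\<Sum>j<n. norm (y j) * \<bar>\<phi> j t\<bar>)" for t
    unfolding tensor_fun_def by (rule sum_norm_le) (simp add: mult.commute)
qed

lemma inner_simple_limit_measurable:
  fixes f g :: "'a \<Rightarrow> 'y::real_inner"
  assumes "simple_limit M f" "simple_limit M g"
  shows "(\<lambda>t. f t \<bullet> g t) \<in> borel_measurable M"
  unfolding simple_limit_real[symmetric]
  by (rule simple_limit_comp2[where h = "(\<bullet>)", OF assms]) (auto simp: case_prod_beta intro!: continuous_intros)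

lemma sq_integrable_inner:
  fixes f g :: "'d::euclidean_space \<Rightarrow> 'y::real_inner"
  assumes f: "sq_integrable f" and g: "sq_integrable g"
  shows "integrable lebesgue (\<lambda>t. f t \<bullet> g t)"
    and "\<bar>LINT t|lebesgue. f t \<bullet> g t\<bar> \<le> L2_norm f * L2_norm g"
proof -
  note a = sq_integrable_norm_L2[OF f] and b = sq_integrable_norm_L2[OF g]
  have le: "\<bar>f t \<bullet> g t\<bar> \<le> norm (f t) * norm (g t)" for t by (rule Cauchy_Schwarz_ineq2)
  show int: "integrable lebesgue (\<lambda>t. f t \<bullet> g t)"
    using f g le by (intro Bochner_Integration.integrable_bound[OF L2_mult_integrable[OF a b] inner_simple_limit_measurable])
      (auto simp: sq_integrable_def)
  have "\<bar>LINT t|lebesgue. f t \<bullet> g t\<bar> \<le> (LINT t|lebesgue. \<bar>f t \<bullet> g t\<bar>)" by (rule integral_abs_bound)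
  also have "\<dots> \<le> L2_inner (\<lambda>t. norm (f t)) (\<lambda>t. norm (g t))"
    unfolding L2_inner_def by (intro integral_mono integrable_abs int L2_mult_integrable a b le)
  also have "\<dots> \<le> L2_norm f * L2_norm g"
    using L2_Cauchy_Schwarz[OF a b] by (simp add: L2_norm_eq_inner)
  finally show "\<bar>LINT t|lebesgue. f t \<bullet> g t\<bar> \<le> L2_norm f * L2_norm g" .
qed

lemma sq_integrable_scaleR_L2:
  assumes "\<phi> \<in> L2" shows "sq_integrable (\<lambda>t. \<phi> t *\<^sub>R c)"
proof (rule sq_integrable_bound)
  show "simple_limit lebesgue (\<lambda>t. \<phi> t *\<^sub>R c)"
    using assms by (intro simple_limit_scaleR simple_limit_const) (auto simp: simple_limit_real L2_def)
  have "(\<lambda>t. \<bar>\<phi> t\<bar>) \<in> L2" using assms by (auto simp: L2_def)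
  then show "(\<lambda>t. norm c * \<bar>\<phi> t\<bar>) \<in> L2" by (rule L2_scale)
qed (simp add: mult.commute)

text \<open>A relation rather than a function, since S is determined only on \<open>L2\<close> and
  its tensor data are not unique. It transfers every computation with finite rank operators to the
  function g.\<close>

definition fin_rep :: "('d::euclidean_space, 'y::real_normed_vector) L2_op \<Rightarrow> ('d \<Rightarrow> 'y) \<Rightarrow> bool"
  where "fin_rep S g \<longleftrightarrow> (\<exists>n \<phi> y. (\<forall>j<n. \<phi> j \<in> L2) \<and> (\<forall>\<psi>\<in>L2. S \<psi> = tensor_op n \<phi> y \<psi>) \<and> g = tensor_fun n \<phi> y)"

lemma fin_rep_sq_integrable: "fin_rep S g \<Longrightarrow> sq_integrable g"
  unfolding fin_rep_def using sq_integrable_tensor_fun by blast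

lemma fin_rep_tensor: "(\<And>j. j < n \<Longrightarrow> \<phi> j \<in> L2) \<Longrightarrow> fin_rep (tensor_op n \<phi> y) (tensor_fun n \<phi> y)"
  unfolding fin_rep_def by blast

lemma finite_rank_iff_fin_rep: "finite_rank S \<longleftrightarrow> (\<exists>g. fin_rep S g)"
proof
  assume "finite_rank S"
  then obtain n e x where "L2_orthonormal n e" "\<forall>\<phi>\<in>L2. S \<phi> = (\<Sum>j<n. L2_inner (e j) \<phi> *\<^sub>R x j)"
    by (auto simp: finite_rank_def finite_rank_rep_def)
  then have "fin_rep S (tensor_fun n e x)"
    unfolding fin_rep_def tensor_op_def L2_orthonormal_def by blast
  then show "\<exists>g. fin_rep S g" by blast
next
  assume "\<exists>g. fin_rep S g"
  then obtain n \<phi> y where \<phi>: "\<And>j. j < n \<Longrightarrow> \<phi> j \<in> L2" and S: "\<forall>\<psi>\<in>L2. S \<psi> = tensor_op n \<phi> y \<psi>"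
    unfolding fin_rep_def by blast
  obtain m e x where "finite_rank_rep (tensor_op n \<phi> y) m e x"
    using tensor_op_orthonormal_rep[of n \<phi> y] \<phi> by blast
  then have "finite_rank_rep S m e x" using S by (auto simp: finite_rank_rep_def)
  then show "finite_rank S" by (auto simp: finite_rank_def)
qed

text \<open>Trace duality. The right side involves only the operator S, so pairings of g with finite
  tensors do not depend on how S is represented.\<close>

lemma fin_rep_pairing:
  fixes y :: "nat \<Rightarrow> 'y::real_inner"
  assumes "fin_rep S g" and \<phi>: "\<And>j. j < n \<Longrightarrow> \<phi> j \<in> L2"
  shows "(LINT t|lebesgue. g t \<bullet> tensor_fun n \<phi> y t) = (\<Sum>j<n. S (\<phi> j) \<bullet> y j)"
proof -
  obtain m e x where e: "\<forall>i<m. e i \<in> L2" and S: "\<forall>\<psi>\<in>L2. S \<psi> = tensor_op m e x \<psi>" and g: "g = tensor_fun m e x"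
    using assms(1) unfolding fin_rep_def by blast
  have "(LINT t|lebesgue. g t \<bullet> tensor_fun n \<phi> y t) =
      (LINT t|lebesgue. (\<Sum>j<n. \<Sum>i<m. (e i t * \<phi> j t) * (x i \<bullet> y j)))"
    by (intro Bochner_Integration.integral_cong refl)
       (simp add: g tensor_fun_def inner_sum_left inner_sum_right sum_distrib_left ac_simps)
  also have "\<dots> = (\<Sum>j<n. \<Sum>i<m. L2_inner (e i) (\<phi> j) * (x i \<bullet> y j))"
  proof -
    have int: "integrable lebesgue (\<lambda>t. (e i t * \<phi> j t) * (x i \<bullet> y j))" if "i < m" "j < n" for i j
      using e \<phi> that by (intro integrable_mult_left L2_mult_integrable) auto
    have "(LINT t|lebesgue. (\<Sum>j<n. \<Sum>i<m. (e i t * \<phi> j t) * (x i \<bullet> y j))) =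
        (\<Sum>j<n. LINT t|lebesgue. (\<Sum>i<m. (e i t * \<phi> j t) * (x i \<bullet> y j)))"
      by (intro Bochner_Integration.integral_sum Bochner_Integration.integrable_sum int) auto
    also have "\<dots> = (\<Sum>j<n. \<Sum>i<m. LINT t|lebesgue. (e i t * \<phi> j t) * (x i \<bullet> y j))"
      by (intro sum.cong refl Bochner_Integration.integral_sum int) auto
    finally show ?thesis by (simp add: L2_inner_def)
  qed
  also have "\<dots> = (\<Sum>j<n. S (\<phi> j) \<bullet> y j)"
    using S \<phi> by (intro sum.cong) (auto simp: tensor_op_def inner_sum_left)
  finally show ?thesis .
qed

lemma L2_norm_square_inner:
  fixes f :: "'d::euclidean_space \<Rightarrow> 'y::real_inner"
  shows "(L2_norm f)\<^sup>2 = (LINT t|lebesgue. f t \<bullet> f t)"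
  by (simp add: L2_norm_square power2_norm_eq_inner)

text \<open>Each of g and g' is itself a finite tensor. Pairing both with g, and then both with g',
  identifies either squared norm with the integral of g \<bullet> g'.\<close>

lemma fin_rep_L2_norm_unique:
  fixes S :: "('d::euclidean_space, 'y::real_inner) L2_op"
  assumes "fin_rep S g" "fin_rep S g'"
  shows "L2_norm g = L2_norm g'"
proof -
  obtain n \<phi> y where \<phi>: "\<And>j. j < n \<Longrightarrow> \<phi> j \<in> L2" and g: "g = tensor_fun n \<phi> y"
    using assms(1) unfolding fin_rep_def by blast
  obtain m e x where e: "\<And>j. j < m \<Longrightarrow> e j \<in> L2" and g': "g' = tensor_fun m e x"
    using assms(2) unfolding fin_rep_def by blast
  have "(LINT t|lebesgue. g t \<bullet> g t) = (LINT t|lebesgue. g' t \<bullet> g t)"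
    using fin_rep_pairing[OF assms(1) \<phi>, where y = y] fin_rep_pairing[OF assms(2) \<phi>, where y = y] g by simp
  moreover have "(LINT t|lebesgue. g t \<bullet> g' t) = (LINT t|lebesgue. g' t \<bullet> g' t)"
    using fin_rep_pairing[OF assms(1) e, where y = x] fin_rep_pairing[OF assms(2) e, where y = x] g' by simp
  ultimately have "(L2_norm g)\<^sup>2 = (L2_norm g')\<^sup>2"
    by (simp add: L2_norm_square_inner inner_commute)
  then show ?thesis by (simp add: L2_norm_nonneg)
qed

text \<open>For an orthonormal representation S (e j) = x j, so pairing the representing function
  with itself gives the sum of the |x j|^2. Uniqueness of the norm then makes the definite
  description well defined.\<close>

lemma gamma_norm_fin_eq:
  fixes S :: "('d::euclidean_space, 'y::real_inner) L2_op"
  assumes "fin_rep S g"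
  shows "gamma_norm_fin S = L2_norm g"
proof -
  have *: "gaussian_norm n x = L2_norm g" if rep: "finite_rank_rep S n e x" for n e x
  proof -
    have e: "\<And>j. j < n \<Longrightarrow> e j \<in> L2"
      and on: "\<And>i j. i < n \<Longrightarrow> j < n \<Longrightarrow> L2_inner (e i) (e j) = (if i = j then 1 else 0)"
      and S: "\<forall>\<psi>\<in>L2. S \<psi> = tensor_op n e x \<psi>"
      using rep by (auto simp: finite_rank_rep_def L2_orthonormal_def tensor_op_def)
    have fr: "fin_rep S (tensor_fun n e x)" using e S unfolding fin_rep_def by blast
    have "(L2_norm (tensor_fun n e x))\<^sup>2 = (\<Sum>j<n. S (e j) \<bullet> x j)"
      unfolding L2_norm_square_inner by (rule fin_rep_pairing[OF fr e])
    also have "\<dots> = (\<Sum>j<n. (norm (x j))\<^sup>2)"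
    proof (rule sum.cong)
      fix j assume "j \<in> {..<n}"
      then have j: "j < n" by simp
      have "S (e j) = (\<Sum>i<n. L2_inner (e i) (e j) *\<^sub>R x i)"
        using S e[OF j] by (simp add: tensor_op_def)
      also have "\<dots> = (\<Sum>i<n. if i = j then x i else 0)"
        using j by (intro sum.cong) (auto simp: on)
      finally have "S (e j) = (\<Sum>i<n. if i = j then x i else 0)" .
      then show "S (e j) \<bullet> x j = (norm (x j))\<^sup>2" using j by (simp add: power2_norm_eq_inner)
    qed simp
    finally have "L2_norm (tensor_fun n e x) = sqrt (\<Sum>j<n. (norm (x j))\<^sup>2)"
      by (metis L2_norm_nonneg real_sqrt_abs abs_of_nonneg)
    then show ?thesis using fin_rep_L2_norm_unique[OF fr assms] by (simp add: gaussian_norm_eq)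
  qed
  have "finite_rank S" using assms finite_rank_iff_fin_rep by blast
  then obtain n e x where "finite_rank_rep S n e x" by (auto simp: finite_rank_def)
  then show ?thesis unfolding gamma_norm_fin_def using *
    by (intro the_equality) metis+
qed

lemma sum_lessThan_add:
  fixes f :: "nat \<Rightarrow> 'a::comm_monoid_add"
  shows "(\<Sum>j<n + m. f j) = (\<Sum>j<n. f j) + (\<Sum>j<m. f (n + j))"
  by (induction m) (simp_all add: add.assoc)

lemma fin_rep_diff:
  fixes S S' :: "('d::euclidean_space, 'y::real_normed_vector) L2_op"
  assumes "fin_rep S g" "fin_rep S' g'"
  shows "fin_rep (\<lambda>\<psi>. S \<psi> - S' \<psi>) (\<lambda>t. g t - g' t)"
proof -
  obtain n \<phi> y where \<phi>: "\<And>j. j < n \<Longrightarrow> \<phi> j \<in> L2" and S: "\<forall>\<psi>\<in>L2. S \<psi> = tensor_op n \<phi> y \<psi>" and g: "g = tensor_fun n \<phi> y"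
    using assms(1) unfolding fin_rep_def by blast
  obtain m e x where e: "\<And>j. j < m \<Longrightarrow> e j \<in> L2" and S': "\<forall>\<psi>\<in>L2. S' \<psi> = tensor_op m e x \<psi>" and g': "g' = tensor_fun m e x"
    using assms(2) unfolding fin_rep_def by blast
  define \<eta> where "\<eta> j = (if j < n then \<phi> j else e (j - n))" for j
  define z where "z j = (if j < n then y j else - x (j - n))" for j
  have split: "(\<Sum>j<n + m. F (\<eta> j) (z j)) = (\<Sum>j<n. F (\<phi> j) (y j)) + (\<Sum>j<m. F (e j) (- x j))"
    for F :: "('d \<Rightarrow> real) \<Rightarrow> 'y \<Rightarrow> 'y"
  proof -
    have "(\<Sum>j<n + m. F (\<eta> j) (z j)) = (\<Sum>j<n. F (\<eta> j) (z j)) + (\<Sum>j<m. F (\<eta> (n + j)) (z (n + j)))"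
      by (rule sum_lessThan_add)
    then show ?thesis by (simp add: \<eta>_def z_def)
  qed
  have "tensor_op (n + m) \<eta> z \<psi> = S \<psi> - S' \<psi>" if "\<psi> \<in> L2" for \<psi>
    using split[of "\<lambda>a b. L2_inner a \<psi> *\<^sub>R b"] S S' that by (simp add: tensor_op_def sum_negf)
  moreover have "tensor_fun (n + m) \<eta> z t = g t - g' t" for t
    using split[of "\<lambda>a b. a t *\<^sub>R b"] by (simp add: tensor_fun_def g g' sum_negf)
  moreover have "\<eta> j \<in> L2" if "j < n + m" for j using \<phi> e that by (auto simp: \<eta>_def)
  ultimately show ?thesis unfolding fin_rep_def by (intro exI[of _ "n + m"] exI[of _ \<eta>] exI[of _ z]) auto
qed

text \<open>The \<gamma>-norm dominates the operator norm: pair g with the rank one tensor \<phi>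
  \<otimes> S \<phi>, which produces |S \<phi>|^2.\<close>

lemma fin_rep_norm_le:
  fixes S :: "('d::euclidean_space, 'y::real_inner) L2_op"
  assumes S: "fin_rep S g" and \<phi>: "\<phi> \<in> L2"
  shows "norm (S \<phi>) \<le> L2_norm g * sqrt (L2_inner \<phi> \<phi>)"
proof -
  let ?h = "tensor_fun 1 (\<lambda>_. \<phi>) (\<lambda>_. S \<phi>)"
  have "(norm (S \<phi>))\<^sup>2 = (LINT t|lebesgue. g t \<bullet> ?h t)"
    using fin_rep_pairing[OF S, of 1 "\<lambda>_. \<phi>" "\<lambda>_. S \<phi>"] \<phi> by (simp add: power2_norm_eq_inner)
  also have "\<dots> \<le> \<bar>LINT t|lebesgue. g t \<bullet> ?h t\<bar>" by simp
  also have "\<dots> \<le> L2_norm g * L2_norm ?h"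
    by (intro sq_integrable_inner(2) fin_rep_sq_integrable[OF S] sq_integrable_tensor_fun) (simp add: \<phi>)
  also have "L2_norm ?h = sqrt (L2_inner \<phi> \<phi>) * norm (S \<phi>)"
  proof -
    have "(LINT t|lebesgue. (norm (?h t))\<^sup>2) = L2_inner \<phi> \<phi> * (norm (S \<phi>))\<^sup>2"
    proof -
      have "(norm (?h t))\<^sup>2 = (\<phi> t * \<phi> t) * (norm (S \<phi>))\<^sup>2" for t
        by (simp add: tensor_fun_def power_mult_distrib flip: power2_eq_square)
      then show ?thesis by (simp add: L2_inner_def)
    qed
    then show ?thesis by (simp add: L2_norm_def real_sqrt_mult)
  qed
  finally have "norm (S \<phi>) * norm (S \<phi>) \<le> (L2_norm g * sqrt (L2_inner \<phi> \<phi>)) * norm (S \<phi>)"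
    by (simp add: power2_eq_square mult.assoc)
  moreover have "0 \<le> L2_norm g * sqrt (L2_inner \<phi> \<phi>)"
    by (simp add: L2_norm_nonneg L2_inner_self_nonneg)
  ultimately show ?thesis by (cases "S \<phi> = 0") auto
qed

text \<open>Makes \<^const>\<open>gamma_norm\<close> independent of the approximating sequence: the pairing of \<open>R m\<close> with the
  fixed finite rank operator \<open>R n\<close> tends to 0 as \<open>m\<close> grows.\<close>

lemma fin_rep_null_sequence:
  fixes R :: "nat \<Rightarrow> ('d::euclidean_space, 'y::real_inner) L2_op"
  assumes rep: "\<And>n. fin_rep (R n) (r n)"
    and Cauchy: "\<And>\<epsilon>. 0 < \<epsilon> \<Longrightarrow> \<exists>N. \<forall>m\<ge>N. \<forall>n\<ge>N. L2_norm (\<lambda>t. r m t - r n t) < \<epsilon>"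
    and null: "\<And>\<phi>. \<phi> \<in> L2 \<Longrightarrow> (\<lambda>n. R n \<phi>) \<longlonglongrightarrow> 0"
  shows "(\<lambda>n. L2_norm (r n)) \<longlonglongrightarrow> 0"
proof (rule LIMSEQ_I)
  fix e :: real assume "0 < e"
  then have e2: "0 < e / 2" by simp
  obtain N where N: "\<And>m n. N \<le> m \<Longrightarrow> N \<le> n \<Longrightarrow> L2_norm (\<lambda>t. r m t - r n t) < e / 2"
    using Cauchy[OF e2] by blast
  have sq: "sq_integrable (r n)" for n using rep by (rule fin_rep_sq_integrable)
  have "L2_norm (r n) < e" if n: "N \<le> n" for n
  proof -
    obtain k \<phi> y where \<phi>: "\<And>j. j < k \<Longrightarrow> \<phi> j \<in> L2" and r: "r n = tensor_fun k \<phi> y"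
      using rep[of n] unfolding fin_rep_def by blast
    define I where "I m = (LINT t|lebesgue. r m t \<bullet> r n t)" for m
    have "I = (\<lambda>m. \<Sum>j<k. R m (\<phi> j) \<bullet> y j)"
      unfolding I_def r by (rule ext) (rule fin_rep_pairing[OF rep \<phi>])
    moreover have "(\<lambda>m. \<Sum>j<k. R m (\<phi> j) \<bullet> y j) \<longlonglongrightarrow> (\<Sum>j<k. 0 \<bullet> y j)"
      using \<phi> by (intro tendsto_sum tendsto_inner tendsto_const null) auto
    ultimately have lim: "I \<longlonglongrightarrow> 0" by simp
    \<comment> \<open>The squared norm of r n differs from its pairing with r m by the pairing of r
      n - r m with r n, small uniformly in m. Letting m grow leaves only this error.\<close>
    have "(L2_norm (r n))\<^sup>2 - e / 2 * L2_norm (r n) \<le> I m" if m: "N \<le> m" for m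
    proof -
      have "(L2_norm (r n))\<^sup>2 - I m = (LINT t|lebesgue. (r n t - r m t) \<bullet> r n t)"
        unfolding I_def L2_norm_square_inner using sq_integrable_inner(1)[OF sq sq]
        by (simp add: inner_diff_left)
      also have "\<dots> \<le> \<bar>LINT t|lebesgue. (r n t - r m t) \<bullet> r n t\<bar>" by simp
      also have "\<dots> \<le> L2_norm (\<lambda>t. r n t - r m t) * L2_norm (r n)"
        by (intro sq_integrable_inner(2) sq_integrable_diff sq)
      also have "\<dots> \<le> e / 2 * L2_norm (r n)"
        using N[OF n m] by (intro mult_right_mono L2_norm_nonneg) simp
      finally show ?thesis by simp
    qed
    then have "(L2_norm (r n))\<^sup>2 - e / 2 * L2_norm (r n) \<le> 0"
      by (intro LIMSEQ_le_const[OF lim]) blast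
    then have "L2_norm (r n) * L2_norm (r n) \<le> e / 2 * L2_norm (r n)" by (simp add: power2_eq_square)
    then have "L2_norm (r n) \<le> e / 2"
      using L2_norm_nonneg[of "r n"] e2 by (cases "L2_norm (r n) = 0") auto
    then show ?thesis using \<open>0 < e\<close> by linarith
  qed
  then show "\<exists>N. \<forall>n\<ge>N. norm (L2_norm (r n) - 0) < e"
    by (intro exI[of _ N] allI impI) (simp add: L2_norm_nonneg)
qed

section \<open>Limits in the \<gamma>-norm and the norm of the limit operator\<close>

lemma gamma_limit_fin_rep:
  fixes S :: "nat \<Rightarrow> ('d::euclidean_space, 'y::real_inner) L2_op"
  assumes "gamma_limit S T"
  obtains g where "\<And>n. fin_rep (S n) (g n)"
    "\<And>\<epsilon>. 0 < \<epsilon> \<Longrightarrow> \<exists>N. \<forall>m\<ge>N. \<forall>n\<ge>N. L2_norm (\<lambda>t. g m t - g n t) < \<epsilon>"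
    "\<And>\<phi>. \<phi> \<in> L2 \<Longrightarrow> (\<lambda>n. S n \<phi>) \<longlonglongrightarrow> T \<phi>"
proof -
  have "\<forall>n. \<exists>g. fin_rep (S n) g" using assms unfolding gamma_limit_def finite_rank_iff_fin_rep by blast
  then obtain g where g: "\<And>n. fin_rep (S n) (g n)" by metis
  have "gamma_norm_fin (\<lambda>\<phi>. S m \<phi> - S n \<phi>) = L2_norm (\<lambda>t. g m t - g n t)" for m n
    by (rule gamma_norm_fin_eq[OF fin_rep_diff[OF g g]])
  then have "\<exists>N. \<forall>m\<ge>N. \<forall>n\<ge>N. L2_norm (\<lambda>t. g m t - g n t) < \<epsilon>" if "0 < \<epsilon>" for \<epsilon>
    using assms \<open>0 < \<epsilon>\<close> unfolding gamma_limit_def by simp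
  moreover have "(\<lambda>n. S n \<phi>) \<longlonglongrightarrow> T \<phi>" if "\<phi> \<in> L2" for \<phi>
    using assms \<open>\<phi> \<in> L2\<close> unfolding gamma_limit_def by blast
  ultimately show ?thesis using that[OF g] by blast
qed

text \<open>The differences of two approximating sequences are \<gamma>-Cauchy and tend to 0 on
  every function of \<open>L2\<close>, so \<open>fin_rep_null_sequence\<close> applies to
  them.\<close>

lemma gamma_limit_unique_norm:
  fixes S S' :: "nat \<Rightarrow> ('d::euclidean_space, 'y::real_inner) L2_op"
  assumes "gamma_limit S T" "gamma_limit S' T"
    and "(\<lambda>n. gamma_norm_fin (S n)) \<longlonglongrightarrow> c" "(\<lambda>n. gamma_norm_fin (S' n)) \<longlonglongrightarrow> c'"
  shows "c = c'"
proof -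
  obtain g where g: "\<And>n. fin_rep (S n) (g n)"
    "\<And>\<epsilon>. 0 < \<epsilon> \<Longrightarrow> \<exists>N. \<forall>m\<ge>N. \<forall>n\<ge>N. L2_norm (\<lambda>t. g m t - g n t) < \<epsilon>"
    "\<And>\<phi>. \<phi> \<in> L2 \<Longrightarrow> (\<lambda>n. S n \<phi>) \<longlonglongrightarrow> T \<phi>"
    by (rule gamma_limit_fin_rep[OF assms(1)]) (rule that)
  obtain g' where g': "\<And>n. fin_rep (S' n) (g' n)"
    "\<And>\<epsilon>. 0 < \<epsilon> \<Longrightarrow> \<exists>N. \<forall>m\<ge>N. \<forall>n\<ge>N. L2_norm (\<lambda>t. g' m t - g' n t) < \<epsilon>"
    "\<And>\<phi>. \<phi> \<in> L2 \<Longrightarrow> (\<lambda>n. S' n \<phi>) \<longlonglongrightarrow> T \<phi>"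
    by (rule gamma_limit_fin_rep[OF assms(2)]) (rule that)
  note sq = fin_rep_sq_integrable[OF g(1)] and sq' = fin_rep_sq_integrable[OF g'(1)]
  have "(\<lambda>n. L2_norm (\<lambda>t. g n t - g' n t)) \<longlonglongrightarrow> 0"
  proof (rule fin_rep_null_sequence[OF fin_rep_diff[OF g(1) g'(1)]])
    show "(\<lambda>n. S n \<phi> - S' n \<phi>) \<longlonglongrightarrow> 0" if "\<phi> \<in> L2" for \<phi>
      using tendsto_diff[OF g(3) g'(3)] that by fastforce
    fix \<epsilon> :: real assume "0 < \<epsilon>"
    then have \<epsilon>: "0 < \<epsilon> / 2" by simp
    obtain N where N: "\<forall>m\<ge>N. \<forall>n\<ge>N. L2_norm (\<lambda>t. g m t - g n t) < \<epsilon> / 2" using g(2)[OF \<epsilon>] by blast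
    obtain N' where N': "\<forall>m\<ge>N'. \<forall>n\<ge>N'. L2_norm (\<lambda>t. g' m t - g' n t) < \<epsilon> / 2" using g'(2)[OF \<epsilon>] by blast
    have "L2_norm (\<lambda>t. (g m t - g' m t) - (g n t - g' n t)) < \<epsilon>" if "max N N' \<le> m" "max N N' \<le> n" for m n
    proof -
      have "L2_norm (\<lambda>t. (g m t - g' m t) - (g n t - g' n t)) \<le>
          L2_norm (\<lambda>t. g m t - g n t) + L2_norm (\<lambda>t. g' m t - g' n t)"
      proof (intro L2_norm_le_add sq_integrable_diff sq sq')
        fix t
        have "(g m t - g' m t) - (g n t - g' n t) = (g m t - g n t) - (g' m t - g' n t)" by simp
        then show "norm ((g m t - g' m t) - (g n t - g' n t)) \<le> norm (g m t - g n t) + norm (g' m t - g' n t)"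
          by (metis norm_triangle_ineq4)
      qed
      moreover have "L2_norm (\<lambda>t. g m t - g n t) < \<epsilon> / 2" using N that by simp
      moreover have "L2_norm (\<lambda>t. g' m t - g' n t) < \<epsilon> / 2" using N' that by simp
      ultimately show ?thesis by linarith
    qed
    then show "\<exists>N. \<forall>m\<ge>N. \<forall>n\<ge>N. L2_norm (\<lambda>t. (g m t - g' m t) - (g n t - g' n t)) < \<epsilon>" by blast
  qed
  then have "(\<lambda>n. \<bar>L2_norm (g n) - L2_norm (g' n)\<bar>) \<longlonglongrightarrow> 0"
    by (rule Lim_null_comparison[rotated]) (simp add: L2_norm_diff_le[OF sq sq'])
  then have "(\<lambda>n. L2_norm (g n) - L2_norm (g' n)) \<longlonglongrightarrow> 0" by (rule tendsto_rabs_zero_cancel)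
  moreover have "(\<lambda>n. L2_norm (g n) - L2_norm (g' n)) \<longlonglongrightarrow> c - c'"
    using tendsto_diff[OF assms(3,4)] by (simp add: gamma_norm_fin_eq[OF g(1)] gamma_norm_fin_eq[OF g'(1)])
  ultimately show ?thesis using LIMSEQ_unique by fastforce
qed

lemma gamma_norm_eqI:
  fixes T :: "('d::euclidean_space, 'y::real_inner) L2_op"
  assumes "gamma_limit S T" "(\<lambda>n. gamma_norm_fin (S n)) \<longlonglongrightarrow> c"
  shows "gamma_norm T = c"
  unfolding gamma_norm_def
proof (rule the_equality)
  show "\<exists>S. gamma_limit S T \<and> (\<lambda>n. gamma_norm_fin (S n)) \<longlonglongrightarrow> c" using assms by blast
  show "c' = c" if "\<exists>S. gamma_limit S T \<and> (\<lambda>n. gamma_norm_fin (S n)) \<longlonglongrightarrow> c'" for c'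
    using that gamma_limit_unique_norm[OF _ assms(1) _ assms(2)] by blast
qed

lemma simple_sq_integrable_fin_rep:
  fixes h :: "'d::euclidean_space \<Rightarrow> 'y::real_normed_vector"
  assumes h: "simple_function lebesgue h" and sq: "sq_integrable h"
  shows "\<exists>n \<phi> y. (\<forall>j<n. \<phi> j \<in> L2) \<and> h = tensor_fun n \<phi> y"
proof -
  \<comment> \<open>The value 0 is left out because its level set may have infinite measure; every
    other level set has finite measure by square integrability.\<close>
  define I where "I = range h - {0}"
  have "finite I" using h by (auto simp: I_def simple_function_def)
  then obtain b where b: "bij_betw b {..<card I} I"
    using bij_betw_from_nat_into_finite by blast
  define \<phi> :: "nat \<Rightarrow> 'd \<Rightarrow> real" where "\<phi> j = indicator (h -` {b j})" for j
  have bI: "b j \<in> I" if "j < card I" for j using b that by (auto simp: bij_betw_def)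
  have "\<phi> j \<in> L2" if j: "j < card I" for j
  proof -
    have meas [measurable]: "h -` {b j} \<in> sets lebesgue"
      using h bI[OF j] by (auto simp: simple_function_def I_def)
    have [measurable]: "\<phi> j \<in> borel_measurable lebesgue" unfolding \<phi>_def by measurable
    have "b j \<noteq> 0" using bI[OF j] by (simp add: I_def)
    have "integrable lebesgue (\<lambda>t. (norm (h t))\<^sup>2 / (norm (b j))\<^sup>2)"
      using sq by (simp add: sq_integrable_def)
    then have "integrable lebesgue (\<lambda>t. (\<phi> j t)\<^sup>2)"
    proof (rule Bochner_Integration.integrable_bound)
      show "AE t in lebesgue. norm ((\<phi> j t)\<^sup>2) \<le> norm ((norm (h t))\<^sup>2 / (norm (b j))\<^sup>2)"
        using \<open>b j \<noteq> 0\<close> by (intro AE_I2) (auto simp: \<phi>_def split: split_indicator)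
    qed measurable
    then show ?thesis by (simp add: L2_def)
  qed
  moreover have "h t = tensor_fun (card I) \<phi> b t" for t
  proof -
    have "tensor_fun (card I) \<phi> b t = (\<Sum>y\<in>I. indicator (h -` {y}) t *\<^sub>R y)"
      unfolding tensor_fun_def \<phi>_def by (rule sum.reindex_bij_betw[OF b])
    also have "\<dots> = (\<Sum>y\<in>I. if y = h t then y else 0)"
      by (intro sum.cong) (auto simp: indicator_def)
    also have "\<dots> = h t" using \<open>finite I\<close> by (auto simp: I_def)
    finally show ?thesis by simp
  qed
  ultimately show ?thesis by (intro exI[of _ "card I"] exI[of _ \<phi>] exI[of _ b]) auto
qed

lemma sq_integrable_simple_approx:
  fixes g :: "'d::euclidean_space \<Rightarrow> 'y::real_normed_vector"
  assumes g: "sq_integrable g" and D: "countable D" "0 \<in> D" "range g \<subseteq> closure D"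
  obtains h where "\<And>n::nat. simple_function lebesgue (h n)" "\<And>n. sq_integrable (h n)" "\<And>n t. h n t \<in> D"
    "(\<lambda>n. L2_norm (\<lambda>t. h n t - g t)) \<longlonglongrightarrow> 0"
proof -
  have gm: "simple_limit lebesgue g" "integrable lebesgue (\<lambda>t. (norm (g t))\<^sup>2)"
    using g by (auto simp: sq_integrable_def)
  have "D \<noteq> {}" "g ` space lebesgue \<subseteq> closure D" using D by auto
  then obtain f where f: "\<And>n::nat. simple_function lebesgue (f n)" "\<And>n t. f n t \<in> D"
    "\<And>t. t \<in> space lebesgue \<Longrightarrow> (\<lambda>n. f n t) \<longlonglongrightarrow> g t"
    by (rule simple_limit_values[OF simple_limit_measurable[OF gm(1)] D(1)]) (rule that)
  \<comment> \<open>The cutoff at twice |g| makes 9 |g|^2 a dominating function for the squared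
    error. It keeps the values in D, as 0 is in D, and where g is nonzero it is eventually
    inactive.\<close>
  define h where "h n t = (if norm (f n t) \<le> 2 * norm (g t) then f n t else 0)" for n t
  have m: "(\<lambda>t. norm (g t)) \<in> borel_measurable lebesgue" "(\<lambda>t. norm (f n t)) \<in> borel_measurable lebesgue" for n
    using simple_limit_norm_measurable gm(1) simple_limit_simple[OF f(1)] by auto
  have h1: "simple_function lebesgue (h n)" for n
    unfolding h_def
  proof (rule simple_function_If[OF f(1)])
    show "{t \<in> space lebesgue. norm (f n t) \<le> 2 * norm (g t)} \<in> sets lebesgue"
      using m(1) m(2)[of n] by measurable
  qed simp
  have hg: "norm (h n t) \<le> 2 * norm (g t)" for n t by (simp add: h_def)
  have h2: "sq_integrable (h n)" for n
    by (rule sq_integrable_bound[OF simple_limit_simple[OF h1] L2_scale[OF sq_integrable_norm_L2[OF g]] hg])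
  have h3: "h n t \<in> D" for n t using f(2) D(2) by (simp add: h_def)
  have lim: "(\<lambda>n. h n t) \<longlonglongrightarrow> g t" for t
  proof (cases "g t = 0")
    case True
    then have "h n t = 0" for n using hg[of n t] by simp
    then show ?thesis using True by simp
  next
    case False
    have ft: "(\<lambda>n. f n t) \<longlonglongrightarrow> g t" using f(3) by simp
    have "norm (g t) < 2 * norm (g t)" using False by simp
    then have "\<forall>\<^sub>F n in sequentially. norm (f n t) < 2 * norm (g t)"
      by (rule order_tendstoD(2)[OF tendsto_norm[OF ft]])
    then have "\<forall>\<^sub>F n in sequentially. f n t = h n t" by eventually_elim (simp add: h_def)
    then show ?thesis using ft by (rule Lim_transform_eventually[rotated])
  qed
  have "(\<lambda>n. LINT t|lebesgue. (norm (h n t - g t))\<^sup>2) \<longlonglongrightarrow> (LINT t|(lebesgue :: 'd measure). (0::real))"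
  proof (rule Bochner_Integration.integral_dominated_convergence[of "\<lambda>_. 0" lebesgue
        "\<lambda>n t. (norm (h n t - g t))\<^sup>2" "\<lambda>t. 9 * (norm (g t))\<^sup>2"])
    show "integrable lebesgue (\<lambda>t. 9 * (norm (g t))\<^sup>2)" using gm(2) by simp
    show "(\<lambda>t. (norm (h n t - g t))\<^sup>2) \<in> borel_measurable lebesgue" for n
      using simple_limit_norm_measurable[OF simple_limit_diff[OF simple_limit_simple[OF h1] gm(1)]] by measurable
    show "AE t in lebesgue. (\<lambda>n. (norm (h n t - g t))\<^sup>2) \<longlonglongrightarrow> 0"
    proof (rule AE_I2)
      fix t
      have "(\<lambda>n. (norm (h n t - g t))\<^sup>2) \<longlonglongrightarrow> (norm (g t - g t))\<^sup>2"
        by (intro tendsto_intros lim)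
      then show "(\<lambda>n. (norm (h n t - g t))\<^sup>2) \<longlonglongrightarrow> 0" by simp
    qed
    show "AE t in lebesgue. norm ((norm (h n t - g t))\<^sup>2) \<le> 9 * (norm (g t))\<^sup>2" for n
    proof (rule AE_I2)
      fix t
      have "norm (h n t - g t) \<le> 3 * norm (g t)"
        using norm_triangle_ineq4[of "h n t" "g t"] hg[of n t] by linarith
      then have "(norm (h n t - g t))\<^sup>2 \<le> (3 * norm (g t))\<^sup>2" by (intro power_mono) auto
      then show "norm ((norm (h n t - g t))\<^sup>2) \<le> 9 * (norm (g t))\<^sup>2" by (simp add: power_mult_distrib)
    qed
  qed simp
  then have "(\<lambda>n. sqrt (LINT t|lebesgue. (norm (h n t - g t))\<^sup>2)) \<longlonglongrightarrow> sqrt 0"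
    by (intro tendsto_real_sqrt) simp
  then have "(\<lambda>n. L2_norm (\<lambda>t. h n t - g t)) \<longlonglongrightarrow> 0" by (simp add: L2_norm_def)
  then show ?thesis using that[of h] h1 h2 h3 by blast
qed

section \<open>Pettis integrals of square integrable functions\<close>

lemma sq_integrable_strongly_measurable: "sq_integrable g \<Longrightarrow> strongly_measurable g"
  by (simp add: sq_integrable_def simple_limit_strongly_measurable)

lemma bounded_linear_L2_bound:
  fixes g :: "'d::euclidean_space \<Rightarrow> 'y::real_normed_vector" and l :: "'y \<Rightarrow> real"
  assumes g: "sq_integrable g" and \<phi>: "\<phi> \<in> L2" and l: "bounded_linear l"
    and K: "\<And>y. norm (l y) \<le> norm y * K"
  shows "integrable lebesgue (\<lambda>t. l (g t) * \<phi> t)"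
    and "\<bar>LINT t|lebesgue. l (g t) * \<phi> t\<bar> \<le> K * (L2_norm g * sqrt (L2_inner \<phi> \<phi>))"
proof -
  have "simple_limit lebesgue g" using g by (simp add: sq_integrable_def)
  then have meas: "(\<lambda>t. l (g t)) \<in> borel_measurable lebesgue"
    by (rule measurable_compose[OF simple_limit_measurable])
       (intro borel_measurable_continuous_onI linear_continuous_on l)
  have a\<phi>: "(\<lambda>t. \<bar>\<phi> t\<bar>) \<in> L2" using \<phi> by (auto simp: L2_def)
  note b = sq_integrable_norm_L2[OF g]
  have int: "integrable lebesgue (\<lambda>t. norm (g t) * \<bar>\<phi> t\<bar>)" by (rule L2_mult_integrable[OF b a\<phi>])
  have le: "\<bar>l (g t) * \<phi> t\<bar> \<le> K * (norm (g t) * \<bar>\<phi> t\<bar>)" for t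
    using mult_right_mono[OF K[of "g t"], of "\<bar>\<phi> t\<bar>"] by (simp add: abs_mult ac_simps)
  show int2: "integrable lebesgue (\<lambda>t. l (g t) * \<phi> t)"
  proof (rule Bochner_Integration.integrable_bound[OF integrable_mult_right[OF int, of K]])
    show "(\<lambda>t. l (g t) * \<phi> t) \<in> borel_measurable lebesgue"
      using meas L2_measurable[OF \<phi>] by measurable
    show "AE t in lebesgue. norm (l (g t) * \<phi> t) \<le> norm (K * (norm (g t) * \<bar>\<phi> t\<bar>))"
      using order_trans[OF le abs_ge_self] by simp
  qed
  \<comment> \<open>The bound for l says nothing about the sign of K when the range is the zero
    space, so that case is separated.\<close>
  have "K \<ge> 0 \<or> (\<forall>y::'y. y = 0)"
  proof (cases "\<exists>y::'y. y \<noteq> 0")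
    case True
    then obtain y :: 'y where y: "y \<noteq> 0" by blast
    have "0 \<le> norm y * K" using K[of y] norm_ge_zero[of "l y"] by linarith
    then show ?thesis using y by (simp add: zero_le_mult_iff)
  qed simp
  then show "\<bar>LINT t|lebesgue. l (g t) * \<phi> t\<bar> \<le> K * (L2_norm g * sqrt (L2_inner \<phi> \<phi>))"
  proof
    assume K0: "0 \<le> K"
    have "\<bar>LINT t|lebesgue. l (g t) * \<phi> t\<bar> \<le> (LINT t|lebesgue. \<bar>l (g t) * \<phi> t\<bar>)" by (rule integral_abs_bound)
    also have "\<dots> \<le> (LINT t|lebesgue. K * (norm (g t) * \<bar>\<phi> t\<bar>))"
      by (intro integral_mono integrable_abs int2 integrable_mult_right int le)
    also have "\<dots> = K * L2_inner (\<lambda>t. norm (g t)) (\<lambda>t. \<bar>\<phi> t\<bar>)" by (simp add: L2_inner_def)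
    also have "\<dots> \<le> K * (L2_norm g * sqrt (L2_inner \<phi> \<phi>))"
    proof (rule mult_left_mono[OF _ K0])
      have "L2_inner (\<lambda>t. \<bar>\<phi> t\<bar>) (\<lambda>t. \<bar>\<phi> t\<bar>) = L2_inner \<phi> \<phi>" by (simp add: L2_inner_def)
      then show "L2_inner (\<lambda>t. norm (g t)) (\<lambda>t. \<bar>\<phi> t\<bar>) \<le> L2_norm g * sqrt (L2_inner \<phi> \<phi>)"
        using L2_Cauchy_Schwarz[OF b a\<phi>] by (simp add: L2_norm_eq_inner)
    qed
    finally show ?thesis .
  next
    assume z: "\<forall>y::'y. y = 0"
    then have g0: "g t = 0" for t by blast
    then have "L2_norm g = 0" by (simp add: L2_norm_def)
    moreover have "l (g t) = 0" for t using g0 linear_0[OF bounded_linear.linear[OF l]] by simp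
    ultimately show ?thesis by simp
  qed
qed

lemma fin_rep_functional:
  fixes S :: "('d::euclidean_space, 'y::real_normed_vector) L2_op" and l :: "'y \<Rightarrow> real"
  assumes "fin_rep S g" "\<psi> \<in> L2" "bounded_linear l"
  shows "l (S \<psi>) = (LINT t|lebesgue. l (g t) * \<psi> t)"
proof -
  interpret l: bounded_linear l by fact
  obtain n \<phi> y where \<phi>: "\<And>j. j < n \<Longrightarrow> \<phi> j \<in> L2" and S: "S \<psi> = tensor_op n \<phi> y \<psi>" and g: "g = tensor_fun n \<phi> y"
    using assms(1,2) unfolding fin_rep_def by blast
  have int: "integrable lebesgue (\<lambda>t. (\<phi> j t * \<psi> t) * l (y j))" if "j < n" for j
    using \<phi>[OF that] assms(2) by (intro integrable_mult_left L2_mult_integrable)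
  have "(LINT t|lebesgue. l (g t) * \<psi> t) = (LINT t|lebesgue. (\<Sum>j<n. (\<phi> j t * \<psi> t) * l (y j)))"
    by (intro Bochner_Integration.integral_cong refl)
       (simp add: g tensor_fun_def l.sum l.scaleR sum_distrib_right sum_distrib_left ac_simps)
  also have "\<dots> = (\<Sum>j<n. LINT t|lebesgue. (\<phi> j t * \<psi> t) * l (y j))"
    by (intro Bochner_Integration.integral_sum int) auto
  also have "\<dots> = l (S \<psi>)"
    unfolding S by (simp add: tensor_op_def l.sum l.scaleR L2_inner_def)
  finally show ?thesis by simp
qed

text \<open>Simple approximants of g are finite tensors and Cauchy in the \<gamma>-norm, hence
  Cauchy at every \<phi>. Completeness of Y supplies the limit operator, and the Pettis formula
  passes to the limit by Cauchy--Schwarz.\<close>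

lemma gamma_representation_exists:
  fixes g :: "'d::euclidean_space \<Rightarrow> 'y::{real_inner, banach}"
  assumes g: "sq_integrable g"
  obtains S T where "gamma_limit S T" "(\<lambda>n. gamma_norm_fin (S n)) \<longlonglongrightarrow> L2_norm g" "represents g T"
proof -
  have "simple_limit lebesgue g" using g by (simp add: sq_integrable_def)
  then obtain D where D: "countable D" "range g \<subseteq> closure D"
    by (rule simple_limit_separable) auto
  then have D0: "countable (insert 0 D)" "0 \<in> insert 0 D" "range g \<subseteq> closure (insert 0 D)"
    using closure_mono[of D "insert 0 D"] by auto
  obtain h where h: "\<And>n::nat. simple_function lebesgue (h n)" "\<And>n. sq_integrable (h n)"
    "(\<lambda>n. L2_norm (\<lambda>t. h n t - g t)) \<longlonglongrightarrow> 0"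
    by (rule sq_integrable_simple_approx[OF g D0]) (rule that)
  have "\<exists>S. fin_rep S (h n)" for n
  proof -
    obtain m \<phi> y where "\<forall>j<m. \<phi> j \<in> L2" "h n = tensor_fun m \<phi> y"
      using simple_sq_integrable_fin_rep[OF h(1,2)] by blast
    then have "fin_rep (tensor_op m \<phi> y) (h n)" using fin_rep_tensor[of m \<phi> y] by simp
    then show ?thesis by blast
  qed
  then obtain S where S: "\<And>n. fin_rep (S n) (h n)" by metis
  have dist_le: "L2_norm (\<lambda>t. h m t - h n t) \<le> L2_norm (\<lambda>t. h m t - g t) + L2_norm (\<lambda>t. h n t - g t)" for m n
    using L2_norm_triangle3[OF h(2) g h(2), of m n] L2_norm_minus_commute[of g "h n"] by simp
  have Cauchy: "\<exists>N. \<forall>m\<ge>N. \<forall>n\<ge>N. L2_norm (\<lambda>t. h m t - h n t) < \<epsilon>" if "0 < \<epsilon>" for \<epsilon>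
  proof -
    have "0 < \<epsilon> / 2" using that by simp
    then obtain N where N: "\<forall>n\<ge>N. norm (L2_norm (\<lambda>t. h n t - g t) - 0) < \<epsilon> / 2"
      using LIMSEQ_D[OF h(3)] by blast
    have "L2_norm (\<lambda>t. h m t - h n t) < \<epsilon>" if "N \<le> m" "N \<le> n" for m n
    proof -
      have "L2_norm (\<lambda>t. h m t - g t) < \<epsilon> / 2" "L2_norm (\<lambda>t. h n t - g t) < \<epsilon> / 2"
        using N that by (auto simp: abs_of_nonneg L2_norm_nonneg)
      then show ?thesis using dist_le[of m n] by linarith
    qed
    then show ?thesis by blast
  qed
  have SCauchy: "Cauchy (\<lambda>n. S n \<phi>)" if \<phi>: "\<phi> \<in> L2" for \<phi>
  proof (rule CauchyI)
    fix e :: real assume e: "0 < e"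
    \<comment> \<open>The added 1 keeps c positive when \<phi> is null, so that e / c makes
      sense.\<close>
    define c where "c = sqrt (L2_inner \<phi> \<phi>) + 1"
    have c: "0 < c" using L2_inner_self_nonneg[of \<phi>] by (simp add: c_def add_nonneg_pos)
    obtain N where N: "\<forall>m\<ge>N. \<forall>n\<ge>N. L2_norm (\<lambda>t. h m t - h n t) < e / c"
      using Cauchy[of "e / c"] e c by auto
    have "norm (S m \<phi> - S n \<phi>) < e" if "N \<le> m" "N \<le> n" for m n
    proof -
      have "norm (S m \<phi> - S n \<phi>) \<le> L2_norm (\<lambda>t. h m t - h n t) * sqrt (L2_inner \<phi> \<phi>)"
        by (rule fin_rep_norm_le[OF fin_rep_diff[OF S S] \<phi>])
      also have "\<dots> \<le> L2_norm (\<lambda>t. h m t - h n t) * c"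
        by (intro mult_left_mono L2_norm_nonneg) (simp add: c_def)
      also have "\<dots> < e / c * c" using N that c by (intro mult_strict_right_mono) auto
      finally show ?thesis using c by simp
    qed
    then show "\<exists>N. \<forall>m\<ge>N. \<forall>n\<ge>N. norm (S m \<phi> - S n \<phi>) < e" by blast
  qed
  define T where "T \<phi> = lim (\<lambda>n. S n \<phi>)" for \<phi>
  have T: "(\<lambda>n. S n \<phi>) \<longlonglongrightarrow> T \<phi>" if "\<phi> \<in> L2" for \<phi>
    unfolding T_def using SCauchy[OF that] by (simp add: Cauchy_convergent convergent_LIMSEQ_iff[symmetric])
  have "gamma_norm_fin (\<lambda>\<phi>. S m \<phi> - S n \<phi>) = L2_norm (\<lambda>t. h m t - h n t)" for m n
    by (rule gamma_norm_fin_eq[OF fin_rep_diff[OF S S]])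
  moreover have "finite_rank (S n)" for n using S[of n] finite_rank_iff_fin_rep by blast
  ultimately have "gamma_limit S T"
    unfolding gamma_limit_def using T Cauchy by simp
  moreover have "(\<lambda>n. gamma_norm_fin (S n)) \<longlonglongrightarrow> L2_norm g"
  proof -
    have "(\<lambda>n. L2_norm (h n) - L2_norm g) \<longlonglongrightarrow> 0"
      by (rule Lim_null_comparison[OF _ h(3)]) (simp add: L2_norm_diff_le[OF h(2) g])
    then show ?thesis by (simp add: gamma_norm_fin_eq[OF S] LIM_zero_iff)
  qed
  moreover have "represents g T"
    unfolding represents_def
  proof (intro conjI ballI allI impI sq_integrable_strongly_measurable[OF g])
    fix \<phi> :: "'d \<Rightarrow> real" and l :: "'y \<Rightarrow> real" assume \<phi>: "\<phi> \<in> L2" and l: "bounded_linear l"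
    interpret l: bounded_linear l by fact
    obtain K where K: "\<And>y. norm (l y) \<le> norm y * K" using l.bounded by blast
    show "integrable lebesgue (\<lambda>t. l (g t) * \<phi> t)" by (rule bounded_linear_L2_bound(1)[OF g \<phi> l K])
    have "(\<lambda>n. (LINT t|lebesgue. l (h n t - g t) * \<phi> t)) \<longlonglongrightarrow> 0"
    proof (rule Lim_null_comparison)
      show "\<forall>\<^sub>F n in sequentially. norm (LINT t|lebesgue. l (h n t - g t) * \<phi> t) \<le>
          K * (L2_norm (\<lambda>t. h n t - g t) * sqrt (L2_inner \<phi> \<phi>))"
        using bounded_linear_L2_bound(2)[OF sq_integrable_diff[OF h(2) g] \<phi> l K] by simp
      have "(\<lambda>n. K * (L2_norm (\<lambda>t. h n t - g t) * sqrt (L2_inner \<phi> \<phi>))) \<longlonglongrightarrow> K * (0 * sqrt (L2_inner \<phi> \<phi>))"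
        by (intro tendsto_intros h(3))
      then show "(\<lambda>n. K * (L2_norm (\<lambda>t. h n t - g t) * sqrt (L2_inner \<phi> \<phi>))) \<longlonglongrightarrow> 0" by simp
    qed
    moreover have "(LINT t|lebesgue. l (h n t - g t) * \<phi> t) = l (S n \<phi>) - (LINT t|lebesgue. l (g t) * \<phi> t)" for n
      unfolding fin_rep_functional[OF S \<phi> l]
      using bounded_linear_L2_bound(1)[OF g \<phi> l K] bounded_linear_L2_bound(1)[OF h(2) \<phi> l K]
      by (simp add: l.diff left_diff_distrib)
    ultimately have "(\<lambda>n. l (S n \<phi>)) \<longlonglongrightarrow> (LINT t|lebesgue. l (g t) * \<phi> t)"
      by (simp add: LIM_zero_iff)
    moreover have "(\<lambda>n. l (S n \<phi>)) \<longlonglongrightarrow> l (T \<phi>)" by (rule l.tendsto[OF T[OF \<phi>]])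
    ultimately show "l (T \<phi>) = (LINT t|lebesgue. l (g t) * \<phi> t)" by (metis LIMSEQ_unique)
  qed
  ultimately show ?thesis by (rule that)
qed

lemma represents_unique:
  fixes T T' :: "('d::euclidean_space, 'y::real_inner) L2_op"
  assumes "represents g T" "represents g T'" "\<phi> \<in> L2"
  shows "T \<phi> = T' \<phi>"
proof -
  let ?l = "\<lambda>y. y \<bullet> (T \<phi> - T' \<phi>)"
  have "?l (T \<phi>) = ?l (T' \<phi>)"
    using assms bounded_linear_inner_left[of "T \<phi> - T' \<phi>"] unfolding represents_def by metis
  then have "(T \<phi> - T' \<phi>) \<bullet> (T \<phi> - T' \<phi>) = 0" by (simp add: inner_diff_left)
  then show ?thesis by simp
qed

text \<open>Completeness of Lebesgue measure: whatever f' does inside a null set is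
  measurable.\<close>

lemma borel_measurable_lebesgue_AE_cong:
  fixes f f' :: "'d::euclidean_space \<Rightarrow> real"
  assumes f: "f \<in> borel_measurable lebesgue" and ae: "AE t in lebesgue. f t = f' t"
  shows "f' \<in> borel_measurable lebesgue"
proof (rule measurableI)
  obtain N where N: "N \<in> null_sets lebesgue" "{t. f t \<noteq> f' t} \<subseteq> N"
    using ae by (auto simp: eventually_ae_filter)
  fix A :: "real set" assume A: "A \<in> sets borel"
  have "f' -` A \<inter> N \<in> null_sets lebesgue"
    by (rule null_sets_completion_subset[OF _ N(1)]) auto
  moreover have "f -` A \<inter> space lebesgue \<in> sets lebesgue" using f A by (rule measurable_sets)
  ultimately have "(f -` A \<inter> space lebesgue - N) \<union> (f' -` A \<inter> N) \<in> sets lebesgue"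
    using N(1) by (intro sets.Un sets.Diff) auto
  moreover have "(f -` A \<inter> space lebesgue - N) \<union> (f' -` A \<inter> N) = f' -` A \<inter> space lebesgue"
    using N(2) by (auto simp: subset_iff) metis+
  ultimately show "f' -` A \<inter> space lebesgue \<in> sets lebesgue" by simp
qed simp

lemma represents_AE_cong:
  fixes g g' :: "'d::euclidean_space \<Rightarrow> 'y::real_normed_vector"
  assumes "represents g T" and ae: "AE t in lebesgue. g t = g' t"
  shows "represents g' T"
  unfolding represents_def
proof (intro conjI ballI allI impI)
  show "strongly_measurable g'"
    using assms(1) strongly_measurable_AE_eq[OF _ ae] by (simp add: represents_def)
  fix \<phi> :: "'d \<Rightarrow> real" and l :: "'y \<Rightarrow> real" assume *: "\<phi> \<in> L2" "bounded_linear l"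
  have int: "integrable lebesgue (\<lambda>t. l (g t) * \<phi> t)" and eq: "l (T \<phi>) = (LINT t|lebesgue. l (g t) * \<phi> t)"
    using assms(1) * unfolding represents_def by blast+
  have ae2: "AE t in lebesgue. l (g t) * \<phi> t = l (g' t) * \<phi> t" using ae by eventually_elim simp
  have meas: "(\<lambda>t. l (g' t) * \<phi> t) \<in> borel_measurable lebesgue"
    by (rule borel_measurable_lebesgue_AE_cong[OF borel_measurable_integrable[OF int] ae2])
  show "integrable lebesgue (\<lambda>t. l (g' t) * \<phi> t)"
    by (rule Bochner_Integration.integrable_cong_AE_imp[OF int meas ae2])
  show "l (T \<phi>) = (LINT t|lebesgue. l (g' t) * \<phi> t)"
    unfolding eq by (rule integral_cong_AE[OF borel_measurable_integrable[OF int] meas ae2])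
qed

lemma gamma_norm_represents:
  fixes g :: "'d::euclidean_space \<Rightarrow> 'y::{real_inner, banach}"
  assumes g: "sq_integrable g" and T: "represents g T"
  shows "T \<in> gamma_space" "gamma_norm T = L2_norm g"
proof -
  obtain S T' where S: "gamma_limit S T'" "(\<lambda>n. gamma_norm_fin (S n)) \<longlonglongrightarrow> L2_norm g" "represents g T'"
    by (rule gamma_representation_exists[OF g]) (rule that)
  have "gamma_limit S T"
    using S(1) represents_unique[OF S(3) T] unfolding gamma_limit_def by auto
  then show "T \<in> gamma_space" "gamma_norm T = L2_norm g"
    using gamma_norm_eqI[OF _ S(2)] by (auto simp: gamma_space_def)
qed

lemma represents_diff:
  assumes "represents g T" "represents g' T'" "strongly_measurable (\<lambda>t. g t - g' t)"
  shows "represents (\<lambda>t. g t - g' t) (\<lambda>\<phi>. T \<phi> - T' \<phi>)"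
  unfolding represents_def
proof (intro conjI ballI allI impI assms(3))
  fix \<phi> :: "'a \<Rightarrow> real" and l :: "'b \<Rightarrow> real" assume *: "\<phi> \<in> L2" "bounded_linear l"
  interpret l: bounded_linear l by fact
  have "integrable lebesgue (\<lambda>t. l (g t) * \<phi> t)" "l (T \<phi>) = (LINT t|lebesgue. l (g t) * \<phi> t)"
    "integrable lebesgue (\<lambda>t. l (g' t) * \<phi> t)" "l (T' \<phi>) = (LINT t|lebesgue. l (g' t) * \<phi> t)"
    using assms(1,2) * unfolding represents_def by blast+
  then show "integrable lebesgue (\<lambda>t. l (g t - g' t) * \<phi> t)"
    "l (T \<phi> - T' \<phi>) = (LINT t|lebesgue. l (g t - g' t) * \<phi> t)"
    by (simp_all add: l.diff left_diff_distrib)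
qed

text \<open>Tested against simple functions close to \<open>g\<close> where \<open>g\<close> is still bounded, the \<open>\<gamma>\<close>-bound forces
  \<open>g\<close> to be square integrable.\<close>

lemma gamma_space_sq_integrable:
  fixes g :: "'d::euclidean_space \<Rightarrow> 'y::{real_inner, banach}"
  assumes T: "T \<in> gamma_space" and rep: "represents g T" and g: "simple_limit lebesgue g"
  shows "sq_integrable g"
proof -
  obtain S where S: "gamma_limit S T" using T by (auto simp: gamma_space_def)
  obtain s where s: "\<And>n. fin_rep (S n) (s n)"
    "\<And>\<epsilon>. 0 < \<epsilon> \<Longrightarrow> \<exists>N. \<forall>m\<ge>N. \<forall>n\<ge>N. L2_norm (\<lambda>t. s m t - s n t) < \<epsilon>"
    "\<And>\<phi>. \<phi> \<in> L2 \<Longrightarrow> (\<lambda>n. S n \<phi>) \<longlonglongrightarrow> T \<phi>"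
    by (rule gamma_limit_fin_rep[OF S]) (rule that)
  note sq = fin_rep_sq_integrable[OF s(1)]
  obtain N where N: "\<forall>m\<ge>N. \<forall>n\<ge>N. L2_norm (\<lambda>t. s m t - s n t) < 1" using s(2)[of 1] by auto
  \<comment> \<open>A \<gamma>-Cauchy sequence is eventually within 1 of its N-th term, so C bounds
    the norms from N on.\<close>
  define C where "C = L2_norm (s N) + 1"
  have C: "0 < C" using L2_norm_nonneg[of "s N"] by (simp add: C_def add_nonneg_pos)
  have sC: "L2_norm (s n) \<le> C" if "N \<le> n" for n
  proof -
    have "L2_norm (\<lambda>t. s n t - s N t) < 1" using N that by simp
    then show ?thesis using L2_norm_diff_le[OF sq[of n] sq[of N]] unfolding C_def by linarith
  qed
  \<comment> \<open>A simple h is a finite tensor, so its pairing with g is a finite combination of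
    values of T. It is the limit of the pairings with s n, each bounded by C times the norm of
    h.\<close>
  have test: "(LINT t|lebesgue. g t \<bullet> h t) \<le> C * L2_norm h"
    if h: "simple_function lebesgue h" "sq_integrable h" for h :: "'d \<Rightarrow> 'y"
  proof -
    obtain k \<phi> y where \<phi>: "\<And>j. j < k \<Longrightarrow> \<phi> j \<in> L2" and heq: "h = tensor_fun k \<phi> y"
      using simple_sq_integrable_fin_rep[OF h] by blast
    have int: "integrable lebesgue (\<lambda>t. (g t \<bullet> y j) * \<phi> j t)"
      and eq: "T (\<phi> j) \<bullet> y j = (LINT t|lebesgue. (g t \<bullet> y j) * \<phi> j t)" if "j < k" for j
      using rep \<phi>[OF that] bounded_linear_inner_left[of "y j"] unfolding represents_def by blast+
    have "(LINT t|lebesgue. g t \<bullet> h t) = (LINT t|lebesgue. (\<Sum>j<k. (g t \<bullet> y j) * \<phi> j t))"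
      by (intro Bochner_Integration.integral_cong refl) (simp add: heq tensor_fun_def inner_sum_right mult.commute)
    also have "\<dots> = (\<Sum>j<k. LINT t|lebesgue. (g t \<bullet> y j) * \<phi> j t)"
      by (intro Bochner_Integration.integral_sum int) auto
    also have "\<dots> = (\<Sum>j<k. T (\<phi> j) \<bullet> y j)" by (simp add: eq)
    finally have gh: "(LINT t|lebesgue. g t \<bullet> h t) = (\<Sum>j<k. T (\<phi> j) \<bullet> y j)" .
    have "(\<lambda>n. \<Sum>j<k. S n (\<phi> j) \<bullet> y j) \<longlonglongrightarrow> (\<Sum>j<k. T (\<phi> j) \<bullet> y j)"
      using \<phi> by (intro tendsto_sum tendsto_inner tendsto_const s(3)) auto
    moreover have "(\<Sum>j<k. S n (\<phi> j) \<bullet> y j) \<le> C * L2_norm h" if n: "N \<le> n" for n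
    proof -
      have "(\<Sum>j<k. S n (\<phi> j) \<bullet> y j) = (LINT t|lebesgue. s n t \<bullet> h t)"
        unfolding heq by (rule fin_rep_pairing[OF s(1) \<phi>, symmetric])
      also have "\<dots> \<le> \<bar>LINT t|lebesgue. s n t \<bullet> h t\<bar>" by simp
      also have "\<dots> \<le> L2_norm (s n) * L2_norm h" by (rule sq_integrable_inner(2)[OF sq \<open>sq_integrable h\<close>])
      also have "\<dots> \<le> C * L2_norm h" by (intro mult_right_mono sC n L2_norm_nonneg)
      finally show ?thesis .
    qed
    ultimately show ?thesis unfolding gh by (intro LIMSEQ_le_const2) blast+
  qed
  obtain f where f: "\<And>n::nat. simple_function lebesgue (f n)" "\<And>t. (\<lambda>n. f n t) \<longlonglongrightarrow> g t"
    using g unfolding simple_limit_def by auto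
  have [measurable]: "(\<lambda>t. norm (g t)) \<in> borel_measurable lebesgue" by (rule simple_limit_norm_measurable[OF g])
  have [measurable]: "(\<lambda>t. norm (f n t - g t)) \<in> borel_measurable lebesgue" for n
    by (intro simple_limit_norm_measurable simple_limit_diff simple_limit_simple f g)
  \<comment> \<open>On E n the simple function f n is close to g relative to |g|, and E n is
    bounded. Cutting f n off outside therefore gives an admissible test function whose pairing with
    g is comparable to |g|^2 on E n.\<close>
  define E where "E n = {t \<in> space lebesgue. norm (f n t - g t) \<le> norm (g t) / 4 \<and> t \<in> ball 0 (real n)}" for n
  have E_sets [measurable]: "E n \<in> sets lebesgue" for n
  proof -
    have "{t \<in> space lebesgue. norm (f n t - g t) \<le> norm (g t) / 4} \<inter> ball 0 (real n) \<in> sets lebesgue"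
      by (intro sets.Int) (measurable, simp)
    moreover have "{t \<in> space lebesgue. norm (f n t - g t) \<le> norm (g t) / 4} \<inter> ball 0 (real n) = E n"
      by (auto simp: E_def)
    ultimately show ?thesis by simp
  qed
  define h where "h n t = (if t \<in> E n then f n t else 0)" for n t
  have h1: "simple_function lebesgue (h n)" for n
    unfolding h_def using E_sets[of n] by (intro simple_function_If_set f) auto
  have h2: "sq_integrable (h n)" for n
  proof (rule sq_integrable_bound)
    show "simple_limit lebesgue (h n)" by (rule simple_limit_simple[OF h1])
    define b where "b = Max (insert 0 (norm ` range (f n)))"
    have fin: "finite (insert 0 (norm ` range (f n)))" using f(1)[of n] by (simp add: simple_function_def)
    show "norm (h n t) \<le> b * indicator (ball 0 (real n)) t" for t
    proof -
      have "norm (f n t) \<le> b" "0 \<le> b" unfolding b_def using fin by (intro Max_ge; simp)+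
      then show ?thesis by (auto simp: h_def E_def)
    qed
    have "integrable lebesgue (indicator (ball (0::'d) (real n)) :: 'd \<Rightarrow> real)"
      using emeasure_bounded_finite[OF bounded_ball, of "0::'d" "real n"]
      by (intro integrable_real_indicator) (auto simp: emeasure_completion)
    moreover have "(\<lambda>t. (indicator (ball (0::'d) (real n)) t :: real)\<^sup>2) = indicator (ball 0 (real n))"
      by (auto simp: fun_eq_iff indicator_def)
    ultimately have "indicator (ball (0::'d) (real n)) \<in> (L2 :: ('d \<Rightarrow> real) set)"
      by (simp add: L2_def borel_measurable_integrable)
    then show "(\<lambda>t::'d. b * indicator (ball 0 (real n)) t) \<in> L2" by (rule L2_scale)
  qed
  \<comment> \<open>On E n one has g \<bullet> f n \<ge> 3/4 |g|^2 and |f n| \<le> 5/4 |g|. With q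
    the integral of |g|^2 over E n, testing gives 3/4 q \<le> 5/4 C sqrt q, whence the constant
    5/3.\<close>
  have bd: "(\<integral>\<^sup>+ t. ennreal ((norm (g t))\<^sup>2 * indicator (E n) t) \<partial>lebesgue) \<le> ennreal ((5 / 3 * C)\<^sup>2)" for n
  proof -
    define G where "G t = (norm (g t))\<^sup>2 * indicator (E n) t" for t
    have near: "norm (f n t - g t) \<le> norm (g t) / 4" if "t \<in> E n" for t using that by (simp add: E_def)
    have G_int: "integrable lebesgue G"
    proof (rule Bochner_Integration.integrable_bound)
      show "integrable lebesgue (\<lambda>t. 4 * (norm (h n t))\<^sup>2)" using h2[of n] by (simp add: sq_integrable_def)
      show "G \<in> borel_measurable lebesgue" unfolding G_def by measurable
      show "AE t in lebesgue. norm (G t) \<le> norm (4 * (norm (h n t))\<^sup>2)"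
      proof (rule AE_I2)
        fix t show "norm (G t) \<le> norm (4 * (norm (h n t))\<^sup>2)"
        proof (cases "t \<in> E n")
          case True
          have "norm (g t) \<le> norm (f n t) + norm (f n t - g t)" by (metis norm_triangle_sub norm_minus_commute)
          then have "norm (g t) \<le> 2 * norm (f n t)" using near[OF True] norm_ge_zero[of "g t"] norm_ge_zero[of "f n t"] by linarith
          then have "(norm (g t))\<^sup>2 \<le> (2 * norm (f n t))\<^sup>2" by (intro power_mono) auto
          then show ?thesis using True by (simp add: G_def h_def power_mult_distrib)
        qed (simp add: G_def)
      qed
    qed
    define q where "q = (LINT t|lebesgue. G t)"
    have q0: "0 \<le> q" unfolding q_def G_def by (intro integral_nonneg_AE) auto
    have "3 / 4 * q \<le> (LINT t|lebesgue. g t \<bullet> h n t)"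
    proof -
      have "3 / 4 * G t \<le> g t \<bullet> h n t" for t
      proof (cases "t \<in> E n")
        case True
        have "- (g t \<bullet> (f n t - g t)) \<le> norm (g t) * norm (f n t - g t)"
          using Cauchy_Schwarz_ineq2[of "g t" "f n t - g t"] by linarith
        also have "\<dots> \<le> norm (g t) * (norm (g t) / 4)" by (intro mult_left_mono near[OF True]) auto
        finally have "(norm (g t))\<^sup>2 - (norm (g t))\<^sup>2 / 4 \<le> g t \<bullet> g t + g t \<bullet> (f n t - g t)"
          by (simp add: power2_norm_eq_inner) (simp add: dot_square_norm power2_eq_square)
        also have "\<dots> = g t \<bullet> f n t" by (simp add: inner_diff_right)
        finally show ?thesis using True by (simp add: G_def h_def)
      qed (simp add: G_def h_def)
      moreover have "integrable lebesgue (\<lambda>t. g t \<bullet> h n t)"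
      proof (rule Bochner_Integration.integrable_bound)
        show "integrable lebesgue (\<lambda>t. 2 * G t)" using G_int by simp
        show "(\<lambda>t. g t \<bullet> h n t) \<in> borel_measurable lebesgue"
          by (intro inner_simple_limit_measurable g simple_limit_simple h1)
        show "AE t in lebesgue. norm (g t \<bullet> h n t) \<le> norm (2 * G t)"
        proof (rule AE_I2)
          fix t show "norm (g t \<bullet> h n t) \<le> norm (2 * G t)"
          proof (cases "t \<in> E n")
            case True
            have "norm (f n t) \<le> 2 * norm (g t)"
              using near[OF True] norm_triangle_sub[of "f n t" "g t"] norm_ge_zero[of "g t"] by linarith
            then have "norm (g t) * norm (f n t) \<le> norm (g t) * (2 * norm (g t))" by (intro mult_left_mono) auto
            then show ?thesis using Cauchy_Schwarz_ineq2[of "g t" "f n t"] True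
              by (simp add: G_def h_def power2_eq_square)
          qed (simp add: G_def h_def)
        qed
      qed
      ultimately show ?thesis unfolding q_def
        using integral_mono[of lebesgue "\<lambda>t. 3 / 4 * G t" "\<lambda>t. g t \<bullet> h n t"] G_int by simp
    qed
    also have "\<dots> \<le> C * L2_norm (h n)" by (rule test[OF h1 h2])
    also have "L2_norm (h n) \<le> 5 / 4 * sqrt q"
    proof -
      have "(LINT t|lebesgue. (norm (h n t))\<^sup>2) \<le> (LINT t|lebesgue. (5 / 4)\<^sup>2 * G t)"
      proof (rule integral_mono)
        show "integrable lebesgue (\<lambda>t. (norm (h n t))\<^sup>2)" using h2[of n] by (simp add: sq_integrable_def)
        show "integrable lebesgue (\<lambda>t. (5 / 4)\<^sup>2 * G t)" using G_int by simp
        fix t show "(norm (h n t))\<^sup>2 \<le> (5 / 4)\<^sup>2 * G t"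
        proof (cases "t \<in> E n")
          case True
          have "norm (f n t) \<le> 5 / 4 * norm (g t)"
            using near[OF True] norm_triangle_sub[of "f n t" "g t"] by linarith
          then have "(norm (f n t))\<^sup>2 \<le> (5 / 4 * norm (g t))\<^sup>2" by (rule power_mono) simp
          then have "(norm (f n t))\<^sup>2 \<le> (5 / 4)\<^sup>2 * (norm (g t))\<^sup>2" by (simp only: power_mult_distrib)
          then show ?thesis using True by (simp only: G_def h_def if_True indicator_simps mult_1_right)
        qed (simp add: G_def h_def)
      qed
      also have "\<dots> = (5 / 4)\<^sup>2 * q" by (simp add: q_def)
      finally have "L2_norm (h n) \<le> sqrt ((5 / 4)\<^sup>2 * q)" unfolding L2_norm_def by (rule real_sqrt_le_mono)
      then show ?thesis by (simp add: real_sqrt_mult)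
    qed
    finally have "3 / 4 * q \<le> C * (5 / 4 * sqrt q)" using C by simp
    then have "sqrt q * sqrt q \<le> (5 / 3 * C) * sqrt q" using q0 by simp
    then have "sqrt q \<le> 5 / 3 * C"
    proof (cases "q = 0")
      case False
      then have "0 < sqrt q" using q0 by simp
      with \<open>sqrt q * sqrt q \<le> (5 / 3 * C) * sqrt q\<close> show ?thesis by (rule mult_right_le_imp_le)
    qed (use C in simp)
    then have "(sqrt q)\<^sup>2 \<le> (5 / 3 * C)\<^sup>2" using q0 by (intro power_mono) auto
    then have "q \<le> (5 / 3 * C)\<^sup>2" using q0 by simp
    moreover have "(\<integral>\<^sup>+ t. ennreal (G t) \<partial>lebesgue) = ennreal q"
      unfolding q_def by (rule nn_integral_eq_integral[OF G_int]) (simp add: G_def)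
    ultimately show ?thesis unfolding G_def by (simp add: ennreal_leI)
  qed
  have "(\<integral>\<^sup>+ t. ennreal ((norm (g t))\<^sup>2) \<partial>lebesgue) \<le> (\<integral>\<^sup>+ t. liminf (\<lambda>n. ennreal ((norm (g t))\<^sup>2 * indicator (E n) t)) \<partial>lebesgue)"
  proof (rule nn_integral_mono)
    fix t :: 'd
    show "ennreal ((norm (g t))\<^sup>2) \<le> liminf (\<lambda>n. ennreal ((norm (g t))\<^sup>2 * indicator (E n) t))"
    proof (cases "g t = 0")
      case False
      have "(\<lambda>n. norm (f n t - g t)) \<longlonglongrightarrow> norm (g t - g t)" by (intro tendsto_intros f(2))
      then have near: "\<forall>\<^sub>F n in sequentially. norm (f n t - g t) < norm (g t) / 4"
        by (rule order_tendstoD(2)) (use False in simp)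
      obtain M :: nat where M: "norm t < real M" using reals_Archimedean2 by blast
      have "\<forall>\<^sub>F n in sequentially. ennreal ((norm (g t))\<^sup>2) \<le> ennreal ((norm (g t))\<^sup>2 * indicator (E n) t)"
        using near eventually_ge_at_top[of M] by eventually_elim (use M in \<open>auto simp: E_def\<close>)
      then show ?thesis by (rule Liminf_bounded)
    qed simp
  qed
  also have "\<dots> \<le> liminf (\<lambda>n. \<integral>\<^sup>+ t. ennreal ((norm (g t))\<^sup>2 * indicator (E n) t) \<partial>lebesgue)"
    by (rule nn_integral_liminf) measurable
  also have "\<dots> \<le> liminf (\<lambda>n. ennreal ((5 / 3 * C)\<^sup>2))"
    by (intro Liminf_mono always_eventually allI bd)
  also have "\<dots> < \<top>" by (simp add: Liminf_const)
  finally have "integrable lebesgue (\<lambda>t. (norm (g t))\<^sup>2)"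
    by (intro integrableI_nonneg) auto
  then show ?thesis using g by (simp add: sq_integrable_def)
qed

subsection \<open>Measurability of \<open>\<gamma>\<close>-valued functions\<close>

lemma simple_limit_lborel_iff: "simple_limit lborel f \<longleftrightarrow> simple_limit borel f"
  by (simp add: simple_limit_iff)

text \<open>Strong measurability of k gives an exceptional null set for every vector. The
  approximants of \<sigma> take countably many values, so a single N serves them all. With k put to
  0 on N, the kernel is jointly measurable along each approximant, and boundedness of each operator
  passes this to \<sigma>.\<close>

lemma kernel_borel_version:
  fixes k :: "'d::euclidean_space \<Rightarrow> 'x::real_normed_vector \<Rightarrow>\<^sub>L 'y::real_normed_vector"
  assumes meas: "\<And>x. strongly_measurable (\<lambda>t. blinfun_apply (k t) x)" and \<sigma>: "simple_limit lborel \<sigma>"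
  obtains N where "N \<in> null_sets (lborel :: 'd measure)"
    "simple_limit (borel \<Otimes>\<^sub>M borel)
      (\<lambda>z. blinfun_apply (if fst z - snd z \<in> N then 0 else k (fst z - snd z)) (\<sigma> (snd z)))"
proof -
  obtain f where f: "\<forall>n::nat. simple_function lborel (f n)" "\<forall>t. (\<lambda>n. f n t) \<longlonglongrightarrow> \<sigma> t"
    using \<sigma> unfolding simple_limit_def by auto
  define D where "D = (\<Union>n. range (f n))"
  have D: "countable D"
    unfolding D_def using f(1) by (intro countable_UN) (auto simp: simple_function_def intro: countable_finite)
  have "\<exists>v. simple_limit lborel v \<and> (AE t in lborel. blinfun_apply (k t) x = v t)" for x
    using strongly_measurable_borel_version[OF meas[of x]] by metis
  then obtain v where v: "\<And>x. simple_limit lborel (v x)" "\<And>x. AE t in lborel. blinfun_apply (k t) x = v x t"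
    by metis
  have "AE t in lborel. \<forall>x\<in>D. blinfun_apply (k t) x = v x t"
    using v(2) by (simp add: AE_ball_countable[OF D])
  then obtain N where N: "N \<in> null_sets lborel" "{t. \<not> (\<forall>x\<in>D. blinfun_apply (k t) x = v x t)} \<subseteq> N"
    by (auto simp: eventually_ae_filter)
  define k' where "k' t = (if t \<in> N then 0 else k t)" for t
  have [measurable]: "N \<in> sets borel" using N(1) by auto
  have k'x: "simple_limit borel (\<lambda>t. blinfun_apply (k' t) x)" if "x \<in> D" for x
  proof -
    have "(\<lambda>t. blinfun_apply (k' t) x) = (\<lambda>t. indicator (- N) t *\<^sub>R v x t)"
      using N(2) that by (auto simp: fun_eq_iff k'_def split: split_indicator)
    moreover have "simple_limit borel (\<lambda>t. indicator (- N) t *\<^sub>R v x t)"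
      using v(1)[of x] by (intro simple_limit_scaleR) (auto simp: simple_limit_lborel_iff simple_limit_real)
    ultimately show ?thesis by simp
  qed
  have step: "simple_limit (borel \<Otimes>\<^sub>M borel) (\<lambda>z. blinfun_apply (k' (fst z - snd z)) (f n (snd z)))" for n
  proof -
    have fin: "finite (range (f n))" using f(1) by (simp add: simple_function_def)
    have "(\<lambda>z. blinfun_apply (k' (fst z - snd z)) (f n (snd z))) =
        (\<lambda>z. \<Sum>y\<in>range (f n). indicator (f n -` {y}) (snd z) *\<^sub>R blinfun_apply (k' (fst z - snd z)) y)"
    proof
      fix z :: "'d \<times> 'd"
      have "(\<Sum>y\<in>range (f n). indicator (f n -` {y}) (snd z) *\<^sub>R blinfun_apply (k' (fst z - snd z)) y) =
          (\<Sum>y\<in>range (f n). if y = f n (snd z) then blinfun_apply (k' (fst z - snd z)) y else 0)"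
        by (intro sum.cong) (auto simp: indicator_def)
      then show "blinfun_apply (k' (fst z - snd z)) (f n (snd z)) =
          (\<Sum>y\<in>range (f n). indicator (f n -` {y}) (snd z) *\<^sub>R blinfun_apply (k' (fst z - snd z)) y)"
        using fin by simp
    qed
    moreover have "simple_limit (borel \<Otimes>\<^sub>M borel)
        (\<lambda>z. \<Sum>y\<in>range (f n). indicator (f n -` {y}) (snd z) *\<^sub>R blinfun_apply (k' (fst z - snd z)) y)"
    proof (intro simple_limit_sum simple_limit_scaleR)
      fix y assume y: "y \<in> range (f n)"
      have [measurable]: "f n -` {y} \<in> sets borel"
        using f(1) y by (auto simp: simple_function_def)
      show "simple_limit (borel \<Otimes>\<^sub>M borel) (\<lambda>z::'d \<times> 'd. indicator (f n -` {y}) (snd z) :: real)"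
        unfolding simple_limit_real by measurable
      have "y \<in> D" using y by (auto simp: D_def)
      from k'x[OF this] show "simple_limit (borel \<Otimes>\<^sub>M borel) (\<lambda>z. blinfun_apply (k' (fst z - snd z)) y)"
        by (rule simple_limit_compose) measurable
    qed
    ultimately show ?thesis by simp
  qed
  have "simple_limit (borel \<Otimes>\<^sub>M borel) (\<lambda>z. blinfun_apply (k' (fst z - snd z)) (\<sigma> (snd z)))"
  proof (rule simple_limit_LIMSEQ)
    show "simple_limit (borel \<Otimes>\<^sub>M borel) (\<lambda>z. blinfun_apply (k' (fst z - snd z)) (f n (snd z)))" for n
      by (rule step)
    show "(\<lambda>n. blinfun_apply (k' (fst z - snd z)) (f n (snd z))) \<longlonglongrightarrow> blinfun_apply (k' (fst z - snd z)) (\<sigma> (snd z))" for z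
      by (intro blinfun.tendsto tendsto_const f(2)[rule_format])
  qed
  then show ?thesis using that[OF N(1)] unfolding k'_def by simp
qed

text \<open>Outer regularity puts A into an open T of almost the same measure, and continuity from
  below exhausts T by finite unions of basis sets. The candidates so obtained form a countable
  family that is independent of A.\<close>

lemma indicator_finite_union_approx:
  fixes A :: "'d::euclidean_space set"
  assumes B: "topological_basis B" "countable B" and A: "A \<in> lmeasurable" and e: "0 < e"
  obtains F where "finite F" "F \<subseteq> B" "\<Union>F \<in> lmeasurable" "measure lebesgue (\<Union>F - A) < e" "measure lebesgue (A - \<Union>F) < e"
proof -
  obtain T where T: "open T" "A \<subseteq> T" "T - A \<in> lmeasurable" "emeasure lebesgue (T - A) < ennreal e"
    using sets_lebesgue_outer_open[of A e] A e by (auto simp: fmeasurableD)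
  have mTA: "measure lebesgue (T - A) < e"
    using T(3,4) e by (simp add: emeasure_eq_measure2 ennreal_less_iff fmeasurableD2)
  have "T = A \<union> (T - A)" using T(2) by blast
  then have Tm: "T \<in> lmeasurable" using A T(3) by (metis fmeasurable.Un)
  obtain B' where B': "B' \<subseteq> B" "\<Union>B' = T" using B(1) T(1) unfolding topological_basis_def by blast
  have "countable B'" using B(2) B'(1) by (rule countable_subset[rotated])
  \<comment> \<open>\<open>from_nat_into\<close> is meaningful on nonempty sets only; T, and with it
    B', may be empty.\<close>
  define b where "b n = (if B' = {} then {} else from_nat_into B' n)" for n
  have bopen: "open (b n)" for n
  proof (cases "B' = {}")
    case False
    then have "from_nat_into B' n \<in> B" using from_nat_into[of B' n] B'(1) by blast
    then show ?thesis using topological_basis_open[OF B(1)] False by (simp add: b_def)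
  qed (simp add: b_def)
  define U where "U n = (\<Union>i<n. b i)" for n
  have bT: "(\<Union>n. b n) = T"
    using B'(2) range_from_nat_into[of B'] \<open>countable B'\<close> by (cases "B' = {}") (auto simp: b_def)
  have UT: "(\<Union>n. U n) = T" unfolding U_def bT[symmetric] by auto
  have Us: "U n \<in> sets lebesgue" for n using bopen by (auto simp: U_def)
  have Um: "U n \<in> lmeasurable" for n
    by (rule fmeasurableI2[OF Tm _ Us]) (use UT in auto)
  have "(\<lambda>n. measure lebesgue (U n)) \<longlonglongrightarrow> measure lebesgue (\<Union>n. U n)"
  proof (rule Lim_measure_incseq)
    show "range U \<subseteq> sets lebesgue" using Us by auto
    show "incseq U" by (auto simp: incseq_def U_def intro: order.strict_trans2)
    show "emeasure lebesgue (\<Union>n. U n) \<noteq> \<infinity>"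
      unfolding UT using fmeasurableD2[OF Tm] by simp
  qed
  then have "\<forall>\<^sub>F n in sequentially. measure lebesgue T - e < measure lebesgue (U n)"
    unfolding UT using e by (intro order_tendstoD(1)) auto
  then obtain n where n: "measure lebesgue T - e < measure lebesgue (U n)" by (auto simp: eventually_sequentially)
  have UnT: "U n \<subseteq> T" using UT by blast
  have mTU: "measure lebesgue (T - U n) < e"
  proof -
    have "emeasure lebesgue T \<noteq> \<infinity>" using fmeasurableD2[OF Tm] by (simp only: infinity_ennreal_def not_False_eq_True)
    from measure_Diff[OF this fmeasurableD[OF Tm] Us UnT] n show ?thesis by linarith
  qed
  define F where "F = (if B' = {} then {} else b ` {..<n})"
  have FU: "\<Union>F = U n" by (auto simp: F_def U_def b_def)
  have "F \<subseteq> B" using B'(1) from_nat_into[of B'] by (auto simp: F_def b_def)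
  moreover have "finite F" by (simp add: F_def)
  moreover have "measure lebesgue (U n - A) \<le> measure lebesgue (T - A)"
    using UnT T(3) Us[of n] A by (intro measure_mono_fmeasurable) (auto simp: fmeasurableD)
  moreover have "measure lebesgue (A - U n) \<le> measure lebesgue (T - U n)"
    using T(2) Tm Um[of n] A by (intro measure_mono_fmeasurable) (auto simp: fmeasurableD)
  ultimately show ?thesis using mTA mTU Um[of n] by (intro that[of F]) (auto simp: FU)
qed

text \<open>Separability of the space of square integrable functions with values in the closure of
  D. The dense family consists of Borel functions, so that distances to it are jointly
  measurable.\<close>

lemma L2_countable_dense:
  fixes D :: "'y::real_normed_vector set"
  assumes D: "countable D" "0 \<in> D"
  obtains g :: "nat \<Rightarrow> 'd::euclidean_space \<Rightarrow> 'y" where "\<And>i. simple_limit borel (g i)" "\<And>i. sq_integrable (g i)"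
    "\<And>f \<epsilon>. sq_integrable f \<Longrightarrow> range f \<subseteq> closure D \<Longrightarrow> 0 < \<epsilon> \<Longrightarrow> \<exists>i. L2_norm (\<lambda>t. g i t - f t) < \<epsilon>"
proof -
  obtain B :: "'d set set" where B: "countable B" "topological_basis B" using ex_countable_basis by blast
  define \<U> where "\<U> = Union ` {F. finite F \<and> F \<subseteq> B}"
  have \<U>: "countable \<U>" unfolding \<U>_def using countable_Collect_finite_subset[OF B(1)] by (intro countable_image) (simp add: conj_commute)
  have \<U>_open: "open U" if "U \<in> \<U>" for U
    using that B(2) by (auto simp: \<U>_def intro!: open_Union dest: topological_basis_open)
  \<comment> \<open>Finite lists of pairs form a countable set, and appending two lists adds their
    functions, which gives closure under sums.\<close>
  define fn :: "('d set \<times> 'y) list \<Rightarrow> 'd \<Rightarrow> 'y" where "fn xs t = (\<Sum>(U, y)\<leftarrow>xs. indicator U t *\<^sub>R y)" for xs t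
  have fn_append: "fn (xs @ ys) t = fn xs t + fn ys t" for xs ys t by (simp add: fn_def)
  have fn_limit: "simple_limit borel (fn xs)" if "xs \<in> lists (\<U> \<times> D)" for xs
    using that
  proof (induction xs)
    case Nil
    then show ?case by (simp add: fn_def simple_limit_const)
  next
    case (Cons p xs)
    obtain U y where p: "p = (U, y)" "U \<in> \<U>" using Cons.hyps by auto
    have "(\<lambda>t. indicator U t *\<^sub>R y + fn xs t) = fn (p # xs)" by (simp add: fn_def p fun_eq_iff)
    moreover have "simple_limit borel (\<lambda>t. indicator U t *\<^sub>R y + fn xs t)"
      using \<U>_open[OF p(2)] Cons.IH
      by (intro simple_limit_add simple_limit_scaleR simple_limit_const) (auto simp: simple_limit_real)
    ultimately show ?case by simp
  qed
  define \<F> where "\<F> = fn ` lists (\<U> \<times> D) \<inter> {f. sq_integrable f}"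
  have \<F>: "countable \<F>" unfolding \<F>_def using \<U> D(1) by (intro countable_Int1 countable_image countable_lists) auto
  have fn_Nil: "fn [] = (\<lambda>_. 0)" by (simp add: fn_def fun_eq_iff)
  have "sq_integrable (fn [])" by (simp add: fn_Nil sq_integrable_def simple_limit_const)
  then have "fn [] \<in> \<F>" unfolding \<F>_def by (intro IntI imageI) auto
  then have ne: "\<F> \<noteq> {}" by blast
  \<comment> \<open>The functions in the closure of the family. Closure under sums reduces simple
    functions to single indicators times a vector of D.\<close>
  define ap where "ap f \<longleftrightarrow> sq_integrable f \<and> (\<forall>\<epsilon>>0. \<exists>h\<in>\<F>. L2_norm (\<lambda>t. h t - f t) < \<epsilon>)" for f
  have ap_add: "ap (\<lambda>t. f t + f' t)" if apf: "ap f" "ap f'" for f f'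
    unfolding ap_def
  proof (intro conjI allI impI)
    have sq: "sq_integrable f" "sq_integrable f'" using apf by (auto simp: ap_def)
    then show "sq_integrable (\<lambda>t. f t + f' t)" by (rule sq_integrable_add)
    fix \<epsilon> :: real assume "0 < \<epsilon>"
    then have "0 < \<epsilon> / 2" by simp
    then obtain h h' where h: "h \<in> \<F>" "L2_norm (\<lambda>t. h t - f t) < \<epsilon> / 2" "h' \<in> \<F>" "L2_norm (\<lambda>t. h' t - f' t) < \<epsilon> / 2"
      using apf unfolding ap_def by blast
    then obtain xs ys where xs: "xs \<in> lists (\<U> \<times> D)" "h = fn xs" "ys \<in> lists (\<U> \<times> D)" "h' = fn ys" by (auto simp: \<F>_def)
    have sqh: "sq_integrable h" "sq_integrable h'" using h by (auto simp: \<F>_def)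
    have eq: "fn (xs @ ys) = (\<lambda>t. h t + h' t)" using fn_append xs by (simp add: fun_eq_iff)
    have mem: "xs @ ys \<in> lists (\<U> \<times> D)" using xs by auto
    have "fn (xs @ ys) \<in> \<F>"
    proof -
      have "sq_integrable (fn (xs @ ys))" unfolding eq by (rule sq_integrable_add[OF sqh])
      then show ?thesis unfolding \<F>_def using mem by blast
    qed
    moreover have "L2_norm (\<lambda>t. fn (xs @ ys) t - (f t + f' t)) < \<epsilon>"
    proof -
      have "L2_norm (\<lambda>t. fn (xs @ ys) t - (f t + f' t)) = L2_norm (\<lambda>t. (h t - f t) + (h' t - f' t))"
        unfolding eq by (simp add: algebra_simps)
      also have "\<dots> \<le> L2_norm (\<lambda>t. h t - f t) + L2_norm (\<lambda>t. h' t - f' t)"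
        by (intro L2_norm_triangle sq_integrable_diff sqh sq)
      finally show ?thesis using h by linarith
    qed
    ultimately show "\<exists>h\<in>\<F>. L2_norm (\<lambda>t. h t - (f t + f' t)) < \<epsilon>" by blast
  qed
  have ap_zero: "ap (\<lambda>_. 0)"
    unfolding ap_def
  proof (intro conjI allI impI)
    show "sq_integrable (\<lambda>_::'d. 0::'y)" by (simp add: sq_integrable_def simple_limit_const)
    show "\<exists>h\<in>\<F>. L2_norm (\<lambda>t. h t - 0) < \<epsilon>" if "0 < \<epsilon>" for \<epsilon> :: real
      using \<open>fn [] \<in> \<F>\<close> that by (intro bexI[of _ "fn []"]) (simp_all add: fn_def L2_norm_def)
  qed
  have ap_ind: "ap (\<lambda>t. indicator A t *\<^sub>R y)" if A: "A \<in> lmeasurable" and y: "y \<in> D" for A y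
    unfolding ap_def
  proof (intro conjI allI impI)
    have sq: "sq_integrable (\<lambda>t. indicator A t *\<^sub>R y)" if "A \<in> lmeasurable" for A :: "'d set"
    proof (rule sq_integrable_scaleR_L2)
      have "(\<lambda>t. (indicator A t :: real)\<^sup>2) = indicator A" by (auto simp: fun_eq_iff indicator_def)
      then show "indicator A \<in> (L2 :: ('d \<Rightarrow> real) set)"
        using that by (auto simp: L2_def fmeasurable_def intro!: integrable_real_indicator)
    qed
    show "sq_integrable (\<lambda>t. indicator A t *\<^sub>R y)" by (rule sq[OF A])
    fix \<epsilon> :: real assume \<epsilon>: "0 < \<epsilon>"
    define c where "c = (norm y)\<^sup>2"
    have c: "0 \<le> c" by (simp add: c_def)
    \<comment> \<open>The squared error is at most 2 c e = \<epsilon>^2 c / (c + 1) < \<epsilon>^2.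
      The added 1 also covers y = 0.\<close>
    define e where "e = \<epsilon>\<^sup>2 / (2 * (c + 1))"
    have e: "0 < e" using \<epsilon> c by (simp add: e_def add_nonneg_pos)
    obtain F where F: "finite F" "F \<subseteq> B" "\<Union>F \<in> lmeasurable" "measure lebesgue (\<Union>F - A) < e" "measure lebesgue (A - \<Union>F) < e"
      by (rule indicator_finite_union_approx[OF B(2,1) A e]) (rule that)
    define U where "U = \<Union>F"
    have Um: "U \<in> lmeasurable" and "U \<in> \<U>" using F by (auto simp: U_def \<U>_def)
    have fnU: "fn [(U, y)] = (\<lambda>t. indicator U t *\<^sub>R y)" by (simp add: fn_def fun_eq_iff)
    have "fn [(U, y)] \<in> \<F>"
    proof -
      have "[(U, y)] \<in> lists (\<U> \<times> D)" using \<open>U \<in> \<U>\<close> y by simp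
      moreover have "sq_integrable (fn [(U, y)])" unfolding fnU by (rule sq[OF Um])
      ultimately show ?thesis unfolding \<F>_def by blast
    qed
    moreover have "L2_norm (\<lambda>t. fn [(U, y)] t - indicator A t *\<^sub>R y) < \<epsilon>"
    proof -
      have dm: "U - A \<in> lmeasurable" "A - U \<in> lmeasurable"
        using Um A by (auto intro: fmeasurable_Diff fmeasurableD)
      have "(norm (fn [(U, y)] t - indicator A t *\<^sub>R y))\<^sup>2 = c * (indicator (U - A) t + indicator (A - U) t)" for t
        by (auto simp: fnU c_def indicator_def)
      then have "(LINT t|lebesgue. (norm (fn [(U, y)] t - indicator A t *\<^sub>R y))\<^sup>2) =
          (LINT t|lebesgue. c * (indicator (U - A) t + indicator (A - U) t))" by simp
      also have "\<dots> = c * (measure lebesgue (U - A) + measure lebesgue (A - U))"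
        using dm[unfolded lmeasurable_iff_integrable] by simp
      also have "\<dots> \<le> c * (2 * e)" using F(4,5) c unfolding U_def by (intro mult_left_mono) auto
      also have "\<dots> = c / (c + 1) * \<epsilon>\<^sup>2" using c by (simp add: e_def field_simps)
      also have "\<dots> < 1 * \<epsilon>\<^sup>2" using c \<epsilon> by (intro mult_strict_right_mono) (auto simp: field_simps)
      finally have "L2_norm (\<lambda>t. fn [(U, y)] t - indicator A t *\<^sub>R y) < sqrt (\<epsilon>\<^sup>2)"
        unfolding L2_norm_def by (intro real_sqrt_less_mono) simp
      then show ?thesis using \<epsilon> by simp
    qed
    ultimately show "\<exists>h\<in>\<F>. L2_norm (\<lambda>t. h t - indicator A t *\<^sub>R y) < \<epsilon>" by blast
  qed
  have ap_simple: "ap h" if h: "simple_function lebesgue h" "sq_integrable h" "\<And>t. h t \<in> D" for h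
  proof -
    define I where "I = range h - {0}"
    have I: "finite I" using h(1) by (simp add: I_def simple_function_def)
    have lm: "h -` {y} \<in> lmeasurable" if y: "y \<in> I" for y
    proof -
      have s: "h -` {y} \<in> sets lebesgue" using h(1) y by (auto simp: simple_function_def I_def)
      have "y \<noteq> 0" using y by (simp add: I_def)
      have "integrable lebesgue (\<lambda>t. (norm (h t))\<^sup>2 / (norm y)\<^sup>2)" using h(2) by (simp add: sq_integrable_def)
      then have "integrable lebesgue (indicator (h -` {y}) :: 'd \<Rightarrow> real)"
      proof (rule Bochner_Integration.integrable_bound)
        show "AE t in lebesgue. norm (indicator (h -` {y}) t :: real) \<le> norm ((norm (h t))\<^sup>2 / (norm y)\<^sup>2)"
          using \<open>y \<noteq> 0\<close> by (intro AE_I2) (auto split: split_indicator)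
      qed (use s in measurable)
      then show ?thesis using s by (simp add: fmeasurable_def integrable_indicator_iff)
    qed
    have sub: "ap (\<lambda>t. \<Sum>y\<in>J. indicator (h -` {y}) t *\<^sub>R y)" if "J \<subseteq> I" for J
      using finite_subset[OF that I] that
    proof (induction J rule: finite_induct)
      case (insert y J)
      have "y \<in> D" using insert.prems h(3) by (auto simp: I_def)
      then have "ap (\<lambda>t. indicator (h -` {y}) t *\<^sub>R y)" using insert.prems by (intro ap_ind lm) auto
      moreover have "ap (\<lambda>t. \<Sum>z\<in>J. indicator (h -` {z}) t *\<^sub>R z)" using insert by blast
      ultimately have "ap (\<lambda>t. indicator (h -` {y}) t *\<^sub>R y + (\<Sum>z\<in>J. indicator (h -` {z}) t *\<^sub>R z))"
        by (rule ap_add)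
      then show ?case by (simp only: sum.insert[OF insert.hyps(1,2)])
    qed (simp add: ap_zero)
    have "(\<lambda>t. \<Sum>y\<in>I. indicator (h -` {y}) t *\<^sub>R y) = h"
    proof
      fix t
      have "(\<Sum>y\<in>I. indicator (h -` {y}) t *\<^sub>R y) = (\<Sum>y\<in>I. if y = h t then y else 0)"
        by (intro sum.cong) (auto simp: indicator_def)
      also have "\<dots> = h t" using I by (auto simp: I_def)
      finally show "(\<Sum>y\<in>I. indicator (h -` {y}) t *\<^sub>R y) = h t" .
    qed
    with sub[OF order_refl] show ?thesis by (simp only:)
  qed
  have dense: "\<exists>h\<in>\<F>. L2_norm (\<lambda>t. h t - f t) < \<epsilon>"
    if f: "sq_integrable f" "range f \<subseteq> closure D" and \<epsilon>: "0 < \<epsilon>" for f \<epsilon>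
  proof -
    obtain h where h: "\<And>n::nat. simple_function lebesgue (h n)" "\<And>n. sq_integrable (h n)" "\<And>n t. h n t \<in> D"
      "(\<lambda>n. L2_norm (\<lambda>t. h n t - f t)) \<longlonglongrightarrow> 0"
      by (rule sq_integrable_simple_approx[OF f(1) D f(2)]) (rule that)
    have "0 < \<epsilon> / 2" using \<epsilon> by simp
    then have "\<forall>\<^sub>F n in sequentially. L2_norm (\<lambda>t. h n t - f t) < \<epsilon> / 2" by (rule order_tendstoD(2)[OF h(4)])
    then obtain n where n: "L2_norm (\<lambda>t. h n t - f t) < \<epsilon> / 2" by (auto simp: eventually_sequentially)
    obtain g where g: "g \<in> \<F>" "L2_norm (\<lambda>t. g t - h n t) < \<epsilon> / 2"
      using ap_simple[OF h(1,2,3)] \<open>0 < \<epsilon> / 2\<close> unfolding ap_def by blast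
    have "sq_integrable g" using g(1) by (simp add: \<F>_def)
    from L2_norm_triangle3[OF this h(2) f(1), of n] have "L2_norm (\<lambda>t. g t - f t) < \<epsilon>" using n g(2) by linarith
    then show ?thesis using g(1) by blast
  qed
  define g where "g = from_nat_into \<F>"
  have g: "g i \<in> \<F>" for i unfolding g_def using ne by (rule from_nat_into)
  have surj: "\<exists>i. g i = h" if "h \<in> \<F>" for h
    unfolding g_def using from_nat_into_surj[OF \<F> that] by blast
  show ?thesis
  proof (rule that[of g])
    show "simple_limit borel (g i)" "sq_integrable (g i)" for i
    proof -
      obtain xs where "xs \<in> lists (\<U> \<times> D)" "g i = fn xs" using g[of i] unfolding \<F>_def by blast
      then show "simple_limit borel (g i)" using fn_limit[of xs] by simp
      show "sq_integrable (g i)" using g[of i] by (simp add: \<F>_def)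
    qed
    show "\<exists>i. L2_norm (\<lambda>t. g i t - f t) < \<epsilon>" if "sq_integrable f" "range f \<subseteq> closure D" "0 < \<epsilon>" for f \<epsilon>
      using dense[OF that] surj by metis
  qed
qed

section \<open>From jointly measurable kernels to strongly measurable \<gamma>-valued
  functions\<close>

lemma sq_integrable_borelI:
  fixes f :: "'d::euclidean_space \<Rightarrow> 'y::real_normed_vector"
  assumes f: "simple_limit borel f" and fin: "(\<integral>\<^sup>+ t. ennreal ((norm (f t))\<^sup>2) \<partial>lborel) < \<top>"
  shows "sq_integrable f"
proof -
  have s: "simple_limit lebesgue f" using f simple_limit_completion by (simp add: simple_limit_lborel_iff)
  have [measurable]: "(\<lambda>t. norm (f t)) \<in> borel_measurable lebesgue" by (rule simple_limit_norm_measurable[OF s])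
  have "integrable lebesgue (\<lambda>t. (norm (f t))\<^sup>2)"
    by (rule integrableI_nonneg) (use fin in \<open>auto simp: nn_integral_completion\<close>)
  then show ?thesis using s by (simp add: sq_integrable_def)
qed

lemma sq_integrable_nn_integral:
  assumes "sq_integrable f"
  shows "(\<integral>\<^sup>+ t. ennreal ((norm (f t))\<^sup>2) \<partial>lborel) = ennreal ((L2_norm f)\<^sup>2)"
proof -
  have "(\<integral>\<^sup>+ t. ennreal ((norm (f t))\<^sup>2) \<partial>lborel) = (\<integral>\<^sup>+ t. ennreal ((norm (f t))\<^sup>2) \<partial>lebesgue)"
    by (simp add: nn_integral_completion)
  also have "\<dots> = ennreal (LINT t|lebesgue. (norm (f t))\<^sup>2)"
    using assms by (intro nn_integral_eq_integral) (auto simp: sq_integrable_def)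
  finally show ?thesis by (simp add: L2_norm_square)
qed

text \<open>At stage n the operator of the nearest of the first functions in a dense sequence is
  chosen, so finitely many operators occur. Nearness is measured on the representing functions,
  where it is a measurable function of s, and equals the \<gamma>-distance almost
  everywhere.\<close>

lemma gamma_strongly_measurableI:
  fixes \<Phi> :: "'d::euclidean_space \<Rightarrow> 'd \<Rightarrow> 'y::{real_inner, banach}"
  assumes \<Phi>: "simple_limit (borel \<Otimes>\<^sub>M borel) (\<lambda>z. \<Phi> (fst z) (snd z))"
    and F: "AE s in lborel. sq_integrable (\<Phi> s) \<and> represents (\<Phi> s) (F s)"
  shows "gamma_strongly_measurable F"
proof -
  obtain D0 where D0: "countable D0" "range (\<lambda>z. \<Phi> (fst z) (snd z)) \<subseteq> closure D0"
    by (rule simple_limit_separable[OF \<Phi>]) (auto simp: space_pair_measure)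
  define D where "D = insert 0 D0"
  have D: "countable D" "0 \<in> D" using D0(1) by (auto simp: D_def)
  have rD: "range (\<Phi> s) \<subseteq> closure D" for s
    using D0(2) closure_mono[of D0 D] by (auto simp: D_def image_subset_iff)
  obtain g :: "nat \<Rightarrow> 'd \<Rightarrow> 'y" where g: "\<And>i. simple_limit borel (g i)" "\<And>i. sq_integrable (g i)"
    "\<And>f \<epsilon>. sq_integrable f \<Longrightarrow> range f \<subseteq> closure D \<Longrightarrow> 0 < \<epsilon> \<Longrightarrow> \<exists>i. L2_norm (\<lambda>t. g i t - f t) < \<epsilon>"
    by (rule L2_countable_dense[OF D]) (rule that)
  have "\<exists>T. represents (g i) T" for i
    by (rule gamma_representation_exists[OF g(2)[of i]]) blast
  then obtain T where T: "\<And>i. represents (g i) (T i)" by metis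
  have Tgs: "T i \<in> gamma_space" for i by (rule gamma_norm_represents(1)[OF g(2) T])
  \<comment> \<open>An extended-valued integral, so measurability in s holds without excluding the s
    for which \<open>\<Phi> s\<close> is not square integrable.\<close>
  define \<rho> where "\<rho> i s = (\<integral>\<^sup>+ t. ennreal ((norm (g i t - \<Phi> s t))\<^sup>2) \<partial>lborel)" for i s
  have \<rho>_meas: "\<rho> i \<in> borel_measurable lborel" for i
  proof -
    have "simple_limit (borel \<Otimes>\<^sub>M borel) (\<lambda>z. g i (snd z) - \<Phi> (fst z) (snd z))"
      by (intro simple_limit_diff \<Phi> simple_limit_compose[OF g(1)]) measurable
    from simple_limit_norm_measurable[OF this]
    have "(\<lambda>z. norm (g i (snd z) - \<Phi> (fst z) (snd z))) \<in> borel_measurable (borel \<Otimes>\<^sub>M borel)" .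
    then have "(\<lambda>(s, t). ennreal ((norm (g i t - \<Phi> s t))\<^sup>2)) \<in> borel_measurable (borel \<Otimes>\<^sub>M lborel)"
      by (simp add: case_prod_beta cong: measurable_cong_sets)
    from lborel.borel_measurable_nn_integral[OF this] show ?thesis
      unfolding \<rho>_def by simp
  qed
  obtain idx :: "nat \<Rightarrow> 'd \<Rightarrow> nat" where idx: "\<And>n. simple_function lborel (idx n)" "\<And>n s. idx n s \<le> n"
    "\<And>n j s. j \<le> n \<Longrightarrow> \<rho> (idx n s) s \<le> \<rho> j s"
    by (rule simple_argmin[of \<rho> lborel, OF \<rho>_meas]) (rule that)
  have "simple_function lebesgue (\<lambda>s. T (idx n s))" for n
    by (rule simple_function_completion[OF simple_function_compose1[OF idx(1)]])
  moreover have "AE s in lborel. (\<lambda>n. gamma_norm (\<lambda>\<phi>. T (idx n s) \<phi> - F s \<phi>)) \<longlonglongrightarrow> 0"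
    using F
  proof eventually_elim
    case (elim s)
    then have sq: "sq_integrable (\<Phi> s)" and rep: "represents (\<Phi> s) (F s)" by auto
    have sqd: "sq_integrable (\<lambda>t. g i t - \<Phi> s t)" for i by (rule sq_integrable_diff[OF g(2) sq])
    have gn: "gamma_norm (\<lambda>\<phi>. T i \<phi> - F s \<phi>) = L2_norm (\<lambda>t. g i t - \<Phi> s t)" for i
      by (rule gamma_norm_represents(2)[OF sqd represents_diff[OF T rep sq_integrable_strongly_measurable[OF sqd]]])
    have \<rho>_eq: "\<rho> i s = ennreal ((L2_norm (\<lambda>t. g i t - \<Phi> s t))\<^sup>2)" for i
      unfolding \<rho>_def by (rule sq_integrable_nn_integral[OF sqd])
    show ?case
    proof (rule LIMSEQ_I)
      fix e :: real assume "0 < e"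
      then obtain j where j: "L2_norm (\<lambda>t. g j t - \<Phi> s t) < e" using g(3)[OF sq rD] by blast
      have "norm (gamma_norm (\<lambda>\<phi>. T (idx n s) \<phi> - F s \<phi>) - 0) < e" if "j \<le> n" for n
      proof -
        have "(L2_norm (\<lambda>t. g (idx n s) t - \<Phi> s t))\<^sup>2 \<le> (L2_norm (\<lambda>t. g j t - \<Phi> s t))\<^sup>2"
          using idx(3)[OF that, of s] unfolding \<rho>_eq by simp
        then have "L2_norm (\<lambda>t. g (idx n s) t - \<Phi> s t) \<le> L2_norm (\<lambda>t. g j t - \<Phi> s t)"
          by (rule power2_le_imp_le) (rule L2_norm_nonneg)
        then show ?thesis using j unfolding gn by (simp add: L2_norm_nonneg)
      qed
      then show "\<exists>N. \<forall>n\<ge>N. norm (gamma_norm (\<lambda>\<phi>. T (idx n s) \<phi> - F s \<phi>) - 0) < e" by blast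
    qed
  qed
  ultimately show ?thesis
    unfolding gamma_strongly_measurable_def using Tgs
    by (intro exI[of _ "\<lambda>n s. T (idx n s)"]) (simp add: AE_completion_iff)
qed

section \<open>Powers of extended nonnegative reals\<close>

lemma ennreal_rpow_mono: "x \<le> y \<Longrightarrow> 0 < a \<Longrightarrow> ennreal_rpow x a \<le> ennreal_rpow y a"
  by (auto simp: ennreal_rpow_def top_unique less_top[symmetric] intro!: ennreal_leI powr_mono2 enn2real_mono)

lemma ennreal_rpow_ennreal: "0 \<le> x \<Longrightarrow> ennreal_rpow (ennreal x) a = ennreal (x powr a)"
  by (simp add: ennreal_rpow_def)

lemma ennreal_rpow_inverse': "0 < a \<Longrightarrow> ennreal_rpow (ennreal_rpow x (1 / a)) a = x"
  by (cases x) (auto simp: ennreal_rpow_def powr_powr)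

lemma ennreal_rpow_mult:
  assumes "0 < a" "0 \<le> c"
  shows "ennreal_rpow (ennreal c * x) a = ennreal (c powr a) * ennreal_rpow x a"
proof (cases x)
  case (real r)
  then show ?thesis using assms by (simp add: ennreal_mult[symmetric] ennreal_rpow_ennreal powr_mult)
next
  case top
  show ?thesis
  proof (cases "c = 0")
    case True
    then show ?thesis using top by (simp add: ennreal_rpow_def)
  next
    case False
    then show ?thesis using assms top by (simp add: ennreal_rpow_def ennreal_mult_top)
  qed
qed

subsection \<open>From the Hoermander conditions to the scalar kernel\<close>

text \<open>The operator norm below need not be measurable, hence the measurable minorants \<open>\<psi>\<close>: translations
  and reflections can be applied to them.\<close>

definition hormander_bound :: "('d::euclidean_space \<Rightarrow> 'x::banach \<Rightarrow>\<^sub>L 'y::banach) \<Rightarrow> real \<Rightarrow> bool"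
  where "hormander_bound k H \<longleftrightarrow> 0 \<le> H \<and> (\<forall>s s' r. \<forall>\<psi>\<in>borel_measurable borel. 2 * dist s s' < r \<longrightarrow>
    (AE t in lborel. r \<le> dist t s' \<longrightarrow> \<psi> t \<le> ennreal ((norm (k (s - t) - k (s' - t)))\<^sup>2)) \<longrightarrow>
    (\<integral>\<^sup>+ t\<in>{t. r \<le> dist t s'}. \<psi> t \<partial>lborel) \<le> ennreal (H\<^sup>2))"

lemma Lp_norm_on_2_le:
  assumes "Lp_norm_on A 2 f \<le> ennreal C" "0 \<le> C"
  shows "(\<integral>\<^sup>+ t\<in>A. ennreal ((norm (f t))\<^sup>2) \<partial>lebesgue) \<le> ennreal (C\<^sup>2)"
proof -
  have "(\<integral>\<^sup>+ t\<in>A. ennreal ((norm (f t))\<^sup>2) \<partial>lebesgue) = ennreal_rpow (Lp_norm_on A 2 f) 2"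
    unfolding Lp_norm_on_def by (subst ennreal_rpow_inverse') (simp_all add: powr_numeral)
  also have "\<dots> \<le> ennreal_rpow (ennreal C) 2" using assms(1) by (rule ennreal_rpow_mono) simp
  also have "\<dots> = ennreal (C\<^sup>2)" using assms(2) by (simp add: ennreal_rpow_ennreal powr_numeral)
  finally show ?thesis .
qed

lemma lborel_distr_reflect:
  fixes c :: "'d::euclidean_space"
  shows "distr lborel borel (\<lambda>y. c - y) = lborel"
proof -
  have "(lborel :: 'd measure) = density (distr lborel borel (\<lambda>y. c + (- 1) *\<^sub>R y)) (\<lambda>_. ennreal (\<bar>- 1\<bar> ^ DIM('d)))"
    by (rule lborel_affine) simp
  then show ?thesis by (simp add: density_1)
qed

lemma nn_integral_lborel_reflect:
  fixes c :: "'d::euclidean_space"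
  assumes [measurable]: "f \<in> borel_measurable borel"
  shows "(\<integral>\<^sup>+ y. f (c - y) \<partial>lborel) = (\<integral>\<^sup>+ y. f y \<partial>lborel)"
  by (subst (2) lborel_distr_reflect[of c, symmetric], subst nn_integral_distr) auto

lemma AE_lborel_reflect:
  fixes c :: "'d::euclidean_space"
  assumes "AE t in lborel. P t"
  shows "AE t in lborel. P (c - t)"
proof -
  have "AE t in distr lborel borel (\<lambda>y. c - y). P t" unfolding lborel_distr_reflect by (rule assms)
  moreover have "(\<lambda>y. c - y) \<in> measurable lborel (borel :: 'd measure)" by measurable
  ultimately show ?thesis by (rule AE_distrD[rotated])
qed

text \<open>The substitution y = s' - t turns the difference into k(y - v) - k(y) with v = s' - s.
  The distance from t to s' becomes |y|, and 2 |v| < r \<le> |y| puts y into the region of the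
  displayed condition.\<close>

lemma hormander_bound_conv:
  fixes k :: "'d::euclidean_space \<Rightarrow> 'x::banach \<Rightarrow>\<^sub>L 'y::banach"
  assumes "Hormander2_conv k"
  obtains H where "hormander_bound k H"
proof -
  obtain C where C: "0 \<le> C"
    "\<And>t. Lp_norm_on {s. norm t \<le> norm s / 2} 2 (\<lambda>s. k (s - t) - k s) \<le> ennreal C"
    using assms unfolding Hormander2_conv_def by blast
  have "hormander_bound k C"
    unfolding hormander_bound_def
  proof (intro conjI C(1) allI ballI impI)
    fix s s' :: 'd and r :: real and \<psi> :: "'d \<Rightarrow> ennreal"
    assume [measurable]: "\<psi> \<in> borel_measurable borel" and r: "2 * dist s s' < r"
      and ae: "AE t in lborel. r \<le> dist t s' \<longrightarrow> \<psi> t \<le> ennreal ((norm (k (s - t) - k (s' - t)))\<^sup>2)"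
    let ?v = "s' - s"
    have "(\<integral>\<^sup>+ t\<in>{t. r \<le> dist t s'}. \<psi> t \<partial>lborel) = (\<integral>\<^sup>+ y. \<psi> (s' - y) * indicator {t. r \<le> dist t s'} (s' - y) \<partial>lborel)"
      by (rule nn_integral_lborel_reflect[symmetric]) measurable
    also have "\<dots> \<le> (\<integral>\<^sup>+ y\<in>{y. norm ?v \<le> norm y / 2}. ennreal ((norm (k (y - ?v) - k y))\<^sup>2) \<partial>lborel)"
    proof (rule nn_integral_mono_AE)
      have "AE y in lborel. r \<le> dist (s' - y) s' \<longrightarrow> \<psi> (s' - y) \<le> ennreal ((norm (k (s - (s' - y)) - k (s' - (s' - y))))\<^sup>2)"
        by (rule AE_lborel_reflect[OF ae])
      then show "AE y in lborel. \<psi> (s' - y) * indicator {t. r \<le> dist t s'} (s' - y) \<le>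
          ennreal ((norm (k (y - ?v) - k y))\<^sup>2) * indicator {y. norm ?v \<le> norm y / 2} y"
      proof eventually_elim
        case (elim y)
        have "norm ?v \<le> norm y / 2" if "r \<le> norm y"
          using r that by (simp add: dist_norm norm_minus_commute)
        moreover have eq: "s - (s' - y) = y - ?v" "s' - (s' - y) = y" by simp_all
        have "r \<le> norm y \<longrightarrow> \<psi> (s' - y) \<le> ennreal ((norm (k (y - ?v) - k y))\<^sup>2)"
          using elim unfolding eq by (simp add: dist_norm)
        ultimately show ?case by (auto simp: dist_norm split: split_indicator)
      qed
    qed
    also have "\<dots> \<le> ennreal (C\<^sup>2)"
      using Lp_norm_on_2_le[OF C(2) C(1)] by (simp add: nn_integral_completion)
    finally show "(\<integral>\<^sup>+ t\<in>{t. r \<le> dist t s'}. \<psi> t \<partial>lborel) \<le> ennreal (C\<^sup>2)" .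
  qed
  then show ?thesis by (rule that)
qed

text \<open>The ball of radius r about s' contains s and s' in its half, because 2 |s - s'| < r. The
  integral outside it is below every admissible constant, hence below their infimum.\<close>

lemma hormander_bound_kernel:
  fixes k :: "'d::euclidean_space \<Rightarrow> 'x::banach \<Rightarrow>\<^sub>L 'y::banach"
  assumes "Hormander2_norm (\<lambda>s t. k (s - t)) = ennreal H" "0 \<le> H"
  shows "hormander_bound k H"
  unfolding hormander_bound_def
proof (intro conjI assms(2) allI ballI impI)
  fix s s' :: 'd and r :: real and \<psi> :: "'d \<Rightarrow> ennreal"
  assume "\<psi> \<in> borel_measurable borel" and r: "2 * dist s s' < r"
    and ae: "AE t in lborel. r \<le> dist t s' \<longrightarrow> \<psi> t \<le> ennreal ((norm (k (s - t) - k (s' - t)))\<^sup>2)"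
  have r0: "0 < r" using r zero_le_dist[of s s'] by linarith
  have "s \<in> ball s' (r / 2)" "s' \<in> ball s' (r / 2)" using r r0 by (auto simp: dist_commute)
  then have "Lp_norm_on (- ball s' r) 2 (\<lambda>t. k (s - t) - k (s' - t)) \<le> Hormander2_norm (\<lambda>s t. k (s - t))"
    unfolding Hormander2_norm_def using r0 by (intro Inf_greatest) blast
  then have le: "Lp_norm_on (- ball s' r) 2 (\<lambda>t. k (s - t) - k (s' - t)) \<le> ennreal H" using assms(1) by simp
  have "(\<integral>\<^sup>+ t\<in>{t. r \<le> dist t s'}. \<psi> t \<partial>lborel) \<le>
      (\<integral>\<^sup>+ t\<in>- ball s' r. ennreal ((norm (k (s - t) - k (s' - t)))\<^sup>2) \<partial>lborel)"
  proof (rule nn_integral_mono_AE)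
    show "AE t in lborel. \<psi> t * indicator {t. r \<le> dist t s'} t \<le>
        ennreal ((norm (k (s - t) - k (s' - t)))\<^sup>2) * indicator (- ball s' r) t"
      using ae by eventually_elim (auto simp: dist_commute split: split_indicator)
  qed
  also have "\<dots> \<le> ennreal (H\<^sup>2)"
    using Lp_norm_on_2_le[OF le assms(2)] by (simp add: nn_integral_completion)
  finally show "(\<integral>\<^sup>+ t\<in>{t. r \<le> dist t s'}. \<psi> t \<partial>lborel) \<le> ennreal (H\<^sup>2)" .
qed

lemma nn_integral_lborel_shift:
  fixes c :: "'d::euclidean_space"
  assumes [measurable]: "f \<in> borel_measurable borel"
  shows "(\<integral>\<^sup>+ y. f (y - c) \<partial>lborel) = (\<integral>\<^sup>+ y. f y \<partial>lborel)"
  using nn_integral_lborel_reflect[of "\<lambda>z. f (- z)" c] nn_integral_lborel_reflect[of f 0] by simp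

lemma AE_shifted_null:
  fixes N :: "'d::euclidean_space set"
  assumes "N \<in> null_sets lborel"
  shows "AE t in lborel. s - t \<notin> N"
  by (rule AE_lborel_reflect) (rule AE_not_in[OF assms])

lemma hormander_boundD:
  assumes "hormander_bound k H" "\<psi> \<in> borel_measurable borel" "2 * dist s s' < r"
    "AE t in lborel. r \<le> dist t s' \<longrightarrow> \<psi> t \<le> ennreal ((norm (k (s - t) - k (s' - t)))\<^sup>2)"
  shows "(\<integral>\<^sup>+ t\<in>{t. r \<le> dist t s'}. \<psi> t \<partial>lborel) \<le> ennreal (H\<^sup>2)"
  using assms unfolding hormander_bound_def by blast

lemma T_bounded_by_of_hormander:
  fixes k :: "'d::euclidean_space \<Rightarrow> 'x::banach \<Rightarrow>\<^sub>L 'y::{real_inner, banach}"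
  assumes meas: "\<And>x. strongly_measurable (\<lambda>t. blinfun_apply (k t) x)" and H: "hormander_bound k H"
    and A: "0 < A" "\<And>x. Lp_norm 2 (\<lambda>t. blinfun_apply (k t) x) \<le> ennreal (A * norm x)" and p: "2 \<le> p"
  shows "T_bounded_by (Lp_norm p) p (\<lambda>s t. k (s - t))
    (sqrt (p * (4 * (12 * real DIM('d)) ^ DIM('d) * A\<^sup>2 + 4 * H\<^sup>2)))"
proof -
  define L where "L = p * (4 * (12 * real DIM('d)) ^ DIM('d) * A\<^sup>2 + 4 * H\<^sup>2)"
  have L: "0 \<le> L" using p by (simp add: L_def)
  have "\<exists>F. is_T (\<lambda>s t. k (s - t)) f F \<and> gamma_strongly_measurable F \<and>
      Lp_norm p (\<lambda>s. gamma_norm (F s)) \<le> ennreal (sqrt L) * Lp_norm p f" if f: "f \<in> Lp_space p" for f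
  proof -
    have "strongly_measurable f" "Lp_norm p f < \<top>" using f by (auto simp: Lp_space_def)
    obtain f' where f': "simple_limit lborel f'" "AE t in lborel. f t = f' t"
      by (rule strongly_measurable_borel_version[OF \<open>strongly_measurable f\<close>]) (rule that)
    have nf': "(\<lambda>t. norm (f' t)) \<in> borel_measurable borel"
      using simple_limit_norm_measurable[OF f'(1)] by simp
    note [measurable] = nf'
    \<comment> \<open>As the inverse of 0 is 0, \<sigma> vanishes where f' does, and f' = |f'|
      \<sigma> holds everywhere.\<close>
    define \<sigma> where "\<sigma> t = inverse (norm (f' t)) *\<^sub>R f' t" for t
    have \<sigma>_lim: "simple_limit lborel \<sigma>" unfolding \<sigma>_def
      by (rule simple_limit_scaleR[OF _ f'(1)]) (simp add: simple_limit_real)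
    have \<sigma>_le: "norm (\<sigma> t) \<le> 1" for t by (cases "f' t = 0") (simp_all add: \<sigma>_def)
    have \<sigma>_f': "norm (f' t) *\<^sub>R \<sigma> t = f' t" for t by (cases "f' t = 0") (simp_all add: \<sigma>_def)
    obtain N where N: "N \<in> null_sets (lborel :: 'd measure)" and
      J: "simple_limit (borel \<Otimes>\<^sub>M borel)
        (\<lambda>z. blinfun_apply (if fst z - snd z \<in> N then 0 else k (fst z - snd z)) (\<sigma> (snd z)))"
      by (rule kernel_borel_version[OF meas \<sigma>_lim]) (rule that)
    define k' where "k' t = (if t \<in> N then 0 else k t)" for t
    define \<Psi> where "\<Psi> s t = blinfun_apply (k' (s - t)) (\<sigma> t)" for s t
    have \<Psi>: "simple_limit (borel \<Otimes>\<^sub>M borel) (\<lambda>z. \<Psi> (fst z) (snd z))"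
      using J unfolding \<Psi>_def k'_def .
    define u where "u s t = norm (\<Psi> s t)" for s t
    have u_meas: "case_prod u \<in> borel_measurable (borel \<Otimes>\<^sub>M borel)"
    proof -
      have "case_prod u = (\<lambda>z. norm (\<Psi> (fst z) (snd z)))" by (simp add: fun_eq_iff u_def)
      then show ?thesis using simple_limit_norm_measurable[OF \<Psi>] by (simp only:)
    qed
    interpret hormander_kernel u A H
    proof
      show "case_prod u \<in> borel_measurable (borel \<Otimes>\<^sub>M borel)" by (rule u_meas)
      show "0 < A" by (rule A(1))
      show "0 \<le> H" using H by (simp add: hormander_bound_def)
      show "(\<integral>\<^sup>+ s. ennreal ((u s t)\<^sup>2) \<partial>lborel) \<le> ennreal (A\<^sup>2)" for t
      proof -
        \<comment> \<open>Translating by t reduces the integral over s to the bound on k applied to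
          the fixed vector \<sigma> t.\<close>
        have "(\<lambda>s. u (s + t) t) \<in> borel_measurable borel"
          using measurable_compose[OF _ u_meas, of "\<lambda>s. (s + t, t)" borel] by simp
        then have m: "(\<lambda>s. norm (blinfun_apply (k' s) (\<sigma> t))) \<in> borel_measurable borel"
          by (simp add: u_def \<Psi>_def)
        have "(\<integral>\<^sup>+ s. ennreal ((u s t)\<^sup>2) \<partial>lborel) = (\<integral>\<^sup>+ s. ennreal ((norm (blinfun_apply (k' s) (\<sigma> t)))\<^sup>2) \<partial>lborel)"
          unfolding u_def \<Psi>_def
          by (rule nn_integral_lborel_shift[of "\<lambda>s. ennreal ((norm (blinfun_apply (k' s) (\<sigma> t)))\<^sup>2)"]) (use m in measurable)
        also have "\<dots> \<le> (\<integral>\<^sup>+ s\<in>UNIV. ennreal ((norm (blinfun_apply (k s) (\<sigma> t)))\<^sup>2) \<partial>lborel)"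
          by (intro nn_integral_mono) (auto simp: k'_def)
        also have "\<dots> \<le> ennreal ((A * norm (\<sigma> t))\<^sup>2)"
          using Lp_norm_on_2_le[OF A(2)[of "\<sigma> t"]] A(1) by (simp add: nn_integral_completion)
        also have "\<dots> \<le> ennreal (A\<^sup>2)"
          using A(1) \<sigma>_le[of t] by (intro ennreal_leI power_mono) (auto intro: mult_left_le)
        finally show ?thesis .
      qed
      show "(\<integral>\<^sup>+ t\<in>{t. r \<le> dist t s'}. ennreal ((u s t - u s' t)\<^sup>2) \<partial>lborel) \<le> ennreal (H\<^sup>2)"
        if r: "2 * dist s s' < r" for s s' r
      proof -
        have um: "(\<lambda>t. u s t) \<in> borel_measurable borel" for s
          using measurable_compose[OF _ u_meas, of "\<lambda>t. (s, t)" borel] by simp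
        have "(\<lambda>t. ennreal ((u s t - u s' t)\<^sup>2)) \<in> borel_measurable borel"
          using um[of s] um[of s'] by measurable
        moreover have "AE t in lborel. r \<le> dist t s' \<longrightarrow>
            ennreal ((u s t - u s' t)\<^sup>2) \<le> ennreal ((norm (k (s - t) - k (s' - t)))\<^sup>2)"
          using AE_shifted_null[OF N, of s] AE_shifted_null[OF N, of s']
        proof eventually_elim
          case (elim t)
          have "\<bar>u s t - u s' t\<bar> \<le> norm (\<Psi> s t - \<Psi> s' t)" unfolding u_def by (rule norm_triangle_ineq3)
          also have "\<Psi> s t - \<Psi> s' t = blinfun_apply (k (s - t) - k (s' - t)) (\<sigma> t)"
            using elim by (simp add: \<Psi>_def k'_def blinfun.diff_left)
          also have "norm \<dots> \<le> norm (k (s - t) - k (s' - t)) * norm (\<sigma> t)" by (rule norm_blinfun)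
          also have "\<dots> \<le> norm (k (s - t) - k (s' - t))" using \<sigma>_le[of t] by (intro mult_left_le) auto
          finally have "\<bar>u s t - u s' t\<bar>\<^sup>2 \<le> (norm (k (s - t) - k (s' - t)))\<^sup>2" by (rule power_mono) simp
          then show ?case by (intro impI ennreal_leI) simp
        qed
        ultimately show ?thesis by (rule hormander_boundD[OF H _ r])
      qed
    qed
    define \<Phi> where "\<Phi> s t = norm (f' t) *\<^sub>R \<Psi> s t" for s t
    have \<Phi>_eq: "\<Phi> s t = blinfun_apply (k' (s - t)) (f' t)" for s t
      using \<sigma>_f'[of t] by (simp add: \<Phi>_def \<Psi>_def flip: blinfun.scaleR_right)
    have \<Phi>: "simple_limit (borel \<Otimes>\<^sub>M borel) (\<lambda>z. \<Phi> (fst z) (snd z))"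
      unfolding \<Phi>_def by (rule simple_limit_scaleR[OF _ \<Psi>]) (simp add: simple_limit_real)
    have \<Phi>s: "simple_limit borel (\<Phi> s)" for s
      using simple_limit_compose[OF \<Phi>, of "\<lambda>t. (s, t)" borel] by simp
    define h where "h t = (norm (f' t))\<^sup>2" for t
    have [measurable]: "h \<in> borel_measurable borel" unfolding h_def by measurable
    let ?W = "W (\<lambda>t. ennreal (h t))"
    have W_eq: "?W s = (\<integral>\<^sup>+ t. ennreal ((norm (\<Phi> s t))\<^sup>2) \<partial>lborel)" for s
      unfolding W_def
      by (intro nn_integral_cong) (simp add: \<Phi>_def u_def h_def power_mult_distrib ennreal_mult[symmetric] mult.commute)
    have L_eq: "2 * (p / 2) * C1 = L" by (simp add: L_def C1_def)
    have hp: "h t powr (p / 2) = norm (f' t) powr p" for t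
      by (cases "f' t = 0") (simp_all add: h_def powr_powr flip: powr_numeral)
    define If where "If = (\<integral>\<^sup>+ t. ennreal (norm (f t) powr p) \<partial>lebesgue)"
    have If_eq: "(\<integral>\<^sup>+ t. ennreal (norm (f' t) powr p) \<partial>lborel) = If"
      unfolding If_def nn_integral_completion
      by (rule nn_integral_cong_AE) (use f'(2) in \<open>auto elim: eventually_mono\<close>)
    have Lpf: "Lp_norm p f = ennreal_rpow If (1 / p)"
      by (simp add: Lp_norm_on_def If_def)
    have If_fin: "If < \<top>" using \<open>Lp_norm p f < \<top>\<close> unfolding Lpf by (auto simp: ennreal_rpow_def less_top[symmetric])
    have main: "(\<integral>\<^sup>+ s. ennreal_rpow (?W s) (p / 2) \<partial>lborel) \<le> ennreal (L powr (p / 2)) * If"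
      using W_Lq[of h "p / 2"] p unfolding L_eq hp If_eq by (simp add: h_def)
    also have "\<dots> < \<top>" using If_fin by (simp add: ennreal_mult_less_top)
    \<comment> \<open>Finiteness of the integral makes \<open>\<Phi> s\<close> square integrable for
      almost every s, so that the operator exists there.\<close>
    finally have "AE s in lborel. ennreal_rpow (?W s) (p / 2) \<noteq> \<infinity>"
      by (intro nn_integral_PInf_AE) (auto simp: ennreal_rpow_def)
    then have W_fin: "AE s in lborel. ?W s < \<top>"
      by eventually_elim (auto simp: ennreal_rpow_def less_top[symmetric])
    \<comment> \<open>The choice is meaningful for the good s only; elsewhere its value is arbitrary
      and affects a null set.\<close>
    define F where "F s = (SOME T. represents (\<Phi> s) T)" for s
    have good: "AE s in lborel. sq_integrable (\<Phi> s) \<and> represents (\<Phi> s) (F s)"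
      using W_fin
    proof eventually_elim
      case (elim s)
      then have sq: "sq_integrable (\<Phi> s)" unfolding W_eq by (rule sq_integrable_borelI[OF \<Phi>s])
      have "\<exists>T. represents (\<Phi> s) T" by (rule gamma_representation_exists[OF sq]) blast
      then have "represents (\<Phi> s) (F s)" unfolding F_def by (rule someI_ex)
      with sq show ?case by blast
    qed
    have "is_T (\<lambda>s t. k (s - t)) f F"
      unfolding is_T_def AE_completion_iff
      using good
    proof eventually_elim
      case (elim s)
      have "AE t in lborel. \<Phi> s t = blinfun_apply (k (s - t)) (f t)"
        using AE_shifted_null[OF N, of s] f'(2) by eventually_elim (simp add: \<Phi>_eq k'_def)
      then have "AE t in lebesgue. \<Phi> s t = blinfun_apply (k (s - t)) (f t)" by (rule AE_completion)
      then have "represents (\<lambda>t. blinfun_apply (k (s - t)) (f t)) (F s)"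
        by (rule represents_AE_cong[OF conjunct2[OF elim]])
      moreover have "F s \<in> gamma_space"
        by (rule gamma_norm_represents(1)[OF conjunct1[OF elim] conjunct2[OF elim]])
      ultimately show ?case by (rule conjI[rotated])
    qed
    moreover have "gamma_strongly_measurable F" by (rule gamma_strongly_measurableI[OF \<Phi> good])
    moreover have "Lp_norm p (\<lambda>s. gamma_norm (F s)) \<le> ennreal (sqrt L) * Lp_norm p f"
    proof -
      have "(\<integral>\<^sup>+ s. ennreal (norm (gamma_norm (F s)) powr p) \<partial>lebesgue) = (\<integral>\<^sup>+ s. ennreal_rpow (?W s) (p / 2) \<partial>lborel)"
        unfolding nn_integral_completion
      proof (rule nn_integral_cong_AE)
        show "AE s in lborel. ennreal (norm (gamma_norm (F s)) powr p) = ennreal_rpow (?W s) (p / 2)"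
          using good
        proof eventually_elim
          case (elim s)
          then have "gamma_norm (F s) = L2_norm (\<Phi> s)" by (intro gamma_norm_represents(2)) auto
          moreover have "?W s = ennreal ((L2_norm (\<Phi> s))\<^sup>2)"
            unfolding W_eq using elim by (intro sq_integrable_nn_integral) auto
          moreover have "((L2_norm (\<Phi> s))\<^sup>2) powr (p / 2) = L2_norm (\<Phi> s) powr p"
            using L2_norm_nonneg[of "\<Phi> s"]
            by (cases "L2_norm (\<Phi> s) = 0") (simp_all add: powr_powr flip: powr_numeral)
          ultimately show ?case by (simp add: ennreal_rpow_ennreal L2_norm_nonneg)
        qed
      qed
      then have "Lp_norm p (\<lambda>s. gamma_norm (F s)) = ennreal_rpow (\<integral>\<^sup>+ s. ennreal_rpow (?W s) (p / 2) \<partial>lborel) (1 / p)"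
        by (simp add: Lp_norm_on_def)
      also have "\<dots> \<le> ennreal_rpow (ennreal (L powr (p / 2)) * If) (1 / p)"
        using main p by (intro ennreal_rpow_mono) auto
      also have "\<dots> = ennreal ((L powr (p / 2)) powr (1 / p)) * ennreal_rpow If (1 / p)"
        using p by (intro ennreal_rpow_mult) auto
      also have "(L powr (p / 2)) powr (1 / p) = sqrt L"
        using p L by (simp add: powr_powr powr_half_sqrt)
      finally show ?thesis unfolding Lpf .
    qed
    ultimately show ?thesis by blast
  qed
  then show ?thesis unfolding T_bounded_by_def L_def[symmetric] using L by simp
qed

text \<open>Chebyshev's inequality for the p-th power.\<close>

lemma weak_Lp_norm_le:
  assumes "0 < p"
  shows "weak_Lp_norm p g \<le> Lp_norm p g"
  unfolding weak_Lp_norm_def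
proof (rule SUP_least)
  fix l :: real assume "l \<in> {0<..}"
  then have l: "0 < l" by simp
  let ?S = "{t. l < norm (g t)}"
  show "ennreal l * ennreal_rpow (emeasure lebesgue ?S) (1 / p) \<le> Lp_norm p g"
  proof (cases "?S \<in> sets lebesgue")
    case True
    have "ennreal (l powr p) * emeasure lebesgue ?S = (\<integral>\<^sup>+ t. ennreal (l powr p) * indicator ?S t \<partial>lebesgue)"
      by (rule nn_integral_cmult_indicator[OF True, symmetric])
    also have "\<dots> \<le> (\<integral>\<^sup>+ t. ennreal (norm (g t) powr p) \<partial>lebesgue)"
      using l assms by (intro nn_integral_mono) (auto split: split_indicator intro!: ennreal_leI powr_mono2)
    finally have "ennreal_rpow (ennreal (l powr p) * emeasure lebesgue ?S) (1 / p) \<le> Lp_norm p g"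
      unfolding Lp_norm_on_def using assms by (intro ennreal_rpow_mono) auto
    moreover have "ennreal_rpow (ennreal (l powr p) * emeasure lebesgue ?S) (1 / p) =
        ennreal l * ennreal_rpow (emeasure lebesgue ?S) (1 / p)"
      using l assms by (subst ennreal_rpow_mult) (auto simp: powr_powr)
    ultimately show ?thesis by simp
  next
    \<comment> \<open>g is arbitrary here, and \<open>emeasure\<close> assigns 0 to a level set that
      is not measurable.\<close>
    case False
    then have "emeasure lebesgue ?S = 0" by (rule emeasure_notin_sets)
    then show ?thesis by (simp add: ennreal_rpow_def)
  qed
qed

subsection \<open>Testing a weak type bound on indicators of balls\<close>

text \<open>For \<open>f = 1\<^bsub>B(0,R)\<^esub> x\<close> the weak type bound at a level comparable to \<open>C \<parallel>x\<parallel>\<close> leaves a point \<open>s\<close> of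
  \<open>B(0,R/2)\<close>, and \<open>s - B(0,R)\<close> contains \<open>B(0,R/2)\<close>.\<close>

lemma weak_bound_on_ball:
  fixes k :: "'d::euclidean_space \<Rightarrow> 'x::banach \<Rightarrow>\<^sub>L 'y::{real_inner, banach}"
  assumes T: "T_bounded_by (weak_Lp_norm p) p (\<lambda>s t. k (s - t)) C" and p: "2 \<le> p"
    and v: "simple_limit lborel v" "AE t in lborel. blinfun_apply (k t) x = v t" and x: "x \<noteq> 0" and R: "0 < R"
  shows "(\<integral>\<^sup>+ y\<in>ball 0 (R / 2). ennreal ((norm (v y))\<^sup>2) \<partial>lborel) \<le> ennreal ((2 ^ DIM('d) * (C + 1) * norm x)\<^sup>2)"
proof -
  let ?n = "DIM('d)"
  \<comment> \<open>The factor 2^d compensates that B(0, R/2) has 2^(-d) times the volume of B(0,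
    R), and exponent 1/p \<le> 1 only helps. The added 1 makes l / (2^d)^(1/p) strictly larger than
    C |x|.\<close>
  define l where "l = 2 ^ ?n * (C + 1) * norm x"
  have C: "0 \<le> C" using T by (simp add: T_bounded_by_def)
  have l: "0 < l" using C x by (simp add: l_def)
  define b where "b = unit_ball_vol ?n * R ^ ?n"
  have b: "0 < b" using R by (simp add: b_def)
  have eb: "emeasure lborel (ball (0::'d) R) = ennreal b" using R by (simp add: emeasure_ball b_def)
  have eb2: "emeasure lborel (ball (0::'d) (R / 2)) = ennreal (b / 2 ^ ?n)"
    using R by (simp add: emeasure_ball b_def power_divide)
  define f where "f t = indicator (ball 0 R) t *\<^sub>R x" for t :: 'd
  have f_lim: "simple_limit lborel f"
  proof -
    have "ball (0::'d) R \<in> sets lborel" by simp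
    then have "simple_limit lborel (indicator (ball (0::'d) R) :: 'd \<Rightarrow> real)"
      unfolding simple_limit_real by (rule borel_measurable_indicator)
    then show ?thesis unfolding f_def by (rule simple_limit_scaleR) (rule simple_limit_const)
  qed
  have "(\<integral>\<^sup>+ t. ennreal (norm (f t) powr p) \<partial>lebesgue) = (\<integral>\<^sup>+ t. ennreal (norm x powr p) * indicator (ball (0::'d) R) t \<partial>lborel)"
    unfolding nn_integral_completion using p by (intro nn_integral_cong) (auto simp: f_def split: split_indicator)
  also have "\<dots> = ennreal (norm x powr p) * ennreal b"
    by (subst nn_integral_cmult_indicator) (simp_all add: eb)
  also have "\<dots> = ennreal (norm x powr p * b)" using b by (simp add: ennreal_mult)
  finally have Lpf: "Lp_norm p f = ennreal (norm x * b powr (1 / p))"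
    using p b by (simp add: Lp_norm_on_def ennreal_rpow_ennreal powr_mult powr_powr)
  then have "f \<in> Lp_space p"
    using simple_limit_strongly_measurable[OF simple_limit_completion[OF f_lim]] by (simp add: Lp_space_def)
  then obtain F where F: "is_T (\<lambda>s t. k (s - t)) f F"
    "weak_Lp_norm p (\<lambda>s. gamma_norm (F s)) \<le> ennreal C * Lp_norm p f"
    using T unfolding T_bounded_by_def by blast
  define \<Phi> where "\<Phi> s t = indicator (ball 0 R) t *\<^sub>R v (s - t)" for s t :: 'd
  have v': "simple_limit borel v" using v(1) by (simp add: simple_limit_lborel_iff)
  have \<Phi>: "simple_limit (borel \<Otimes>\<^sub>M borel) (\<lambda>z. \<Phi> (fst z) (snd z))"
    unfolding \<Phi>_def
  proof (intro simple_limit_scaleR)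
    show "simple_limit (borel \<Otimes>\<^sub>M borel) (\<lambda>z. v (fst z - snd z))"
      by (rule simple_limit_compose[OF v']) measurable
    have [measurable]: "ball (0::'d) R \<in> sets borel" by simp
    show "simple_limit (borel \<Otimes>\<^sub>M borel) (\<lambda>z::'d \<times> 'd. indicator (ball 0 R) (snd z) :: real)"
      unfolding simple_limit_real by measurable
  qed
  have \<Phi>s: "simple_limit borel (\<Phi> s)" for s
    using simple_limit_compose[OF \<Phi>, of "\<lambda>t. (s, t)" borel] by simp
  define M where "M s = (\<integral>\<^sup>+ t. ennreal ((norm (\<Phi> s t))\<^sup>2) \<partial>lborel)" for s
  have M_meas: "M \<in> borel_measurable borel"
  proof -
    have "(\<lambda>(s, t). ennreal ((norm (\<Phi> s t))\<^sup>2)) \<in> borel_measurable (borel \<Otimes>\<^sub>M lborel)"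
      using simple_limit_norm_measurable[OF \<Phi>] by (simp add: case_prod_beta cong: measurable_cong_sets)
    from lborel.borel_measurable_nn_integral[OF this] show ?thesis unfolding M_def by simp
  qed
  have good: "AE s in lborel. M s = ennreal ((gamma_norm (F s))\<^sup>2) \<and> 0 \<le> gamma_norm (F s)"
    using F(1)[unfolded is_T_def AE_completion_iff]
  proof eventually_elim
    case (elim s)
    have "AE t in lborel. blinfun_apply (k (s - t)) (f t) = \<Phi> s t"
      using AE_lborel_reflect[OF v(2), of s] by eventually_elim (simp add: f_def \<Phi>_def blinfun.scaleR_right)
    then have "AE t in lebesgue. blinfun_apply (k (s - t)) (f t) = \<Phi> s t" by (rule AE_completion)
    then have rep: "represents (\<Phi> s) (F s)" by (rule represents_AE_cong[OF conjunct2[OF elim]])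
    have "simple_limit lebesgue (\<Phi> s)" using \<Phi>s[of s] by (simp add: simple_limit_completion simple_limit_lborel_iff)
    then have sq: "sq_integrable (\<Phi> s)" by (rule gamma_space_sq_integrable[OF conjunct1[OF elim] rep])
    show ?case
      unfolding M_def sq_integrable_nn_integral[OF sq] gamma_norm_represents(2)[OF sq rep]
      by (simp add: L2_norm_nonneg)
  qed
  \<comment> \<open>Measurability of the level set is essential: \<open>emeasure\<close> of a
    non-measurable set would be 0, and the weak bound would carry no information. It is inherited
    from M, which agrees with the squared \<gamma>-norm almost everywhere.\<close>
  have g_meas: "(\<lambda>s. gamma_norm (F s)) \<in> borel_measurable lebesgue"
  proof (rule borel_measurable_lebesgue_AE_cong)
    show "(\<lambda>s. sqrt (enn2real (M s))) \<in> borel_measurable lebesgue"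
      by (rule measurable_completion) (use M_meas in measurable)
    show "AE s in lebesgue. sqrt (enn2real (M s)) = gamma_norm (F s)"
      unfolding AE_completion_iff using good by eventually_elim simp
  qed
  define S where "S = {s. l < norm (gamma_norm (F s))}"
  have S_meas: "S \<in> sets lebesgue"
    using measurable_sets[OF measurable_compose[OF g_meas borel_measurable_norm], of "{l<..}"] by (simp add: S_def vimage_def)
  have S_less: "emeasure lebesgue S < ennreal (b / 2 ^ ?n)"
  proof (rule ccontr)
    assume "\<not> ?thesis"
    then have "ennreal_rpow (ennreal (b / 2 ^ ?n)) (1 / p) \<le> ennreal_rpow (emeasure lebesgue S) (1 / p)"
      using p by (intro ennreal_rpow_mono) auto
    then have "ennreal l * ennreal ((b / 2 ^ ?n) powr (1 / p)) \<le> ennreal l * ennreal_rpow (emeasure lebesgue S) (1 / p)"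
      using b by (intro mult_left_mono) (auto simp: ennreal_rpow_ennreal)
    also have "\<dots> \<le> weak_Lp_norm p (\<lambda>s. gamma_norm (F s))"
      unfolding weak_Lp_norm_def S_def using l by (intro SUP_upper) simp
    also have "\<dots> \<le> ennreal C * ennreal (norm x * b powr (1 / p))" using F(2) unfolding Lpf .
    finally have "ennreal (l * (b / 2 ^ ?n) powr (1 / p)) \<le> ennreal (C * (norm x * b powr (1 / p)))"
      using l C by (simp add: ennreal_mult'[symmetric] ennreal_mult''[symmetric])
    then have "l * (b / 2 ^ ?n) powr (1 / p) \<le> C * (norm x * b powr (1 / p))"
      using C by (subst (asm) ennreal_le_iff) auto
    also have "(b / 2 ^ ?n) powr (1 / p) = b powr (1 / p) / (2 ^ ?n) powr (1 / p)"
      using b by (simp add: powr_divide)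
    finally have "l / (2 ^ ?n) powr (1 / p) * b powr (1 / p) \<le> C * norm x * b powr (1 / p)" by (simp add: ac_simps)
    then have "l / (2 ^ ?n) powr (1 / p) \<le> C * norm x"
      by (rule mult_right_le_imp_le) (use b in simp)
    moreover have "(C + 1) * norm x \<le> l / (2 ^ ?n) powr (1 / p)"
    proof -
      have "((2::real) ^ ?n) powr (1 / p) \<le> (2 ^ ?n) powr 1" using p by (intro powr_mono) auto
      then have "l / 2 ^ ?n \<le> l / (2 ^ ?n) powr (1 / p)" using l by (intro divide_left_mono) auto
      then show ?thesis by (simp add: l_def)
    qed
    ultimately have "(C + 1) * norm x \<le> C * norm x" by (rule order_trans[rotated])
    then show False using x by (simp add: algebra_simps)
  qed
  obtain N where N: "N \<in> null_sets lborel" "{s. \<not> (M s = ennreal ((gamma_norm (F s))\<^sup>2) \<and> 0 \<le> gamma_norm (F s))} \<subseteq> N"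
    using good by (auto simp: eventually_ae_filter)
  \<comment> \<open>S has smaller measure than this ball, so some s in the ball avoids both S and
    the null set on which M and the \<gamma>-norm may disagree.\<close>
  have "\<not> ball 0 (R / 2) \<subseteq> S \<union> N"
  proof
    assume sub: "ball 0 (R / 2) \<subseteq> S \<union> N"
    have Nl: "N \<in> null_sets lebesgue" using N(1) by (rule null_sets_completionI)
    have "emeasure lebesgue (ball (0::'d) (R / 2)) \<le> emeasure lebesgue (S \<union> N)"
      using S_meas Nl by (intro emeasure_mono[OF sub]) auto
    also have "\<dots> = emeasure lebesgue S" using emeasure_Un_null_set[OF S_meas Nl] .
    finally show False using S_less eb2 by simp
  qed
  then obtain s where s: "s \<in> ball 0 (R / 2)" "s \<notin> S" "s \<notin> N" by blast
  then have Ms: "M s = ennreal ((gamma_norm (F s))\<^sup>2)" and "0 \<le> gamma_norm (F s)" "gamma_norm (F s) \<le> l"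
    using N(2) by (auto simp: S_def)
  then have "M s \<le> ennreal (l\<^sup>2)" by (auto intro!: ennreal_leI power_mono)
  have vm: "(\<lambda>y. norm (v y)) \<in> borel_measurable borel" by (rule simple_limit_norm_measurable[OF v'])
  have [measurable]: "ball (0::'d) R \<in> sets borel" by simp
  have "(\<integral>\<^sup>+ y\<in>ball 0 (R / 2). ennreal ((norm (v y))\<^sup>2) \<partial>lborel) \<le>
      (\<integral>\<^sup>+ y. ennreal ((norm (v y))\<^sup>2) * indicator (ball 0 R) (s - y) \<partial>lborel)"
  proof (rule nn_integral_mono)
    fix y :: 'd
    have "norm (s - y) < R" if "norm y < R / 2" using norm_triangle_ineq4[of s y] s(1) that by simp
    then show "ennreal ((norm (v y))\<^sup>2) * indicator (ball 0 (R / 2)) y \<le> ennreal ((norm (v y))\<^sup>2) * indicator (ball 0 R) (s - y)"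
      by (auto split: split_indicator)
  qed
  also have "\<dots> = (\<integral>\<^sup>+ t. ennreal ((norm (v (s - t)))\<^sup>2) * indicator (ball 0 R) t \<partial>lborel)"
    using nn_integral_lborel_reflect[of "\<lambda>y. ennreal ((norm (v y))\<^sup>2) * indicator (ball 0 R) (s - y)" s] vm by simp
  also have "\<dots> = M s"
    unfolding M_def \<Phi>_def by (intro nn_integral_cong) (auto split: split_indicator)
  finally show ?thesis using \<open>M s \<le> ennreal (l\<^sup>2)\<close> unfolding l_def by simp
qed

text \<open>The bound of \<open>weak_bound_on_ball\<close> does not depend on the radius, so Fatou's
  lemma extends it to the whole space.\<close>

lemma L2_bound_of_weak_bound:
  fixes k :: "'d::euclidean_space \<Rightarrow> 'x::banach \<Rightarrow>\<^sub>L 'y::{real_inner, banach}"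
  assumes meas: "\<And>x. strongly_measurable (\<lambda>t. blinfun_apply (k t) x)"
    and T: "T_bounded_by (weak_Lp_norm p) p (\<lambda>s t. k (s - t)) C" and p: "2 \<le> p"
  shows "Lp_norm 2 (\<lambda>t. blinfun_apply (k t) x) \<le> ennreal (2 ^ DIM('d) * (C + 1) * norm x)"
proof (cases "x = 0")
  case True
  then show ?thesis by (simp add: Lp_norm_on_def ennreal_rpow_def)
next
  case False
  let ?c = "2 ^ DIM('d) * (C + 1) * norm x"
  have C: "0 \<le> C" using T by (simp add: T_bounded_by_def)
  obtain v where v: "simple_limit lborel v" "AE t in lborel. blinfun_apply (k t) x = v t"
    by (rule strongly_measurable_borel_version[OF meas[of x]]) (rule that)
  have vm: "(\<lambda>y. norm (v y)) \<in> borel_measurable borel" using simple_limit_norm_measurable[OF v(1)] by simp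
  have bd: "(\<integral>\<^sup>+ y\<in>ball 0 (real (Suc n) / 2). ennreal ((norm (v y))\<^sup>2) \<partial>lborel) \<le> ennreal (?c\<^sup>2)" for n
    by (rule weak_bound_on_ball[OF T p v False]) simp
  have "(\<integral>\<^sup>+ y. ennreal ((norm (v y))\<^sup>2) \<partial>lborel) \<le>
      (\<integral>\<^sup>+ y. liminf (\<lambda>n. ennreal ((norm (v y))\<^sup>2) * indicator (ball 0 (real (Suc n) / 2)) y) \<partial>lborel)"
  proof (rule nn_integral_mono)
    fix y :: 'd
    obtain N :: nat where N: "2 * norm y < real N" using reals_Archimedean2 by blast
    have "\<forall>\<^sub>F n in sequentially. ennreal ((norm (v y))\<^sup>2) \<le> ennreal ((norm (v y))\<^sup>2) * indicator (ball 0 (real (Suc n) / 2)) y"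
      using eventually_ge_at_top[of N] by eventually_elim (use N in simp)
    then show "ennreal ((norm (v y))\<^sup>2) \<le> liminf (\<lambda>n. ennreal ((norm (v y))\<^sup>2) * indicator (ball 0 (real (Suc n) / 2)) y)"
      by (rule Liminf_bounded)
  qed
  also have "\<dots> \<le> liminf (\<lambda>n. \<integral>\<^sup>+ y\<in>ball 0 (real (Suc n) / 2). ennreal ((norm (v y))\<^sup>2) \<partial>lborel)"
  proof (rule nn_integral_liminf)
    have [measurable]: "ball (0::'d) \<rho> \<in> sets borel" for \<rho> by simp
    show "(\<lambda>y. ennreal ((norm (v y))\<^sup>2) * indicator (ball 0 (real (Suc n) / 2)) y) \<in> borel_measurable lborel" for n
      using vm by measurable
  qed
  also have "\<dots> \<le> liminf (\<lambda>n. ennreal (?c\<^sup>2))"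
    by (intro Liminf_mono always_eventually allI bd)
  also have "\<dots> = ennreal (?c\<^sup>2)" by (simp add: Liminf_const)
  finally have int: "(\<integral>\<^sup>+ y. ennreal ((norm (v y))\<^sup>2) \<partial>lborel) \<le> ennreal (?c\<^sup>2)" .
  have "(\<integral>\<^sup>+ t. ennreal (norm (blinfun_apply (k t) x) powr 2) \<partial>lebesgue) = (\<integral>\<^sup>+ y. ennreal ((norm (v y))\<^sup>2) \<partial>lborel)"
    unfolding nn_integral_completion
    by (rule nn_integral_cong_AE) (use v(2) in \<open>auto elim: eventually_mono simp: powr_numeral\<close>)
  then have "Lp_norm 2 (\<lambda>t. blinfun_apply (k t) x) = ennreal_rpow (\<integral>\<^sup>+ y. ennreal ((norm (v y))\<^sup>2) \<partial>lborel) (1 / 2)"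
    by (simp add: Lp_norm_on_def)
  also have "\<dots> \<le> ennreal_rpow (ennreal (?c\<^sup>2)) (1 / 2)" by (rule ennreal_rpow_mono[OF int]) simp
  also have "\<dots> = ennreal ?c" using C by (simp add: ennreal_rpow_ennreal powr_half_sqrt)
  finally show ?thesis .
qed

text \<open>With D = 1000 d, the factor D^p absorbs 4 p, since exp 4 \<le> 81 \<le> D, and D^d
  absorbs (12 d)^d. As \<open>C_pd\<close> is at least 1, it is at most its square, and A^2 + H^2
  \<le> (A + H)^2 allows the root to be taken.\<close>

lemma C_pd_bound:
  assumes "1 \<le> d" "2 \<le> p" "0 \<le> A" "0 \<le> H"
  shows "sqrt (p * (4 * (12 * real d) ^ d * A\<^sup>2 + 4 * H\<^sup>2)) \<le> C_pd p d * (A + H)"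
proof -
  define D where "D = 1000 * real d"
  have D: "1000 \<le> D" using assms(1) by (simp add: D_def)
  have d1: "1 \<le> (12 * real d) ^ d" using assms(1) by (intro one_le_power) auto
  have "4 * p \<le> D powr p"
  proof -
    have "exp 4 = exp (1::real) ^ 4" by (simp flip: exp_of_nat_mult)
    also have "\<dots> \<le> 3 ^ 4" by (intro power_mono exp_le) simp
    finally have "exp (4::real) \<le> D" using D by simp
    then have "4 \<le> ln D" using D by (simp add: ln_ge_iff)
    then have "p * 4 \<le> p * ln D" using assms(2) by (intro mult_left_mono) auto
    also have "\<dots> \<le> exp (p * ln D)" using exp_ge_add_one_self[of "p * ln D"] by linarith
    finally show ?thesis using D by (simp add: powr_def)
  qed
  moreover have "(12 * real d) ^ d \<le> D powr real d"
    using D by (simp add: powr_realpow D_def power_mono)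
  ultimately have "4 * p * (12 * real d) ^ d \<le> D powr p * D powr real d"
    using assms(2) by (intro mult_mono) auto
  also have "\<dots> = D powr (p + real d)" by (simp add: powr_add)
  also have "\<dots> \<le> (D powr (p + real d))\<^sup>2"
    using D assms(2) by (intro self_le_power ge_one_powr_ge_zero) auto
  finally have "4 * p * (12 * real d) ^ d \<le> (C_pd p d)\<^sup>2" by (simp add: C_pd_def D_def)
  have "p * (4 * (12 * real d) ^ d * A\<^sup>2 + 4 * H\<^sup>2) \<le> 4 * p * (12 * real d) ^ d * (A\<^sup>2 + H\<^sup>2)"
    using d1 assms(2) mult_right_mono[OF d1, of "p * H\<^sup>2"] by (simp add: algebra_simps)
  also have "\<dots> \<le> (C_pd p d)\<^sup>2 * (A + H)\<^sup>2"
    using assms \<open>4 * p * (12 * real d) ^ d \<le> (C_pd p d)\<^sup>2\<close> by (intro mult_mono) (auto simp: power2_sum)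
  also have "\<dots> = (C_pd p d * (A + H))\<^sup>2" by (simp add: power_mult_distrib)
  finally have "sqrt (p * (4 * (12 * real d) ^ d * A\<^sup>2 + 4 * H\<^sup>2)) \<le> sqrt ((C_pd p d * (A + H))\<^sup>2)"
    by (rule real_sqrt_le_mono)
  also have "\<dots> = C_pd p d * (A + H)" using assms by (simp add: C_pd_def)
  finally show ?thesis .
qed

theorem corollary5p10:
  fixes k :: "'d::euclidean_space \<Rightarrow> 'x::banach \<Rightarrow>\<^sub>L 'y::{real_inner, banach}"
    and K :: "'d \<Rightarrow> 'd \<Rightarrow> 'x \<Rightarrow>\<^sub>L 'y"
  assumes meas: "\<And>x. strongly_measurable (\<lambda>t. blinfun_apply (k t) x)"
    and hormander: "Hormander2_conv k"
    and K_def: "K = (\<lambda>s t. k (s - t))"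
  shows
    "((\<exists>A\<^sub>0>0. \<forall>x. Lp_norm 2 (\<lambda>t. blinfun_apply (k t) x) \<le> ennreal (A\<^sub>0 * norm x))
        \<longleftrightarrow> (\<forall>p\<ge>2. K \<in> K_gamma_Lp p))
     \<and> ((\<forall>p\<ge>2. K \<in> K_gamma_Lp p) \<longleftrightarrow> (\<exists>p\<ge>2. K \<in> K_gamma_weak_Lp p))
     \<and> (\<forall>p\<ge>2. \<forall>A\<^sub>0>0. (\<forall>x. Lp_norm 2 (\<lambda>t. blinfun_apply (k t) x) \<le> ennreal (A\<^sub>0 * norm x))
          \<longrightarrow> K_gamma_Lp_norm p K \<le> ennreal (C_pd p DIM('d)) * (ennreal A\<^sub>0 + Hormander2_norm K))"
  proof -
  let ?L2 = "\<lambda>A\<^sub>0. \<forall>x. Lp_norm 2 (\<lambda>t. blinfun_apply (k t) x) \<le> ennreal (A\<^sub>0 * norm x)"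
  let ?c = "\<lambda>p A H. sqrt (p * (4 * (12 * real DIM('d)) ^ DIM('d) * A\<^sup>2 + 4 * H\<^sup>2))"
  have strong: "T_bounded_by (Lp_norm p) p K (?c p A H)"
    if "hormander_bound k H" "0 < A" "?L2 A" "2 \<le> p" for p A H
    unfolding K_def using that by (intro T_bounded_by_of_hormander[OF meas]) auto
  have 12: "\<forall>p\<ge>2. K \<in> K_gamma_Lp p" if h: "\<exists>A\<^sub>0>0. ?L2 A\<^sub>0"
  proof -
    obtain H where H: "hormander_bound k H" by (rule hormander_bound_conv[OF hormander])
    obtain A where A: "0 < A" "?L2 A" using h by blast
    show ?thesis using strong[OF H A] by (auto simp: K_gamma_Lp_def)
  qed
  have 23: "\<exists>p\<ge>2. K \<in> K_gamma_weak_Lp p" if h: "\<forall>p\<ge>2. K \<in> K_gamma_Lp p"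
  proof -
    have "K \<in> K_gamma_Lp 2" using h by simp
    then obtain C where C: "T_bounded_by (Lp_norm 2) 2 K C" unfolding K_gamma_Lp_def by blast
    have "weak_Lp_norm 2 g \<le> Lp_norm 2 g" for g :: "'d \<Rightarrow> real" by (rule weak_Lp_norm_le) simp
    then have "T_bounded_by (weak_Lp_norm 2) 2 K C"
      using C unfolding T_bounded_by_def by (meson order_trans)
    then have "K \<in> K_gamma_weak_Lp 2" by (auto simp: K_gamma_weak_Lp_def)
    then show ?thesis by auto
  qed
  have 31: "\<exists>A\<^sub>0>0. ?L2 A\<^sub>0" if h: "\<exists>p\<ge>2. K \<in> K_gamma_weak_Lp p"
  proof -
    obtain p C where p: "2 \<le> p" and C: "T_bounded_by (weak_Lp_norm p) p (\<lambda>s t. k (s - t)) C"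
      using h unfolding K_gamma_weak_Lp_def K_def by blast
    have "0 \<le> C" using C by (simp add: T_bounded_by_def)
    then have "0 < 2 ^ DIM('d) * (C + 1)" by simp
    moreover have "?L2 (2 ^ DIM('d) * (C + 1))" using L2_bound_of_weak_bound[OF meas C p] by blast
    ultimately show ?thesis by blast
  qed
  have norm: "K_gamma_Lp_norm p K \<le> ennreal (C_pd p DIM('d)) * (ennreal A + Hormander2_norm K)"
    if p: "2 \<le> p" and A: "0 < A" "?L2 A" for p A
  proof (cases "Hormander2_norm K")
    case (real H)
    \<comment> \<open>The equivalences take H from the displayed condition on k. Here H is the value
      of \<open>Hormander2_norm K\<close> itself, so that the estimate carries the stated
      constant.\<close>
    have "hormander_bound k H" using hormander_bound_kernel[of k H] real unfolding K_def by blast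
    then have "T_bounded_by (Lp_norm p) p K (?c p A H)" by (rule strong[OF _ A p])
    then have "K_gamma_Lp_norm p K \<le> ennreal (?c p A H)"
      unfolding K_gamma_Lp_norm_def by (intro INF_lower) simp
    also have "\<dots> \<le> ennreal (C_pd p DIM('d) * (A + H))"
      using A(1) real(1) p by (intro ennreal_leI C_pd_bound) (auto simp: DIM_positive Suc_leI)
    also have "\<dots> = ennreal (C_pd p DIM('d)) * (ennreal A + Hormander2_norm K)"
      using A(1) real by (simp add: ennreal_mult C_pd_def)
    finally show ?thesis .
  next
    case top
    \<comment> \<open>A positive factor times an infinite Hoermander norm is infinite, so the
      estimate is trivial in this case.\<close>
    have "0 < C_pd p DIM('d)" by (simp add: C_pd_def)
    then show ?thesis using top by (simp add: ennreal_mult_top)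
  qed
  show ?thesis
  proof (intro conjI)
    show "(\<exists>A\<^sub>0>0. ?L2 A\<^sub>0) \<longleftrightarrow> (\<forall>p\<ge>2. K \<in> K_gamma_Lp p)" using 12 23 31 by blast
    show "(\<forall>p\<ge>2. K \<in> K_gamma_Lp p) \<longleftrightarrow> (\<exists>p\<ge>2. K \<in> K_gamma_weak_Lp p)" using 12 23 31 by blast
    show "\<forall>p\<ge>2. \<forall>A\<^sub>0>0. ?L2 A\<^sub>0 \<longrightarrow>
        K_gamma_Lp_norm p K \<le> ennreal (C_pd p DIM('d)) * (ennreal A\<^sub>0 + Hormander2_norm K)"
      using norm by blast
  qed
qed

end
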